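(* Let $N$ be a positive integer. Let $A$ be a Jacobi matrix with $N$-periodically modulated entries, associated with sequences $(a_n : n \in \mathbb{N}_0)$ and $(b_n : n \in \mathbb{N}_0)$, so that $\mathfrak{X}_0(0) = \sigma \operatorname{Id}$ for a certain $\sigma \in \{-1, 1\}$. Assume that there are $i \in \{0, 1, \ldots, N-1\}$ and a sequence of positive numbers $(\gamma_n : n \in \mathbb{N}_0)$ satisfying $$\sum_{n=0}^\infty \frac{1}{\gamma_n} = \infty,$$ such that $R_{nN+i}(0) = \gamma_n \big(X_{nN+i}(0) - \sigma \operatorname{Id} \big)$ converges to a non-zero matrix $\mathcal{R}_i$. If $\big( R_{nN+i}(0) : n \in \mathbb{N} \big)$ belongs to $\mathcal{D}_1 \big( \operatorname{Mat}(2, \mathbb{R}) \big)$, $\operatorname{discr} \mathcal{R}_i > 0$, and $$\sum_{n=0}^\infty \frac{1}{a_n} < \infty,$$ then $A$ is self-adjoint if and only if there is $n_0 \geq 1$ such that $$\sum_{n=n_0}^{\infty} \prod_{j=n_0}^n \bigg| 1 + \frac{\sigma \operatorname{tr} R_{jN+i}(0) + \sqrt{\operatorname{discr} R_{jN+i}(0)}}{2 \gamma_j} \bigg|^2 = \infty.$$ Moreover, if $A$ is self-adjoint, then $\sigma_{\mathrm{ess}}(A) = \emptyset$.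
   Context: $\mathbb{N}=\{1,2,\dots\}$, $\mathbb{N}_0=\mathbb{N}\cup\{0\}$. Given $a_n>0$ and $b_n\in\mathbb{R}$ ($n\in\mathbb{N}_0$), the Jacobi matrix $A$ is the closure in $\ell^2(\mathbb{N}_0)$ of the operator acting on finitely supported sequences by the symmetric tridiagonal matrix with diagonal entries $b_0,b_1,\ldots$ and off-diagonal entries $a_0,a_1,\ldots$, i.e. $(Ax)_0=b_0x_0+a_0x_1$ and $(Ax)_n=a_{n-1}x_{n-1}+b_nx_n+a_nx_{n+1}$ for $n\ge1$. $\sigma_{\mathrm{ess}}(A)$ denotes the essential spectrum of a self-adjoint $A$. $A$ has $N$-periodically modulated entries if there are $N$-periodic sequences $(\alpha_n:n\in\mathbb{Z})$ of positive numbers and $(\beta_n:n\in\mathbb{Z})$ of real numbers such that $a_n\to\infty$, $\left|\frac{a_{n-1}}{a_n}-\frac{\alpha_{n-1}}{\alpha_n}\right|\to0$ and $\left|\frac{b_n}{a_n}-\frac{\beta_n}{\alpha_n}\right|\to0$ as $n\to\infty$. Transfer matrices: for $j\ge1$, $B_j(x)=\begin{pmatrix}0&1\\-\frac{a_{j-1}}{a_j}&\frac{x-b_j}{a_j}\end{pmatrix}$, $X_n(x)=B_{n+N-1}(x)\cdots B_{n+1}(x)B_n(x)$ for $n\ge1$; for $j\in\mathbb{Z}$, $\mathfrak{B}_j(x)=\begin{pmatrix}0&1\\-\frac{\alpha_{j-1}}{\alpha_j}&\frac{x-\beta_j}{\alpha_j}\end{pmatrix}$, $\mathfrak{X}_n(x)=\mathfrak{B}_{n+N-1}(x)\cdots\mathfrak{B}_{n+1}(x)\mathfrak{B}_n(x)$.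 For a real $2\times2$ matrix $X$, $\operatorname{discr}X=(\operatorname{tr}X)^2-4\det X$. The square root of a negative number $t$ is understood as $\mathrm{i}\sqrt{|t|}$ (this can occur only for finitely many $j$). $\operatorname{Mat}(2,\mathbb{R})$ carries the operator norm. A sequence $(x_n:n\in\mathbb{N})$ in a normed space $V$ belongs to $\mathcal{D}_1(V)$ if it is bounded and $\sum_{n=1}^\infty\|x_{n+1}-x_n\|<\infty$. *)

theory Defs
  imports "HOL-Analysis.Analysis"
begin

section \<open>Unbounded operators on the complex Hilbert space of square-summable sequences\<close>

definition ell2 :: "(nat \<Rightarrow> complex) set" where
  "ell2 = {x. summable (\<lambda>n. (cmod (x n))\<^sup>2)}"

definition ell2_norm :: "(nat \<Rightarrow> complex) \<Rightarrow> real" where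
  "ell2_norm x = sqrt (\<Sum>n. (cmod (x n))\<^sup>2)"

definition ell2_inner :: "(nat \<Rightarrow> complex) \<Rightarrow> (nat \<Rightarrow> complex) \<Rightarrow> complex" where
  "ell2_inner x y = (\<Sum>n. x n * cnj (y n))"

text \<open>An operator is represented by its graph, a set of pairs of elements of \<open>ell2\<close>.\<close>

type_synonym ell2_op = "((nat \<Rightarrow> complex) \<times> (nat \<Rightarrow> complex)) set"

definition op_closure :: "ell2_op \<Rightarrow> ell2_op" where
  "op_closure T = {(x, y). x \<in> ell2 \<and> y \<in> ell2 \<and>
     (\<forall>e>0. \<exists>(u, v)\<in>T. ell2_norm (\<lambda>n. x n - u n) < e \<and> ell2_norm (\<lambda>n. y n - v n) < e)}"

definition densely_defined :: "ell2_op \<Rightarrow> bool" where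
  "densely_defined T \<longleftrightarrow>
     (\<forall>x\<in>ell2. \<forall>e>0. \<exists>(u, v)\<in>T. ell2_norm (\<lambda>n. x n - u n) < e)"

definition op_adjoint :: "ell2_op \<Rightarrow> ell2_op" where
  "op_adjoint T = {(y, z). y \<in> ell2 \<and> z \<in> ell2 \<and>
     (\<forall>(u, v)\<in>T. ell2_inner v y = ell2_inner u z)}"

text \<open>The adjoint of a densely defined operator is single-valued, so a self-adjoint graph is
  automatically the graph of a function.\<close>

definition self_adjoint :: "ell2_op \<Rightarrow> bool" where
  "self_adjoint T \<longleftrightarrow> densely_defined T \<and> op_adjoint T = T"

text \<open>\<open>T - z\<close> maps the domain of \<open>T\<close> bijectively onto \<open>ell2\<close> and has a bounded inverse.\<close>

definition resolvent_set :: "ell2_op \<Rightarrow> complex set" where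
  "resolvent_set T = {z.
     (\<forall>y\<in>ell2. \<exists>!x. (x, \<lambda>n. z * x n + y n) \<in> T) \<and>
     (\<exists>C. \<forall>(x, w)\<in>T. ell2_norm x \<le> C * ell2_norm (\<lambda>n. w n - z * x n))}"

definition op_spectrum :: "ell2_op \<Rightarrow> complex set" where
  "op_spectrum T = - resolvent_set T"

definition eigenspace :: "ell2_op \<Rightarrow> complex \<Rightarrow> (nat \<Rightarrow> complex) set" where
  "eigenspace T z = {x. (x, \<lambda>n. z * x n) \<in> T}"

definition finite_dimensional :: "(nat \<Rightarrow> complex) set \<Rightarrow> bool" where
  "finite_dimensional E \<longleftrightarrow>
     (\<exists>F. finite F \<and> (\<forall>x\<in>E. \<exists>c. x = (\<lambda>n. \<Sum>f\<in>F. c f * f n)))"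

text \<open>The discrete spectrum consists of the isolated points of the spectrum that are eigenvalues
  of finite multiplicity; for self-adjoint operators its complement in the spectrum is the
  essential spectrum.\<close>

definition discrete_spectrum :: "ell2_op \<Rightarrow> complex set" where
  "discrete_spectrum T = {z. z isolated_in op_spectrum T \<and>
     (\<exists>x\<in>eigenspace T z. x \<noteq> (\<lambda>n. 0)) \<and> finite_dimensional (eigenspace T z)}"

definition essential_spectrum :: "ell2_op \<Rightarrow> complex set" where
  "essential_spectrum T = op_spectrum T - discrete_spectrum T"


section \<open>Jacobi matrices\<close>

definition jacobi_action ::
  "(nat \<Rightarrow> real) \<Rightarrow> (nat \<Rightarrow> real) \<Rightarrow> (nat \<Rightarrow> complex) \<Rightarrow> nat \<Rightarrow> complex" where
  "jacobi_action a b x n =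
     (if n = 0 then of_real (b 0) * x 0 + of_real (a 0) * x 1
      else of_real (a (n - 1)) * x (n - 1) + of_real (b n) * x n + of_real (a n) * x (n + 1))"

definition jacobi_matrix :: "(nat \<Rightarrow> real) \<Rightarrow> (nat \<Rightarrow> real) \<Rightarrow> ell2_op" where
  "jacobi_matrix a b = op_closure {(x, jacobi_action a b x) | x. finite {n. x n \<noteq> 0}}"

definition periodically_modulated ::
  "nat \<Rightarrow> (int \<Rightarrow> real) \<Rightarrow> (int \<Rightarrow> real) \<Rightarrow> (nat \<Rightarrow> real) \<Rightarrow> (nat \<Rightarrow> real) \<Rightarrow> bool" where
  "periodically_modulated N \<alpha> \<beta> a b \<longleftrightarrow>
     (\<forall>j. \<alpha> (j + int N) = \<alpha> j \<and> \<alpha> j > 0) \<and> (\<forall>j. \<beta> (j + int N) = \<beta> j) \<and>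
     filterlim a at_top sequentially \<and>
     (\<lambda>n. \<bar>a (n - 1) / a n - \<alpha> (int n - 1) / \<alpha> (int n)\<bar>) \<longlonglongrightarrow> 0 \<and>
     (\<lambda>n. \<bar>b n / a n - \<beta> (int n) / \<alpha> (int n)\<bar>) \<longlonglongrightarrow> 0"


section \<open>Transfer matrices\<close>

text \<open>Only meaningful for \<open>j \<ge> 1\<close>, since \<open>j - 1\<close> is truncated at \<open>0\<close>.\<close>

definition transfer_matrix ::
  "(nat \<Rightarrow> real) \<Rightarrow> (nat \<Rightarrow> real) \<Rightarrow> nat \<Rightarrow> real \<Rightarrow> real^2^2" where
  "transfer_matrix a b j x =
     vector [vector [0, 1], vector [- (a (j - 1) / a j), (x - b j) / a j]]"

definition periodic_transfer_matrix ::
  "(int \<Rightarrow> real) \<Rightarrow> (int \<Rightarrow> real) \<Rightarrow> int \<Rightarrow> real \<Rightarrow> real^2^2" where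
  "periodic_transfer_matrix \<alpha> \<beta> j x =
     vector [vector [0, 1], vector [- (\<alpha> (j - 1) / \<alpha> j), (x - \<beta> j) / \<alpha> j]]"

text \<open>\<open>left_prod M k = M (k - 1) ** \<dots> ** M 1 ** M 0\<close>\<close>

primrec left_prod :: "(nat \<Rightarrow> real^2^2) \<Rightarrow> nat \<Rightarrow> real^2^2" where
  "left_prod M 0 = mat 1"
| "left_prod M (Suc k) = M k ** left_prod M k"

definition N_step_transfer ::
  "nat \<Rightarrow> (nat \<Rightarrow> real) \<Rightarrow> (nat \<Rightarrow> real) \<Rightarrow> nat \<Rightarrow> real \<Rightarrow> real^2^2" where
  "N_step_transfer N a b n x = left_prod (\<lambda>k. transfer_matrix a b (n + k) x) N"

definition periodic_N_step_transfer ::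
  "nat \<Rightarrow> (int \<Rightarrow> real) \<Rightarrow> (int \<Rightarrow> real) \<Rightarrow> int \<Rightarrow> real \<Rightarrow> real^2^2" where
  "periodic_N_step_transfer N \<alpha> \<beta> n x =
     left_prod (\<lambda>k. periodic_transfer_matrix \<alpha> \<beta> (n + int k) x) N"

definition discr :: "real^2^2 \<Rightarrow> real" where
  "discr X = (trace X)\<^sup>2 - 4 * det X"

text \<open>Sequences indexed from \<open>1\<close>: the value at \<open>0\<close> is ignored.\<close>

definition D1 :: "(nat \<Rightarrow> 'v::real_normed_vector) \<Rightarrow> bool" where
  "D1 x \<longleftrightarrow> bounded (x ` {1..}) \<and> summable (\<lambda>n. norm (x (n + 2) - x (n + 1)))"

text \<open>The library norm on \<open>real^2^2\<close> is not the operator norm, whereas the norm on bounded linear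
  maps is.\<close>

definition mat_op :: "real^2^2 \<Rightarrow> (real^2) \<Rightarrow>\<^sub>L (real^2)" where
  "mat_op M = Blinfun (\<lambda>v. M *v v)"

end

theory Submission
  imports Defs
begin

text \<open>
Everything is decided by the real solutions of the three-term recurrence at energy zero.

Two consecutive values of such a solution, read off at the positions \<open>k N + i\<close>, evolve by
\<open>\<sigma> (Id + \<epsilon>\<^sub>k S\<^sub>k)\<close> with \<open>\<epsilon>\<^sub>k = 1 / \<gamma>\<^sub>k\<close> and \<open>S\<^sub>k = \<sigma> R\<^sub>k\<close>. Since \<open>R\<^sub>k\<close> has a non-zero limit
while the increments \<open>R\<^sub>k / \<gamma>\<^sub>k\<close> vanish, \<open>\<epsilon>\<^sub>k\<close> tends to \<open>0\<close>; and \<open>S\<^sub>k\<close> has bounded variation and a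
limit with two distinct real eigenvalues. In coordinates given by left eigenvectors of \<open>S\<^sub>k\<close> the
system is therefore diagonal up to a summable error, and a discrete Levinson argument
(\<open>solution_dichotomy\<close>) yields a dominant solution \<open>\<phi>\<close> comparable in size to \<open>P\<^sub>k\<close>, the
product of the numbers \<open>1 + \<epsilon>\<^sub>j \<mu>\<^sub>j\<^sup>+\<close> over large \<open>j < k\<close>, and a recessive solution \<open>\<psi>\<close> bounded by a
multiple of \<open>Q\<^sub>k\<close>, the product of the \<open>1 + \<epsilon>\<^sub>j \<mu>\<^sub>j\<^sup>-\<close>; here \<open>\<mu>\<^sub>j\<^sup>+\<close> and \<open>\<mu>\<^sub>j\<^sup>-\<close> are the larger and the smaller
eigenvalue of \<open>S\<^sub>j\<close>. Apart from finitely many factors, which do not affect convergence, the series in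
the theorem is the sum of the \<open>P\<^sub>k\<^sup>2\<close>, so it diverges exactly when \<open>\<phi>\<close> is not square-summable.

The determinants of the transfer matrices telescope, hence \<open>P\<^sub>k Q\<^sub>k\<close> is a multiple of
\<open>1 / a\<close> at the sampled position, and \<open>P\<^sub>k / Q\<^sub>k\<close> is non-decreasing. Together this gives
\<open>\<bar>\<phi>\<^sub>m \<psi>\<^sub>n\<bar> \<le> h\<^sub>m h\<^sub>n\<close> for \<open>m \<le> n\<close> with \<open>h\<^sub>n\<close> a multiple of \<open>1 / sqrt a\<^sub>n\<close>
(\<open>sampled_bounds_dichotomy\<close>), and \<open>h\<close> is square-summable because the \<open>1 / a\<^sub>n\<close> are summable.

This single bound carries the operator theory. It says that the Green kernel built from \<open>\<phi>\<close> and \<open>\<psi>\<close>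
is Hilbert-Schmidt; and since \<open>Q\<^sub>k \<le> P\<^sub>k\<close>, the sequence \<open>h\<close> dominates \<open>\<psi>\<close> as well. If \<open>\<phi>\<close> is square-summable too, the boundary form of
the maximal operator does not vanish, and the Jacobi matrix is not self-adjoint. If \<open>\<phi>\<close> is not
square-summable, every element of the maximal domain is a Green potential plus a multiple of \<open>\<psi>\<close>
and can be approximated by finitely supported sequences (\<open>self_adjoint_iff\<close>). The same
representation dominates the entries of \<open>x\<close> by \<open>h\<close> times its graph norm, so bounded sets in the graph
norm are precompact; hence the spectrum consists of isolated simple eigenvalues
(\<open>essential_spectrum_empty\<close>).
\<close>

section \<open>Square-summable sequences\<close>

lemma summable_mult_of_squares:
  fixes f g :: "nat \<Rightarrow> real"
  assumes "summable (\<lambda>n. (f n)\<^sup>2)" "summable (\<lambda>n. (g n)\<^sup>2)"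
  shows "summable (\<lambda>n. \<bar>f n\<bar> * \<bar>g n\<bar>)"
proof (rule summable_comparison_test')
  show "summable (\<lambda>n. (f n)\<^sup>2 + (g n)\<^sup>2)" using assms by (rule summable_add)
  fix n
  have "2 * (\<bar>f n\<bar> * \<bar>g n\<bar>) \<le> (f n)\<^sup>2 + (g n)\<^sup>2"
    using zero_le_power2 [of "\<bar>f n\<bar> - \<bar>g n\<bar>"] unfolding power2_diff by simp
  moreover have "0 \<le> \<bar>f n\<bar> * \<bar>g n\<bar>" by simp
  ultimately have "\<bar>f n\<bar> * \<bar>g n\<bar> \<le> (f n)\<^sup>2 + (g n)\<^sup>2" by linarith
  then show "norm (\<bar>f n\<bar> * \<bar>g n\<bar>) \<le> (f n)\<^sup>2 + (g n)\<^sup>2" by simp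
qed

lemma L2_set_le_suminf:
  assumes "summable (\<lambda>n. (f n)\<^sup>2)"
  shows "L2_set f {..<n} \<le> sqrt (\<Sum>n. (f n)\<^sup>2)"
  unfolding L2_set_def using assms by (intro real_sqrt_le_mono sum_le_suminf) auto

lemma suminf_cauchy_schwarz:
  fixes f g :: "nat \<Rightarrow> real"
  assumes f: "summable (\<lambda>n. (f n)\<^sup>2)" and g: "summable (\<lambda>n. (g n)\<^sup>2)"
  shows "(\<Sum>n. \<bar>f n\<bar> * \<bar>g n\<bar>) \<le> sqrt (\<Sum>n. (f n)\<^sup>2) * sqrt (\<Sum>n. (g n)\<^sup>2)"
proof (rule suminf_le_const)
  show "summable (\<lambda>n. \<bar>f n\<bar> * \<bar>g n\<bar>)" by (rule summable_mult_of_squares [OF f g])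
  fix n
  have "(\<Sum>i<n. \<bar>f i\<bar> * \<bar>g i\<bar>) \<le> L2_set f {..<n} * L2_set g {..<n}"
    by (rule L2_set_mult_ineq)
  also have "\<dots> \<le> sqrt (\<Sum>n. (f n)\<^sup>2) * sqrt (\<Sum>n. (g n)\<^sup>2)"
    using L2_set_le_suminf [OF f, of n] L2_set_le_suminf [OF g, of n]
    by (intro mult_mono) (auto simp: suminf_nonneg f)
  finally show "(\<Sum>i<n. \<bar>f i\<bar> * \<bar>g i\<bar>) \<le> sqrt (\<Sum>n. (f n)\<^sup>2) * sqrt (\<Sum>n. (g n)\<^sup>2)" .
qed

lemma ell2_add:
  assumes "x \<in> ell2" "y \<in> ell2" shows "(\<lambda>n. x n + y n) \<in> ell2"
proof -
  have "summable (\<lambda>n. 2 * ((cmod (x n))\<^sup>2 + (cmod (y n))\<^sup>2))"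
    using assms unfolding ell2_def by (intro summable_mult summable_add) auto
  moreover have "norm ((cmod (x n + y n))\<^sup>2) \<le> 2 * ((cmod (x n))\<^sup>2 + (cmod (y n))\<^sup>2)" for n
  proof -
    have "(cmod (x n + y n))\<^sup>2 \<le> (cmod (x n) + cmod (y n))\<^sup>2"
      by (intro power_mono norm_triangle_ineq) auto
    moreover have "0 \<le> (cmod (x n) - cmod (y n))\<^sup>2" by simp
    ultimately show ?thesis unfolding power2_sum power2_diff by simp
  qed
  ultimately show ?thesis
    unfolding ell2_def by (auto intro: summable_comparison_test')
qed

lemma ell2_scale: "x \<in> ell2 \<Longrightarrow> (\<lambda>n. c * x n) \<in> ell2"
  unfolding ell2_def by (simp add: norm_mult power_mult_distrib summable_mult)

lemma ell2_diff:
  assumes "x \<in> ell2" "y \<in> ell2" shows "(\<lambda>n. x n - y n) \<in> ell2"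
  using ell2_add [OF assms(1) ell2_scale [OF assms(2), of "-1"]] by simp

lemma ell2_finite_support: "finite {n. x n \<noteq> 0} \<Longrightarrow> x \<in> ell2"
  unfolding ell2_def by (auto intro!: summable_finite [of "{n. x n \<noteq> 0}"])

lemma ell2_dominated:
  assumes "summable (\<lambda>n. (h n)\<^sup>2)" "\<And>n. cmod (x n) \<le> C * h n"
  shows "x \<in> ell2"
proof -
  have "summable (\<lambda>n. C\<^sup>2 * (h n)\<^sup>2)" using assms(1) by (rule summable_mult)
  moreover have "norm ((cmod (x n))\<^sup>2) \<le> C\<^sup>2 * (h n)\<^sup>2" for n
    using power_mono [OF assms(2) [of n] norm_ge_zero, of 2] by (simp add: power_mult_distrib)
  ultimately show ?thesis unfolding ell2_def mem_Collect_eq by (rule summable_comparison_test')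
qed

lemma ell2_norm_dominated:
  assumes "summable (\<lambda>n. (h n)\<^sup>2)" "\<And>n. cmod (x n) \<le> C * h n" "0 \<le> C"
  shows "ell2_norm x \<le> C * sqrt (\<Sum>n. (h n)\<^sup>2)"
proof -
  have "(\<Sum>n. (cmod (x n))\<^sup>2) \<le> (\<Sum>n. C\<^sup>2 * (h n)\<^sup>2)"
    using ell2_dominated [OF assms(1,2)] assms power_mono [OF assms(2) norm_ge_zero, of _ 2]
    by (intro suminf_le summable_mult) (auto simp: power_mult_distrib ell2_def)
  also have "\<dots> = C\<^sup>2 * (\<Sum>n. (h n)\<^sup>2)" using assms(1) by (rule suminf_mult)
  finally have "ell2_norm x \<le> sqrt (C\<^sup>2 * (\<Sum>n. (h n)\<^sup>2))"
    unfolding ell2_norm_def by (rule real_sqrt_le_mono)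
  then show ?thesis using assms(3) by (simp add: real_sqrt_mult)
qed

lemma ell2_norm_nonneg: "x \<in> ell2 \<Longrightarrow> 0 \<le> ell2_norm x"
  unfolding ell2_norm_def ell2_def by (simp add: suminf_nonneg)

lemma ell2_norm_scale: "x \<in> ell2 \<Longrightarrow> ell2_norm (\<lambda>n. c * x n) = cmod c * ell2_norm x"
  unfolding ell2_norm_def ell2_def
  by (simp add: norm_mult power_mult_distrib suminf_mult real_sqrt_mult)

lemma ell2_norm_triangle:
  assumes x: "x \<in> ell2" and y: "y \<in> ell2"
  shows "ell2_norm (\<lambda>n. x n + y n) \<le> ell2_norm x + ell2_norm y"
proof -
  have sx: "summable (\<lambda>n. (cmod (x n))\<^sup>2)" and sy: "summable (\<lambda>n. (cmod (y n))\<^sup>2)"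
    using assms by (auto simp: ell2_def)
  have "(\<Sum>n. (cmod (x n + y n))\<^sup>2) \<le> (ell2_norm x + ell2_norm y)\<^sup>2"
  proof (rule suminf_le_const)
    show "summable (\<lambda>n. (cmod (x n + y n))\<^sup>2)" using ell2_add [OF assms] by (simp add: ell2_def)
    fix n
    have "L2_set (\<lambda>i. cmod (x i + y i)) {..<n} \<le> L2_set (\<lambda>i. cmod (x i) + cmod (y i)) {..<n}"
      by (intro L2_set_mono norm_triangle_ineq) auto
    also have "\<dots> \<le> L2_set (\<lambda>i. cmod (x i)) {..<n} + L2_set (\<lambda>i. cmod (y i)) {..<n}"
      by (rule L2_set_triangle_ineq)
    also have "\<dots> \<le> ell2_norm x + ell2_norm y"
      unfolding ell2_norm_def by (intro add_mono L2_set_le_suminf sx sy)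
    finally have "(L2_set (\<lambda>i. cmod (x i + y i)) {..<n})\<^sup>2 \<le> (ell2_norm x + ell2_norm y)\<^sup>2"
      by (intro power_mono L2_set_nonneg)
    then show "(\<Sum>i<n. (cmod (x i + y i))\<^sup>2) \<le> (ell2_norm x + ell2_norm y)\<^sup>2"
      by (simp add: L2_set_def sum_nonneg)
  qed
  then show ?thesis
    unfolding ell2_norm_def [of "\<lambda>n. x n + y n"]
    by (intro real_le_lsqrt) (use assms ell2_norm_nonneg ell2_norm_def in auto)
qed

lemma cmod_le_ell2_norm:
  assumes "x \<in> ell2" shows "cmod (x n) \<le> ell2_norm x"
proof -
  have "(cmod (x n))\<^sup>2 \<le> (\<Sum>n. (cmod (x n))\<^sup>2)"
    using assms sum_le_suminf [of "\<lambda>n. (cmod (x n))\<^sup>2" "{n}"] by (simp add: ell2_def)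
  then show ?thesis unfolding ell2_norm_def by (rule real_le_rsqrt)
qed

lemma ell2_norm_eq_zero:
  assumes "x \<in> ell2" "ell2_norm x = 0" shows "x n = 0"
  using cmod_le_ell2_norm [OF assms(1), of n] assms(2) by simp

lemma ell2_summable_inner:
  assumes "x \<in> ell2" "y \<in> ell2" shows "summable (\<lambda>n. x n * cnj (y n))"
proof (rule summable_norm_cancel)
  show "summable (\<lambda>n. norm (x n * cnj (y n)))"
    using summable_mult_of_squares [of "\<lambda>n. cmod (x n)" "\<lambda>n. cmod (y n)"] assms
    by (simp add: ell2_def norm_mult)
qed

lemma ell2_inner_bound:
  assumes "x \<in> ell2" "y \<in> ell2"
  shows "cmod (ell2_inner x y) \<le> ell2_norm x * ell2_norm y"
proof -
  have s: "summable (\<lambda>n. norm (x n * cnj (y n)))"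
    using summable_mult_of_squares [of "\<lambda>n. cmod (x n)" "\<lambda>n. cmod (y n)"] assms
    by (simp add: ell2_def norm_mult)
  have "cmod (ell2_inner x y) \<le> (\<Sum>n. norm (x n * cnj (y n)))"
    unfolding ell2_inner_def using s by (rule summable_norm)
  also have "\<dots> \<le> ell2_norm x * ell2_norm y"
    using suminf_cauchy_schwarz [of "\<lambda>n. cmod (x n)" "\<lambda>n. cmod (y n)"] assms
    by (simp add: ell2_def ell2_norm_def norm_mult)
  finally show ?thesis .
qed

lemma ell2_inner_diff_left:
  assumes "x \<in> ell2" "y \<in> ell2" "z \<in> ell2"
  shows "ell2_inner (\<lambda>n. x n - y n) z = ell2_inner x z - ell2_inner y z"
  unfolding ell2_inner_def
  by (simp add: suminf_diff [OF ell2_summable_inner ell2_summable_inner] assms left_diff_distrib)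

lemma ell2_inner_self:
  assumes "x \<in> ell2" shows "ell2_inner x x = of_real ((ell2_norm x)\<^sup>2)"
proof -
  have "(\<Sum>n. x n * cnj (x n)) = (\<Sum>n. of_real ((cmod (x n))\<^sup>2))"
    by (simp add: complex_norm_square flip: of_real_power)
  also have "\<dots> = of_real (\<Sum>n. (cmod (x n))\<^sup>2)"
    using assms by (simp add: ell2_def suminf_of_real)
  finally show ?thesis
    using assms unfolding ell2_inner_def ell2_norm_def ell2_def by (simp add: suminf_nonneg)
qed

lemma ell2_truncation:
  assumes "x \<in> ell2"
  shows "(\<lambda>K. ell2_norm (\<lambda>n. x n - (if n < K then x n else 0))) \<longlonglongrightarrow> 0"
proof -
  have s: "summable (\<lambda>n. (cmod (x n))\<^sup>2)" using assms by (simp add: ell2_def)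
  have eq: "(\<Sum>n. (cmod (x n - (if n < K then x n else 0)))\<^sup>2)
      = (\<Sum>n. (cmod (x n))\<^sup>2) - (\<Sum>n<K. (cmod (x n))\<^sup>2)" for K
  proof -
    let ?g = "\<lambda>n. (cmod (x n - (if n < K then x n else 0)))\<^sup>2"
    have "summable ?g"
      using ell2_diff [OF assms ell2_finite_support [of "\<lambda>n. if n < K then x n else 0"]]
      by (simp add: ell2_def)
    then have "suminf ?g = (\<Sum>n. ?g (n + K)) + (\<Sum>n<K. ?g n)"
      by (rule suminf_split_initial_segment)
    also have "\<dots> = (\<Sum>n. (cmod (x (n + K)))\<^sup>2)" by simp
    also have "\<dots> = (\<Sum>n. (cmod (x n))\<^sup>2) - (\<Sum>n<K. (cmod (x n))\<^sup>2)"
      using suminf_split_initial_segment [OF s, of K] by simp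
    finally show ?thesis .
  qed
  have "(\<lambda>K. (\<Sum>n. (cmod (x n))\<^sup>2) - (\<Sum>n<K. (cmod (x n))\<^sup>2)) \<longlonglongrightarrow> (\<Sum>n. (cmod (x n))\<^sup>2) - (\<Sum>n. (cmod (x n))\<^sup>2)"
    by (intro tendsto_intros summable_LIMSEQ s)
  then have "(\<lambda>K. sqrt ((\<Sum>n. (cmod (x n))\<^sup>2) - (\<Sum>n<K. (cmod (x n))\<^sup>2))) \<longlonglongrightarrow> sqrt 0"
    by (intro tendsto_real_sqrt) simp
  then show ?thesis unfolding ell2_norm_def eq by simp
qed

section \<open>The maximal Jacobi operator\<close>

text \<open>The graph of the adjoint of the Jacobi matrix. Self-adjointness thus means that each of its elements
is a limit, in the graph norm, of finitely supported sequences.\<close>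

definition jacobi_max :: "(nat \<Rightarrow> real) \<Rightarrow> (nat \<Rightarrow> real) \<Rightarrow> ell2_op" where
  "jacobi_max a b = {(x, jacobi_action a b x) | x. x \<in> ell2 \<and> jacobi_action a b x \<in> ell2}"

lemma jacobi_action_0: "jacobi_action a b x 0 = of_real (b 0) * x 0 + of_real (a 0) * x 1"
  by (simp add: jacobi_action_def)

lemma jacobi_action_Suc:
  "jacobi_action a b x (Suc n) =
    of_real (a n) * x n + of_real (b (Suc n)) * x (Suc n) + of_real (a (Suc n)) * x (Suc (Suc n))"
  by (simp add: jacobi_action_def)

lemma jacobi_action_add:
  "jacobi_action a b (\<lambda>n. x n + y n) n = jacobi_action a b x n + jacobi_action a b y n"
  by (simp add: jacobi_action_def algebra_simps)

lemma jacobi_action_diff: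
  "jacobi_action a b (\<lambda>n. x n - y n) n = jacobi_action a b x n - jacobi_action a b y n"
  by (simp add: jacobi_action_def algebra_simps)

lemma jacobi_action_scale:
  "jacobi_action a b (\<lambda>n. c * x n) n = c * jacobi_action a b x n"
  by (simp add: jacobi_action_def algebra_simps)

lemma norm_jacobi_action_le:
  assumes "\<And>m. cmod (x m) \<le> d"
  shows "cmod (jacobi_action a b x n) \<le> (\<bar>a (n - 1)\<bar> + \<bar>b n\<bar> + \<bar>a n\<bar>) * d"
proof -
  have d: "cmod (of_real r * x m) \<le> \<bar>r\<bar> * d" for r m
    using assms [of m] by (simp add: norm_mult mult_left_mono)
  have "0 \<le> d" using assms [of 0] norm_ge_zero order_trans by blast
  show ?thesis
  proof (cases n)
    case 0
    have "cmod (jacobi_action a b x n) \<le> \<bar>b 0\<bar> * d + \<bar>a 0\<bar> * d"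
      unfolding 0 jacobi_action_0 by (intro norm_triangle_le add_mono d)
    moreover have "0 \<le> \<bar>a 0\<bar> * d" using \<open>0 \<le> d\<close> by simp
    ultimately show ?thesis using 0 by (simp add: distrib_right)
  next
    case (Suc k)
    have "cmod (jacobi_action a b x n) \<le> \<bar>a k\<bar> * d + \<bar>b n\<bar> * d + \<bar>a n\<bar> * d"
      unfolding Suc jacobi_action_Suc
      by (intro norm_triangle_le add_mono d order_trans [OF norm_triangle_ineq])
    then show ?thesis using Suc by (simp add: distrib_right)
  qed
qed

lemma jacobi_action_zero_beyond:
  assumes "\<And>n. n \<ge> M \<Longrightarrow> x n = 0" "n \<ge> Suc M"
  shows "jacobi_action a b x n = 0"
  using assms by (cases n) (auto simp: jacobi_action_Suc)

lemma finite_support_bound: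
  fixes x :: "nat \<Rightarrow> 'a::zero"
  assumes "finite {n. x n \<noteq> 0}"
  obtains M where "\<And>n. n \<ge> M \<Longrightarrow> x n = 0"
proof -
  from assms obtain M where "\<forall>n\<in>{n. x n \<noteq> 0}. n < M"
    by (metis finite_nat_set_iff_bounded)
  then show ?thesis using that by (metis (mono_tags) mem_Collect_eq not_less)
qed

lemma finite_support_of_bound:
  fixes x :: "nat \<Rightarrow> 'a::zero"
  assumes "\<And>n. n \<ge> M \<Longrightarrow> x n = 0"
  shows "finite {n. x n \<noteq> 0}"
proof (rule finite_subset)
  show "{n. x n \<noteq> 0} \<subseteq> {..<M}"
  proof
    fix n assume "n \<in> {n. x n \<noteq> 0}"
    then show "n \<in> {..<M}" using assms [of n] by (cases "n < M") simp_all
  qed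
qed simp

lemma finite_support_jacobi_action:
  assumes "finite {n. x n \<noteq> 0}" shows "finite {n. jacobi_action a b x n \<noteq> 0}"
proof -
  obtain M where "\<And>n. n \<ge> M \<Longrightarrow> x n = 0" using assms by (rule finite_support_bound) blast
  then show ?thesis by (intro finite_support_of_bound [of "Suc M"] jacobi_action_zero_beyond)
qed

text \<open>Summation by parts: the sum telescopes to the Wronskian of \<open>u\<close> and \<open>y\<close> at the upper end.\<close>

lemma jacobi_green_identity:
  "(\<Sum>n\<le>M. jacobi_action a b u n * cnj (y n) - u n * cnj (jacobi_action a b y n))
    = of_real (a M) * (u (Suc M) * cnj (y M) - u M * cnj (y (Suc M)))"
proof (induction M)
  case 0 show ?case by (simp add: jacobi_action_0 algebra_simps)
next
  case (Suc M) then show ?case by (simp add: jacobi_action_Suc algebra_simps)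
qed

lemma jacobi_symmetric_finite_support:
  assumes "finite {n. u n \<noteq> 0}"
  shows "ell2_inner (jacobi_action a b u) y = ell2_inner u (jacobi_action a b y)"
proof -
  obtain M where M: "\<And>n. n \<ge> M \<Longrightarrow> u n = 0" using assms by (rule finite_support_bound) blast
  have "ell2_inner (jacobi_action a b u) y = (\<Sum>n\<le>M. jacobi_action a b u n * cnj (y n))"
    unfolding ell2_inner_def
    by (rule suminf_finite) (use jacobi_action_zero_beyond [of M u] M in auto)
  moreover have "ell2_inner u (jacobi_action a b y) = (\<Sum>n\<le>M. u n * cnj (jacobi_action a b y n))"
    unfolding ell2_inner_def by (rule suminf_finite) (use M in auto)
  ultimately show ?thesis
    using jacobi_green_identity [of a b u y M] M by (simp add: sum_subtractf)
qed

lemma in_jacobi_matrix_iff: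
  "(x, y) \<in> jacobi_matrix a b \<longleftrightarrow> x \<in> ell2 \<and> y \<in> ell2 \<and>
    (\<forall>e>0. \<exists>u. finite {n. u n \<noteq> 0} \<and> ell2_norm (\<lambda>n. x n - u n) < e
      \<and> ell2_norm (\<lambda>n. y n - jacobi_action a b u n) < e)"
proof -
  have "(\<exists>(u, v)\<in>{(x, jacobi_action a b x) | x. finite {n. x n \<noteq> 0}}. P u v)
    \<longleftrightarrow> (\<exists>u. finite {n. u n \<noteq> 0} \<and> P u (jacobi_action a b u))" for P
    by blast
  then show ?thesis unfolding jacobi_matrix_def op_closure_def by simp
qed

lemma finite_support_in_jacobi_matrix:
  assumes "finite {n. u n \<noteq> 0}"
  shows "(u, jacobi_action a b u) \<in> jacobi_matrix a b"
  unfolding in_jacobi_matrix_iff using assms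
  by (auto intro!: ell2_finite_support finite_support_jacobi_action exI [of _ u] simp: ell2_norm_def)

lemma densely_defined_jacobi_matrix: "densely_defined (jacobi_matrix a b)"
  unfolding densely_defined_def
proof (intro ballI allI impI)
  fix x and e :: real assume x: "x \<in> ell2" and e: "e > 0"
  obtain K where "ell2_norm (\<lambda>n. x n - (if n < K then x n else 0)) < e"
    using order_tendstoD(2) [OF ell2_truncation [OF x] e] by (auto simp: eventually_sequentially)
  then show "\<exists>(u, v)\<in>jacobi_matrix a b. ell2_norm (\<lambda>n. x n - u n) < e"
    by (intro bexI [OF _ finite_support_in_jacobi_matrix [of "\<lambda>n. if n < K then x n else 0" a b]]) auto
qed

text \<open>Each entry of \<open>J x\<close> involves only three entries of \<open>x\<close>, so norm limits can be taken entry by entry.\<close>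

lemma jacobi_matrix_subset_max: "jacobi_matrix a b \<subseteq> jacobi_max a b"
proof
  fix t assume t: "t \<in> jacobi_matrix a b"
  obtain x y where [simp]: "t = (x, y)" by (cases t)
  have x: "x \<in> ell2" and y: "y \<in> ell2"
    and appr: "\<And>e. e > 0 \<Longrightarrow> \<exists>u. finite {n. u n \<noteq> 0} \<and> ell2_norm (\<lambda>n. x n - u n) < e
      \<and> ell2_norm (\<lambda>n. y n - jacobi_action a b u n) < e"
    using t unfolding \<open>t = (x, y)\<close> in_jacobi_matrix_iff by auto
  have "y n = jacobi_action a b x n" for n
  proof -
    define c where "c = \<bar>a (n - 1)\<bar> + \<bar>b n\<bar> + \<bar>a n\<bar> + 1"
    have cr: "c * r = \<bar>a (n - 1)\<bar> * r + \<bar>b n\<bar> * r + \<bar>a n\<bar> * r + r" for r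
      by (simp add: c_def algebra_simps)
    have "cmod (y n - jacobi_action a b x n) \<le> 0 + e" if "e > 0" for e
    proof -
      have c: "c > 0" unfolding c_def by (intro add_nonneg_pos add_nonneg_nonneg) auto
      have "e / (2 * c) > 0" using c that by simp
      from appr [OF this] obtain u where u: "finite {n. u n \<noteq> 0}"
        and 1: "ell2_norm (\<lambda>n. x n - u n) < e / (2 * c)"
        and 2: "ell2_norm (\<lambda>n. y n - jacobi_action a b u n) < e / (2 * c)" by blast
      have d: "cmod (x m - u m) \<le> e / (2 * c)" for m
        using cmod_le_ell2_norm [OF ell2_diff [OF x ell2_finite_support [OF u]], of m] 1 by simp
      have "cmod (jacobi_action a b (\<lambda>n. x n - u n) n)
          \<le> \<bar>a (n - 1)\<bar> * (e / (2*c)) + \<bar>b n\<bar> * (e / (2*c)) + \<bar>a n\<bar> * (e / (2*c))"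
        using norm_jacobi_action_le [of "\<lambda>n. x n - u n", OF d, of a b n] by (simp only: distrib_right)
      moreover have "cmod (y n - jacobi_action a b u n) \<le> e / (2*c)"
        using cmod_le_ell2_norm [OF ell2_diff [OF y ell2_finite_support
            [OF finite_support_jacobi_action [OF u]]], of n a b] 2 by simp
      moreover have "cmod (y n - jacobi_action a b x n)
         \<le> cmod (y n - jacobi_action a b u n) + cmod (jacobi_action a b (\<lambda>n. x n - u n) n)"
      proof -
        have "y n - jacobi_action a b x n
          = (y n - jacobi_action a b u n) - jacobi_action a b (\<lambda>n. x n - u n) n"
          unfolding jacobi_action_diff by simp
        then show ?thesis by (simp only: norm_triangle_ineq4)
      qed
      ultimately have "cmod (y n - jacobi_action a b x n) \<le> c * (e / (2*c))"
        unfolding cr by linarith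
      also have "\<dots> \<le> e" using c that by simp
      finally show ?thesis by simp
    qed
    then have "cmod (y n - jacobi_action a b x n) \<le> 0" by (rule field_le_epsilon)
    then show ?thesis by simp
  qed
  then have "y = jacobi_action a b x" by blast
  then show "t \<in> jacobi_max a b" using x y unfolding jacobi_max_def by auto
qed

text \<open>Testing against unit vectors shows that an element of the adjoint has second component \<open>J y\<close>;
conversely, symmetry on finitely supported sequences passes to the closure by Cauchy-Schwarz.\<close>

lemma adjoint_jacobi_matrix: "op_adjoint (jacobi_matrix a b) = jacobi_max a b"
proof (intro equalityI subsetI)
  fix t assume t: "t \<in> op_adjoint (jacobi_matrix a b)"
  obtain y z where [simp]: "t = (y, z)" by (cases t)
  have y: "y \<in> ell2" and z: "z \<in> ell2"
    and adj: "\<And>u v. (u, v) \<in> jacobi_matrix a b \<Longrightarrow> ell2_inner v y = ell2_inner u z"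
    using t unfolding op_adjoint_def by auto
  have "z n = jacobi_action a b y n" for n
  proof -
    define u where "u = (\<lambda>m. if m = n then 1 else 0 :: complex)"
    have u: "finite {m. u m \<noteq> 0}" unfolding u_def by simp
    have pick: "ell2_inner u w = cnj (w n)" for w
      unfolding ell2_inner_def u_def by (subst suminf_finite [of "{n}"]) auto
    have "ell2_inner u z = ell2_inner u (jacobi_action a b y)"
      using adj [OF finite_support_in_jacobi_matrix [OF u]]
        jacobi_symmetric_finite_support [OF u, of a b y] by simp
    then show ?thesis unfolding pick by simp
  qed
  then have "z = jacobi_action a b y" by blast
  then show "t \<in> jacobi_max a b" using y z unfolding jacobi_max_def by auto
next
  fix t assume "t \<in> jacobi_max a b"
  then obtain y where [simp]: "t = (y, jacobi_action a b y)" and y: "y \<in> ell2"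
    and z: "jacobi_action a b y \<in> ell2" unfolding jacobi_max_def by auto
  have "ell2_inner v y = ell2_inner x (jacobi_action a b y)" if uv: "(x, v) \<in> jacobi_matrix a b" for x v
  proof -
    have x: "x \<in> ell2" and v: "v \<in> ell2"
      and appr: "\<And>e. e > 0 \<Longrightarrow> \<exists>u. finite {n. u n \<noteq> 0} \<and> ell2_norm (\<lambda>n. x n - u n) < e
        \<and> ell2_norm (\<lambda>n. v n - jacobi_action a b u n) < e"
      using uv unfolding in_jacobi_matrix_iff by auto
    define c where "c = ell2_norm y + ell2_norm (jacobi_action a b y) + 1"
    have c: "c > 0" unfolding c_def using ell2_norm_nonneg y z by (simp add: add_nonneg_pos)
    have "cmod (ell2_inner v y - ell2_inner x (jacobi_action a b y)) \<le> 0 + e" if "e > 0" for e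
    proof -
      have "e / c > 0" using c that by simp
      from appr [OF this] obtain u where u: "finite {n. u n \<noteq> 0}"
        and 1: "ell2_norm (\<lambda>n. x n - u n) < e / c"
        and 2: "ell2_norm (\<lambda>n. v n - jacobi_action a b u n) < e / c" by blast
      note uj = ell2_finite_support [OF finite_support_jacobi_action [OF u], of a b]
      note uu = ell2_finite_support [OF u]
      have "ell2_inner v y - ell2_inner x (jacobi_action a b y)
        = ell2_inner (\<lambda>n. v n - jacobi_action a b u n) y
          - ell2_inner (\<lambda>n. x n - u n) (jacobi_action a b y)"
        using jacobi_symmetric_finite_support [OF u, of a b y]
        by (simp add: ell2_inner_diff_left x v uj uu y z)
      also have "cmod \<dots> \<le> (e / c) * ell2_norm y + (e / c) * ell2_norm (jacobi_action a b y)"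
        by (rule order_trans [OF norm_triangle_ineq4],
            intro add_mono order_trans [OF ell2_inner_bound] mult_right_mono ell2_norm_nonneg)
           (use 1 2 ell2_diff x v uj uu y z in auto)
      also have "\<dots> = (e / c) * (c - 1)" 
        by (simp add: c_def algebra_simps add_divide_distrib)
      also have "\<dots> \<le> (e / c) * c" using c that by (intro mult_left_mono) auto
      finally show ?thesis using c by simp
    qed
    then have "cmod (ell2_inner v y - ell2_inner x (jacobi_action a b y)) \<le> 0"
      by (rule field_le_epsilon)
    then show ?thesis by simp
  qed
  then show "t \<in> op_adjoint (jacobi_matrix a b)"
    unfolding op_adjoint_def using y z by auto
qed

lemma self_adjoint_iff_max_subset:
  "self_adjoint (jacobi_matrix a b) \<longleftrightarrow> jacobi_max a b \<subseteq> jacobi_matrix a b"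
  unfolding self_adjoint_def adjoint_jacobi_matrix
  using densely_defined_jacobi_matrix jacobi_matrix_subset_max by blast

section \<open>Three-term recurrences at energy zero\<close>

text \<open>The boundary equation at \<open>0\<close> is not imposed, so the solutions form a space of dimension two.\<close>

definition sol :: "(nat \<Rightarrow> real) \<Rightarrow> (nat \<Rightarrow> real) \<Rightarrow> (nat \<Rightarrow> real) \<Rightarrow> bool" where
  "sol a b u \<longleftrightarrow> (\<forall>n. a n * u n + b (Suc n) * u (Suc n) + a (Suc n) * u (Suc (Suc n)) = 0)"

lemma sol_combination:
  assumes "sol a b u" "sol a b v" shows "sol a b (\<lambda>n. s * u n + t * v n)"
  unfolding sol_def
proof
  fix n
  have "a n * (s * u n + t * v n) + b (Suc n) * (s * u (Suc n) + t * v (Suc n))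
      + a (Suc n) * (s * u (Suc (Suc n)) + t * v (Suc (Suc n)))
    = s * (a n * u n + b (Suc n) * u (Suc n) + a (Suc n) * u (Suc (Suc n)))
      + t * (a n * v n + b (Suc n) * v (Suc n) + a (Suc n) * v (Suc (Suc n)))"
    by (simp add: algebra_simps)
  also have "\<dots> = 0" using assms unfolding sol_def by simp
  finally show "a n * (s * u n + t * v n) + b (Suc n) * (s * u (Suc n) + t * v (Suc n))
      + a (Suc n) * (s * u (Suc (Suc n)) + t * v (Suc (Suc n))) = 0" .
qed

text \<open>The recurrence can be solved for either outer term because \<open>a\<close> never vanishes, so that two
consecutive values may be prescribed anywhere: first at \<open>0\<close>, then one step further by going back.\<close>

lemma sol_exists:
  assumes a: "\<And>n. a n > 0"
  shows "\<exists>u. sol a b u \<and> u n = s \<and> u (Suc n) = t"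
proof (induction n arbitrary: s t)
  case 0
  define f where "f = rec_nat (s, t) (\<lambda>n (x, y). (y, - (a n * x + b (Suc n) * y) / a (Suc n)))"
  have f0: "f 0 = (s, t)" and fS: "f (Suc n) = (snd (f n), - (a n * fst (f n) + b (Suc n) * snd (f n)) / a (Suc n))" for n
    unfolding f_def by (simp_all add: case_prod_beta)
  have "sol a b (\<lambda>n. fst (f n))" unfolding sol_def
  proof
    fix n show "a n * fst (f n) + b (Suc n) * fst (f (Suc n)) + a (Suc n) * fst (f (Suc (Suc n))) = 0"
      using a[of "Suc n"] by (simp add: fS)
  qed
  moreover have "fst (f 0) = s" "fst (f (Suc 0)) = t" by (simp_all add: fS f0)
  ultimately show ?case by blast
next
  case (Suc n)
  obtain u where u: "sol a b u" "u n = - (b (Suc n) * s + a (Suc n) * t) / a n" "u (Suc n) = s"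
    using Suc by blast
  have "a n * u n + b (Suc n) * u (Suc n) + a (Suc n) * u (Suc (Suc n)) = 0" using u(1) unfolding sol_def by blast
  moreover have "a n * u n = - (b (Suc n) * s + a (Suc n) * t)" using a[of n] u(2) by simp
  ultimately have "a (Suc n) * u (Suc (Suc n)) = a (Suc n) * t" unfolding u(3) by linarith
  then have "u (Suc (Suc n)) = t" using a[of "Suc n"] by simp
  then show ?case using u by blast
qed

lemma sol_unique:
  assumes a: "\<And>n. a n > 0" and u: "sol a b u" and v: "sol a b v"
    and eq: "u n = v n" "u (Suc n) = v (Suc n)"
  shows "u = v"
proof -
  have eqn: "a n * w n + b (Suc n) * w (Suc n) + a (Suc n) * w (Suc (Suc n)) = 0" if "sol a b w" for w n
    using that unfolding sol_def by blast
  have base: "u 0 = v 0 \<and> u (Suc 0) = v (Suc 0)" using eq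
  proof (induction n)
    case (Suc n)
    have "a n * u n = - b (Suc n) * u (Suc n) - a (Suc n) * u (Suc (Suc n))"
      "a n * v n = - b (Suc n) * v (Suc n) - a (Suc n) * v (Suc (Suc n))"
      using eqn [OF u, of n] eqn [OF v, of n] by linarith+
    then have "a n * u n = a n * v n" using Suc.prems by simp
    then show ?case using Suc a[of n] by simp
  qed simp
  have "u m = v m \<and> u (Suc m) = v (Suc m)" for m
  proof (induction m)
    case (Suc m)
    have "a (Suc m) * u (Suc (Suc m)) = - a m * u m - b (Suc m) * u (Suc m)"
      "a (Suc m) * v (Suc (Suc m)) = - a m * v m - b (Suc m) * v (Suc m)"
      using eqn [OF u, of m] eqn [OF v, of m] by linarith+
    then have "a (Suc m) * u (Suc (Suc m)) = a (Suc m) * v (Suc (Suc m))" using Suc by simp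
    then show ?case using Suc a[of "Suc m"] by simp
  qed (rule base)
  then show ?thesis by blast
qed

lemma sol_wronskian:
  assumes "sol a b u" "sol a b v"
  shows "a n * (u n * v (Suc n) - u (Suc n) * v n) = a 0 * (u 0 * v 1 - u 1 * v 0)"
proof (induction n)
  case (Suc n)
  have 1: "a (Suc n) * v (Suc (Suc n)) = - a n * v n - b (Suc n) * v (Suc n)"
    and 2: "a (Suc n) * u (Suc (Suc n)) = - a n * u n - b (Suc n) * u (Suc n)"
    using assms unfolding sol_def by (simp_all add: eq_neg_iff_add_eq_0 algebra_simps)
  have "a (Suc n) * (u (Suc n) * v (Suc (Suc n)) - u (Suc (Suc n)) * v (Suc n))
    = u (Suc n) * (a (Suc n) * v (Suc (Suc n))) - v (Suc n) * (a (Suc n) * u (Suc (Suc n)))"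
    by (simp add: algebra_simps)
  also have "\<dots> = a n * (u n * v (Suc n) - u (Suc n) * v n)"
    unfolding 1 2 by (simp add: algebra_simps)
  finally show ?case using Suc by simp
qed simp

section \<open>Dichotomy of solutions and the Green kernel\<close>

text \<open>Pairing with a sequence \<open>g\<close> outside \<open>\<ell>\<^sup>2\<close> is an unbounded functional on finitely supported sequences,
and the level sets of an unbounded functional are dense. Concretely, \<open>f\<close> is truncated at \<open>K\<close>, and the
missing amount \<open>d\<close> is supplied by a multiple of \<open>g\<close> on a block from \<open>K\<close> to \<open>L\<close>, at the cost
\<open>\<bar>d\<bar> / sqrt S\<close>, where \<open>S\<close> is the sum of the squares of \<open>g\<close> over the block.\<close>

lemma ell2_approx_prescribed_pairing:
  fixes g :: "nat \<Rightarrow> real"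
  assumes g: "\<not> summable (\<lambda>n. (g n)\<^sup>2)" and f: "f \<in> ell2" and e: "e > 0"
  obtains f' L where "\<And>n. n \<ge> L \<Longrightarrow> f' n = 0" "ell2_norm (\<lambda>n. f n - f' n) < e"
    "(\<Sum>n<L. of_real (g n) * f' n) = c"
proof -
  have "e / 2 > 0" using e by simp
  from order_tendstoD(2) [OF ell2_truncation [OF f] this]
  obtain K where K: "ell2_norm (\<lambda>n. f n - (if n < K then f n else 0)) < e / 2"
    unfolding eventually_sequentially by blast
  define d where "d = c - (\<Sum>n<K. of_real (g n) * f n)"
  define B where "B = (2 * (cmod d + 1) / e)\<^sup>2"
  have "\<exists>L. (\<Sum>n<L. (g n)\<^sup>2) > (\<Sum>n<K. (g n)\<^sup>2) + B"
  proof (rule ccontr)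
    assume "\<nexists>L. (\<Sum>n<L. (g n)\<^sup>2) > (\<Sum>n<K. (g n)\<^sup>2) + B"
    then have "summable (\<lambda>n. (g n)\<^sup>2)"
      by (intro bounded_imp_summable [of _ "(\<Sum>n<K. (g n)\<^sup>2) + B"])
         (auto simp: not_less lessThan_Suc_atMost [symmetric] simp del: sum.lessThan_Suc)
    with g show False by contradiction
  qed
  then obtain L where L: "(\<Sum>n<L. (g n)\<^sup>2) > (\<Sum>n<K. (g n)\<^sup>2) + B" by blast
  have "B \<ge> 0" unfolding B_def by simp
  have "K < L"
  proof (rule ccontr)
    assume "\<not> K < L"
    then have "(\<Sum>n<L. (g n)\<^sup>2) \<le> (\<Sum>n<K. (g n)\<^sup>2)" by (intro sum_mono2) auto
    with L \<open>B \<ge> 0\<close> show False by simp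
  qed
  define S where "S = (\<Sum>n\<in>{K..<L}. (g n)\<^sup>2)"
  have split: "sum u {..<L} = sum u {..<K} + sum u {K..<L}" for u :: "nat \<Rightarrow> 'b::comm_monoid_add"
    using \<open>K < L\<close> by (metis less_imp_le_nat sum.atLeastLessThan_concat lessThan_atLeast0 zero_le)
  have SB: "S > B" using L split [of "\<lambda>n. (g n)\<^sup>2"] unfolding S_def by simp
  then have S: "S > 0" using \<open>B \<ge> 0\<close> by simp
  define f' where "f' n = (if n < K then f n else if n < L then d / of_real S * of_real (g n) else 0)"
    for n
  define r where "r n = (if K \<le> n \<and> n < L then - (d / of_real S) * of_real (g n) else 0)" for n
  have "f' n = 0" if "n \<ge> L" for n using that \<open>K < L\<close> unfolding f'_def by simp
  moreover have "ell2_norm (\<lambda>n. f n - f' n) < e"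
  proof -
    have r: "r \<in> ell2" by (rule ell2_finite_support, rule finite_support_of_bound [of L]) (simp add: r_def)
    have rn: "ell2_norm r = cmod d / sqrt S"
    proof -
      have "(\<Sum>n. (cmod (r n))\<^sup>2) = (\<Sum>n\<in>{K..<L}. (cmod (r n))\<^sup>2)"
        by (rule suminf_finite) (auto simp: r_def)
      also have "\<dots> = (\<Sum>n\<in>{K..<L}. (cmod d / S)\<^sup>2 * (g n)\<^sup>2)"
        using S by (intro sum.cong refl)
          (simp add: r_def norm_mult norm_divide power_mult_distrib power_divide)
      also have "\<dots> = (cmod d / S)\<^sup>2 * S" unfolding S_def by (simp add: sum_distrib_left)
      also have "\<dots> = (cmod d / sqrt S)\<^sup>2"
        using S by (simp add: power_divide power2_eq_square)
      finally show ?thesis unfolding ell2_norm_def using S by (simp add: real_sqrt_divide)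
    qed
    have "2 * (cmod d + 1) / e < sqrt S" using SB unfolding B_def by (rule real_less_rsqrt)
    then have "cmod d / sqrt S < e / 2" using S e by (simp add: field_simps)
    moreover have eq: "(\<lambda>n. f n - f' n) = (\<lambda>n. (f n - (if n < K then f n else 0)) + r n)"
      unfolding f'_def r_def using \<open>K < L\<close> by auto
    moreover have "ell2_norm (\<lambda>n. (f n - (if n < K then f n else 0)) + r n)
      \<le> ell2_norm (\<lambda>n. f n - (if n < K then f n else 0)) + ell2_norm r"
      by (intro ell2_norm_triangle r ell2_diff f ell2_finite_support) simp
    ultimately show ?thesis using K unfolding eq rn by linarith
  qed
  moreover have "(\<Sum>n<L. of_real (g n) * f' n) = c"
  proof -
    have "(\<Sum>n\<in>{K..<L}. of_real (g n) * f' n)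
        = (\<Sum>n\<in>{K..<L}. d / of_real S * of_real ((g n)\<^sup>2))"
      by (intro sum.cong refl) (simp add: f'_def power2_eq_square)
    also have "\<dots> = d / of_real S * of_real S" unfolding S_def by (simp add: sum_distrib_left)
    also have "\<dots> = d" using S by simp
    finally have "(\<Sum>n\<in>{K..<L}. of_real (g n) * f' n) = d" .
    moreover have "(\<Sum>n<K. of_real (g n) * f' n) = (\<Sum>n<K. of_real (g n) * f n)"
      by (intro sum.cong) (auto simp: f'_def)
    ultimately show ?thesis unfolding split d_def by simp
  qed
  ultimately show thesis using that by blast
qed

lemma jacobi_homogeneous_zero:
  assumes "\<And>n. a n \<noteq> 0" "\<And>n. jacobi_action a b x (Suc n) = z * x (Suc n)" "x 0 = 0" "x 1 = 0"
  shows "x n = 0"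
proof -
  have "x n = 0 \<and> x (Suc n) = 0"
  proof (induction n)
    case (Suc n)
    then show ?case using assms(1)[of "Suc n"] assms(2)[of n] by (simp add: jacobi_action_Suc)
  qed (use assms in auto)
  then show ?thesis ..
qed

text \<open>The equation with centre \<open>Suc M\<close> is restored by changing the entry \<open>M\<close>, which does not enter the
equations further out.\<close>

lemma jacobi_extend_backward:
  fixes a b :: "nat \<Rightarrow> real" and z :: complex
  assumes a: "\<And>n. a n \<noteq> 0"
    and eq: "\<And>n. n \<ge> M \<Longrightarrow> jacobi_action a b x (Suc n) = z * x (Suc n) + y (Suc n)"
  shows "\<exists>x'. (\<forall>n\<ge>M. x' n = x n) \<and> (\<forall>n. jacobi_action a b x' (Suc n) = z * x' (Suc n) + y (Suc n))"
  using eq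
proof (induction M arbitrary: x)
  case 0 then show ?case by blast
next
  case (Suc M)
  define v where "v = (z * x (Suc M) + y (Suc M) - of_real (b (Suc M)) * x (Suc M)
    - of_real (a (Suc M)) * x (Suc (Suc M))) / of_real (a M)"
  define x1 where "x1 = x(M := v)"
  have "jacobi_action a b x1 (Suc n) = z * x1 (Suc n) + y (Suc n)" if "n \<ge> M" for n
  proof (cases "n = M")
    case True
    then show ?thesis using a[of M] by (simp add: jacobi_action_Suc x1_def v_def)
  next
    case False
    then have "n \<ge> Suc M" using that by simp
    from Suc.prems [OF this] show ?thesis using \<open>n \<ge> Suc M\<close> by (simp add: jacobi_action_Suc x1_def)
  qed
  from Suc.IH [OF this] obtain x' where "\<forall>n\<ge>M. x' n = x1 n"
    "\<forall>n. jacobi_action a b x' (Suc n) = z * x' (Suc n) + y (Suc n)" by blast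
  then show ?case by (intro exI [of _ x']) (auto simp: x1_def)
qed

lemma suminf_tendsto_dominated:
  fixes u :: "nat \<Rightarrow> nat \<Rightarrow> 'a :: {real_normed_algebra, banach}"
  assumes "\<And>n. (\<lambda>k. u k n) \<longlonglongrightarrow> v n" "\<And>k n. norm (u k n) \<le> G n" "summable G"
  shows "(\<lambda>k. \<Sum>n. u k n) \<longlonglongrightarrow> (\<Sum>n. v n)"
proof -
  have "eventually (\<lambda>(n, k). norm (u k n) \<le> G n) (sequentially \<times>\<^sub>F sequentially)"
    using assms(2) by (intro always_eventually) auto
  from tannerys_theorem [of "\<lambda>n k. u k n", OF assms(1) this assms(3)] show ?thesis by simp
qed

text \<open>Banach's fixed-point theorem in the supremum norm: the iterates of zero have geometrically
decreasing increments, hence converge uniformly.\<close>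

lemma sup_contraction_fixed_point:
  fixes F :: "(nat \<Rightarrow> complex) \<Rightarrow> nat \<Rightarrow> complex"
  assumes bdd: "\<And>\<xi>. bounded (range \<xi>) \<Longrightarrow> bounded (range (F \<xi>))"
    and contr: "\<And>\<xi> \<eta> d n. bounded (range \<xi>) \<Longrightarrow> bounded (range \<eta>)
      \<Longrightarrow> (\<And>m. cmod (\<xi> m - \<eta> m) \<le> d) \<Longrightarrow> cmod (F \<xi> n - F \<eta> n) \<le> d / 2"
  obtains \<xi> where "bounded (range \<xi>)" "F \<xi> = \<xi>"
proof -
  define X where "X k = (F ^^ k) (\<lambda>_. 0)" for k
  have X0: "X 0 = (\<lambda>_. 0)" and XS: "X (Suc k) = F (X k)" for k unfolding X_def by simp_all
  have Xb: "bounded (range (X k))" for k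
    by (induction k) (auto simp: X0 XS bdd)
  obtain D where D: "\<And>m. cmod (X 1 m) \<le> D"
    using Xb [of 1] unfolding bounded_iff by blast
  have step: "cmod (X (Suc k) m - X k m) \<le> D * (1 / 2) ^ k" for k m
  proof (induction k arbitrary: m)
    case 0 show ?case using D by (simp add: X0)
  next
    case (Suc k)
    show ?case using contr [OF Xb Xb Suc] unfolding XS [symmetric] by simp
  qed
  have geo: "summable (\<lambda>j. D * (1 / 2) ^ (j + k))" for k :: nat
    by (intro summable_mult summable_ignore_initial_segment summable_geometric) simp
  have sX: "summable (\<lambda>j. X (Suc j) m - X j m)" for m
    by (rule summable_comparison_test' [OF geo [of 0]]) (use step in simp)
  define \<xi> where "\<xi> m = (\<Sum>j. X (Suc j) m - X j m)" for m
  have near: "cmod (\<xi> m - X k m) \<le> 2 * D * (1 / 2) ^ k" for m k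
  proof -
    have "(\<Sum>j<k. X (Suc j) m - X j m) = X k m"
      by (subst sum_lessThan_telescope) (simp add: X0)
    then have "\<xi> m - X k m = (\<Sum>j. X (Suc (j + k)) m - X (j + k) m)"
      using suminf_split_initial_segment [OF sX, of m k] unfolding \<xi>_def by simp
    also have "cmod \<dots> \<le> (\<Sum>j. D * (1 / 2) ^ (j + k))"
      by (rule norm_suminf_le [OF step geo])
    also have "\<dots> = D * (1 / 2) ^ k * (\<Sum>j. (1 / 2) ^ j)"
      by (subst suminf_mult [symmetric]) (auto simp: power_add mult_ac intro: summable_geometric)
    also have "\<dots> = 2 * D * (1 / 2) ^ k" by (simp add: suminf_geometric)
    finally show ?thesis .
  qed
  have \<xi>b: "bounded (range \<xi>)"
    using near [of _ 0] by (auto simp: bounded_iff X0)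
  have "F \<xi> n = \<xi> n" for n
  proof -
    have le: "cmod (F \<xi> n - \<xi> n) \<le> 2 * D * (1 / 2) ^ k" for k
    proof -
      have "cmod (F \<xi> n - X (Suc k) n) \<le> D * (1 / 2) ^ k"
        using contr [OF \<xi>b Xb near, of n] unfolding XS by simp
      moreover have "cmod (\<xi> n - X (Suc k) n) \<le> D * (1 / 2) ^ k" using near [of n "Suc k"] by simp
      ultimately show ?thesis
        using norm_triangle_ineq4 [of "F \<xi> n - X (Suc k) n" "\<xi> n - X (Suc k) n"] by simp
    qed
    have "(\<lambda>k. 2 * D * (1 / 2 :: real) ^ k) \<longlonglongrightarrow> 2 * D * 0"
      by (intro tendsto_intros LIMSEQ_power_zero) simp
    then have "cmod (F \<xi> n - \<xi> n) \<le> 2 * D * 0"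
      by (rule LIMSEQ_le_const) (use le in blast)
    then show ?thesis by simp
  qed
  then have "F \<xi> = \<xi>" by (rule ext)
  with \<xi>b show thesis by (rule that)
qed

text \<open>The solutions \<open>\<phi>\<close> and \<open>\<psi>\<close> are normalised to have Wronskian one. The bound on \<open>\<phi> m * \<psi> n\<close> for \<open>m \<le> n\<close>
majorises the Green kernel at energy zero by the rank-one kernel \<open>h m * h n\<close>.\<close>

locale jacobi_dichotomy =
  fixes a b \<phi> \<psi> h :: "nat \<Rightarrow> real"
  assumes a_pos: "\<And>n. a n > 0"
    and \<phi>_sol: "sol a b \<phi>" and \<psi>_sol: "sol a b \<psi>"
    and wronskian_0: "a 0 * (\<phi> 0 * \<psi> 1 - \<phi> 1 * \<psi> 0) = 1"
    and kernel_bound: "\<And>m n. m \<le> n \<Longrightarrow> \<bar>\<phi> m\<bar> * \<bar>\<psi> n\<bar> \<le> h m * h n"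
    and \<psi>_le: "\<And>n. \<bar>\<psi> n\<bar> \<le> h n"
    and h_pos: "\<And>n. h n > 0"
    and h_summable: "summable (\<lambda>n. (h n)\<^sup>2)"
begin

abbreviation J where "J \<equiv> jacobi_action a b"

lemma wronskian: "a n * (\<phi> n * \<psi> (Suc n) - \<phi> (Suc n) * \<psi> n) = 1"
  using sol_wronskian [OF \<phi>_sol \<psi>_sol, of n] wronskian_0 by simp

lemma J_sol:
  assumes "sol a b u" shows "J (\<lambda>n. of_real (u n)) (Suc n) = 0"
proof -
  have "a n * u n + b (Suc n) * u (Suc n) + a (Suc n) * u (Suc (Suc n)) = 0"
    using assms unfolding sol_def by blast
  from arg_cong [OF this, of complex_of_real] show ?thesis unfolding jacobi_action_Suc by simp
qed

lemmas J_\<phi> = J_sol [OF \<phi>_sol] and J_\<psi> = J_sol [OF \<psi>_sol]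

lemma \<psi>_in_ell2: "(\<lambda>n. c * of_real (\<psi> n)) \<in> ell2"
  by (rule ell2_dominated [OF h_summable, of _ "cmod c"]) (simp add: norm_mult \<psi>_le mult_left_mono)

lemma initial_values:
  obtains c d :: complex where
    "c * of_real (\<phi> 0) + d * of_real (\<psi> 0) = x0" "c * of_real (\<phi> 1) + d * of_real (\<psi> 1) = x1"
proof
  have w: "complex_of_real (a 0) * (of_real (\<phi> 0) * of_real (\<psi> 1) - of_real (\<phi> 1) * of_real (\<psi> 0)) = 1"
    using arg_cong [OF wronskian_0, of complex_of_real] by simp
  let ?c = "of_real (a 0) * (x0 * of_real (\<psi> 1) - x1 * of_real (\<psi> 0))"
  let ?d = "of_real (a 0) * (of_real (\<phi> 0) * x1 - of_real (\<phi> 1) * x0)"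
  show "?c * of_real (\<phi> 0) + ?d * of_real (\<psi> 0) = x0" using w by algebra
  show "?c * of_real (\<phi> 1) + ?d * of_real (\<psi> 1) = x1" using w by algebra
qed

lemma homogeneous_solution:
  assumes "\<And>n. J x (Suc n) = 0"
  obtains c d where "\<And>n. x n = c * of_real (\<phi> n) + d * of_real (\<psi> n)"
proof -
  obtain c d where c: "c * of_real (\<phi> 0) + d * of_real (\<psi> 0) = x 0"
    "c * of_real (\<phi> 1) + d * of_real (\<psi> 1) = x 1" by (rule initial_values)
  define u where "u = (\<lambda>n. c * of_real (\<phi> n) + d * of_real (\<psi> n))"
  have Ju: "J u (Suc n) = 0" for n
    unfolding u_def jacobi_action_add jacobi_action_scale J_\<phi> J_\<psi> by simp
  have "x n - u n = 0" for n
    by (rule jacobi_homogeneous_zero [of a b "\<lambda>n. x n - u n" 0])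
       (use a_pos c Ju assms in \<open>auto simp: jacobi_action_diff u_def less_imp_neq [symmetric]\<close>)
  then show thesis using that [of c d] unfolding u_def by simp
qed

text \<open>Variation of constants: the kernel is \<open>\<phi>\<close> at the smaller index times \<open>\<psi>\<close> at the larger one.\<close>

definition green :: "(nat \<Rightarrow> complex) \<Rightarrow> nat \<Rightarrow> complex" where
  "green f n = of_real (\<psi> n) * (\<Sum>m\<le>n. of_real (\<phi> m) * f m)
    + of_real (\<phi> n) * (\<Sum>m. of_real (\<psi> (m + Suc n)) * f (m + Suc n))"

abbreviation h_norm :: real where "h_norm \<equiv> sqrt (\<Sum>n. (h n)\<^sup>2)"

lemma h_norm_nonneg: "0 \<le> h_norm" using h_summable by (simp add: suminf_nonneg)

lemma h_le: "h n \<le> h_norm"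
proof -
  have "(h n)\<^sup>2 \<le> (\<Sum>n. (h n)\<^sup>2)" using sum_le_suminf [OF h_summable, of "{n}"] by simp
  then show ?thesis by (rule real_le_rsqrt)
qed

lemma summable_h_ell2:
  assumes "f \<in> ell2" shows "summable (\<lambda>m. h m * cmod (f m))"
  using summable_mult_of_squares [OF h_summable, of "\<lambda>n. cmod (f n)"] assms h_pos
  by (simp add: ell2_def abs_of_pos)

lemma suminf_h_ell2:
  assumes "f \<in> ell2" shows "(\<Sum>m. h m * cmod (f m)) \<le> h_norm * ell2_norm f"
  using suminf_cauchy_schwarz [OF h_summable, of "\<lambda>n. cmod (f n)"] assms h_pos
  by (simp add: ell2_def ell2_norm_def abs_of_pos)

lemma summable_\<psi>:
  assumes "summable (\<lambda>m. h m * cmod (f m))"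
  shows "summable (\<lambda>m. of_real (\<psi> m) * f m)"
  by (rule summable_comparison_test' [OF assms]) (simp add: norm_mult \<psi>_le mult_right_mono)

lemma green_bound:
  assumes S: "summable (\<lambda>m. h m * cmod (f m))"
  shows "cmod (green f n) \<le> h n * (\<Sum>m. h m * cmod (f m))"
proof -
  have "cmod (of_real (\<psi> n) * (\<Sum>m\<le>n. of_real (\<phi> m) * f m))
      \<le> (\<Sum>m\<le>n. h n * (h m * cmod (f m)))"
  proof -
    have "cmod (of_real (\<psi> n) * (\<Sum>m\<le>n. of_real (\<phi> m) * f m))
      = cmod (\<Sum>m\<le>n. of_real (\<psi> n) * (of_real (\<phi> m) * f m))" by (simp add: sum_distrib_left)
    also have "\<dots> \<le> (\<Sum>m\<le>n. h n * (h m * cmod (f m)))"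
    proof (rule sum_norm_le)
      fix m assume "m \<in> {..n}"
      then have "\<bar>\<phi> m\<bar> * \<bar>\<psi> n\<bar> * cmod (f m) \<le> h m * h n * cmod (f m)"
        by (intro mult_right_mono kernel_bound) auto
      then show "cmod (of_real (\<psi> n) * (of_real (\<phi> m) * f m)) \<le> h n * (h m * cmod (f m))"
        by (simp add: norm_mult mult_ac)
    qed
    finally show ?thesis .
  qed
  moreover have "cmod (of_real (\<phi> n) * (\<Sum>m. of_real (\<psi> (m + Suc n)) * f (m + Suc n)))
      \<le> (\<Sum>m. h n * (h (m + Suc n) * cmod (f (m + Suc n))))"
  proof -
    have s1: "summable (\<lambda>m. of_real (\<psi> (m + Suc n)) * f (m + Suc n))"
      using summable_ignore_initial_segment [OF summable_\<psi> [OF S]] .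
    have s2: "summable (\<lambda>m. h n * (h (m + Suc n) * cmod (f (m + Suc n))))"
      by (rule summable_mult, rule summable_ignore_initial_segment [OF S])
    have le: "cmod (of_real (\<phi> n) * (of_real (\<psi> (m + Suc n)) * f (m + Suc n)))
       \<le> h n * (h (m + Suc n) * cmod (f (m + Suc n)))" for m
    proof -
      have "\<bar>\<phi> n\<bar> * \<bar>\<psi> (m + Suc n)\<bar> * cmod (f (m + Suc n))
          \<le> h n * h (m + Suc n) * cmod (f (m + Suc n))"
        by (intro mult_right_mono kernel_bound) auto
      then show ?thesis by (simp add: norm_mult mult_ac)
    qed
    have "of_real (\<phi> n) * (\<Sum>m. of_real (\<psi> (m + Suc n)) * f (m + Suc n))
        = (\<Sum>m. of_real (\<phi> n) * (of_real (\<psi> (m + Suc n)) * f (m + Suc n)))"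
      using s1 by (simp add: suminf_mult)
    then show ?thesis using norm_suminf_le [OF le s2] by simp
  qed
  ultimately have "cmod (green f n) \<le> (\<Sum>m\<le>n. h n * (h m * cmod (f m)))
      + (\<Sum>m. h n * (h (m + Suc n) * cmod (f (m + Suc n))))"
    unfolding green_def by (rule norm_triangle_mono)
  also have "\<dots> = (\<Sum>m. h n * (h m * cmod (f m)))"
    using suminf_split_initial_segment [OF summable_mult [OF S, of "h n"], of "Suc n"]
    by (simp add: lessThan_Suc_atMost)
  also have "\<dots> = h n * (\<Sum>m. h m * cmod (f m))" using S by (rule suminf_mult)
  finally show ?thesis .
qed

lemma green_bound_ell2:
  assumes "f \<in> ell2" shows "cmod (green f n) \<le> h_norm * ell2_norm f * h n"
  using order_trans [OF green_bound [OF summable_h_ell2 [OF assms]]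
    mult_left_mono [OF suminf_h_ell2 [OF assms], of "h n"]] h_pos[of n] by (simp add: mult_ac)

lemma green_diff:
  assumes "summable (\<lambda>m. h m * cmod (f m))" "summable (\<lambda>m. h m * cmod (g m))"
  shows "green (\<lambda>n. f n - g n) n = green f n - green g n"
proof -
  have "(\<Sum>m. of_real (\<psi> (m + Suc n)) * (f (m + Suc n) - g (m + Suc n)))
     = (\<Sum>m. of_real (\<psi> (m + Suc n)) * f (m + Suc n)) - (\<Sum>m. of_real (\<psi> (m + Suc n)) * g (m + Suc n))"
    unfolding right_diff_distrib
    by (rule suminf_diff [symmetric];
        rule summable_ignore_initial_segment [OF summable_\<psi>]) (use assms in auto)
  then show ?thesis unfolding green_def
    by (simp add: right_diff_distrib sum_subtractf)
qed

text \<open>From one index to the next, a single term moves from the tail sum to the head sum. Collecting the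
coefficients of the two sums at \<open>Suc n\<close> gives the recurrences for \<open>\<phi>\<close> and \<open>\<psi>\<close>, and what remains is
\<open>f (Suc n)\<close> times the Wronskian.\<close>

lemma J_green:
  assumes "summable (\<lambda>m. h m * cmod (f m))"
  shows "J (green f) (Suc n) = f (Suc n)"
proof -
  define P where "P n = (\<Sum>m\<le>n. of_real (\<phi> m) * f m)" for n
  define Q where "Q n = (\<Sum>m. of_real (\<psi> (m + Suc n)) * f (m + Suc n))" for n
  have P: "P (Suc n) = P n + of_real (\<phi> (Suc n)) * f (Suc n)" for n unfolding P_def by simp
  have Q: "Q n = of_real (\<psi> (Suc n)) * f (Suc n) + Q (Suc n)" for n
    using suminf_split_head [OF summable_ignore_initial_segment [OF summable_\<psi> [OF assms], of "Suc n"]]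
    unfolding Q_def by simp
  have g: "green f n = of_real (\<psi> n) * P n + of_real (\<phi> n) * Q n" for n
    unfolding green_def P_def Q_def ..
  have w: "complex_of_real (a n) * (of_real (\<phi> n) * of_real (\<psi> (Suc n))
      - of_real (\<phi> (Suc n)) * of_real (\<psi> n)) = 1"
    using arg_cong [OF wronskian [of n], of complex_of_real] by simp
  show ?thesis
    unfolding jacobi_action_Suc g
    using P[of n] P[of "Suc n"] Q[of n] Q[of "Suc n"] w J_\<phi>[of n, unfolded jacobi_action_Suc]
      J_\<psi>[of n, unfolded jacobi_action_Suc]
    by algebra
qed

text \<open>When all solutions are square-summable, the maximal domain contains \<open>p\<close> with \<open>J p = 0\<close> and
\<open>p\<^sub>0 = 1\<close>, as well as \<open>q\<close> with \<open>J q\<close> the unit vector at \<open>0\<close> (the polynomials of the first and second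
kind at zero). Symmetry would make \<open>\<langle>J q, p\<rangle> = 1\<close> equal to \<open>\<langle>q, J p\<rangle> = 0\<close>.\<close>

lemma not_self_adjoint:
  assumes \<phi>2: "summable (\<lambda>n. (\<phi> n)\<^sup>2)"
  shows "\<not> self_adjoint (jacobi_matrix a b)"
proof
  assume sa: "self_adjoint (jacobi_matrix a b)"
  have in_ell2: "(\<lambda>n. c * of_real (\<phi> n) + d * of_real (\<psi> n)) \<in> ell2" for c d
    by (intro ell2_add ell2_scale \<psi>_in_ell2) (use \<phi>2 in \<open>simp add: ell2_def\<close>)
  have sol: "\<exists>x\<in>ell2. (\<forall>n. J x (Suc n) = 0) \<and> x 0 = x0 \<and> x 1 = x1" for x0 x1
  proof -
    obtain c d where cd: "c * of_real (\<phi> 0) + d * of_real (\<psi> 0) = x0"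
      "c * of_real (\<phi> 1) + d * of_real (\<psi> 1) = x1" by (rule initial_values)
    have "J (\<lambda>n. c * of_real (\<phi> n) + d * of_real (\<psi> n)) (Suc n) = 0" for n
      unfolding jacobi_action_add jacobi_action_scale J_\<phi> J_\<psi> by simp
    then show ?thesis using cd by (intro bexI [OF _ in_ell2 [of c d]]) auto
  qed
  from sol [of 1 "- of_real (b 0) / of_real (a 0)"] obtain p where
    p: "p \<in> ell2" "\<And>n. J p (Suc n) = 0" "p 0 = 1" "p 1 = - of_real (b 0) / of_real (a 0)" by blast
  from sol [of 0 "1 / of_real (a 0)"] obtain q where
    q: "q \<in> ell2" "\<And>n. J q (Suc n) = 0" "q 0 = 0" "q 1 = 1 / of_real (a 0)" by blast
  have a0: "complex_of_real (a 0) \<noteq> 0" using a_pos[of 0] by simp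
  have Jp: "J p = (\<lambda>n. 0)"
  proof
    fix n show "J p n = 0" by (cases n) (use p a0 in \<open>auto simp: jacobi_action_0\<close>)
  qed
  have Jq: "J q = (\<lambda>n. if n = 0 then 1 else 0)"
  proof
    fix n show "J q n = (if n = 0 then 1 else 0)"
      by (cases n) (use q a0 in \<open>auto simp: jacobi_action_0\<close>)
  qed
  have Jq2: "J q \<in> ell2" unfolding Jq by (rule ell2_finite_support) simp
  have "(p, J p) \<in> op_adjoint (jacobi_matrix a b)" "(q, J q) \<in> op_adjoint (jacobi_matrix a b)"
    unfolding adjoint_jacobi_matrix jacobi_max_def using p(1) q(1) Jq2
    by (auto simp: Jp ell2_finite_support)
  moreover have "op_adjoint (jacobi_matrix a b) = jacobi_matrix a b"
    using sa unfolding self_adjoint_def by blast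
  ultimately have "(p, J p) \<in> op_adjoint (jacobi_matrix a b)" "(q, J q) \<in> jacobi_matrix a b"
    by simp_all
  then have "ell2_inner (J q) p = ell2_inner q (J p)"
    unfolding op_adjoint_def by auto
  moreover have "ell2_inner (J q) p = 1"
    unfolding ell2_inner_def Jq by (subst suminf_finite [of "{0}"]) (auto simp: p)
  moreover have "ell2_inner q (J p) = 0" unfolding ell2_inner_def Jp by simp
  ultimately show False by simp
qed

text \<open>The difference of \<open>x\<close> and its Green potential solves the homogeneous recurrence and lies in \<open>\<ell>\<^sup>2\<close>,
so that it has no component along \<open>\<phi>\<close>.\<close>

lemma inhomogeneous_decaying:
  assumes \<phi>2: "\<not> summable (\<lambda>n. (\<phi> n)\<^sup>2)"
    and x: "x \<in> ell2" and f: "f \<in> ell2" and eq: "\<And>n. J x (Suc n) = f (Suc n)"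
  obtains c where "\<And>n. x n = green f n + c * of_real (\<psi> n)"
proof -
  have g: "green f \<in> ell2"
    by (rule ell2_dominated [OF h_summable, of _ "h_norm * ell2_norm f"]) (rule green_bound_ell2 [OF f])
  have "J (\<lambda>n. x n - green f n) (Suc n) = 0" for n
    unfolding jacobi_action_diff eq J_green [OF summable_h_ell2 [OF f]] by simp
  then obtain c d where cd: "\<And>n. x n - green f n = c * of_real (\<phi> n) + d * of_real (\<psi> n)"
    by (rule homogeneous_solution) blast
  have "(\<lambda>n. (x n - green f n) - d * of_real (\<psi> n)) \<in> ell2"
    by (intro ell2_diff x g \<psi>_in_ell2)
  then have "(\<lambda>n. c * of_real (\<phi> n)) \<in> ell2" unfolding cd by simp
  then have s: "summable (\<lambda>n. (cmod c)\<^sup>2 * (\<phi> n)\<^sup>2)"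
    by (simp add: ell2_def norm_mult power_mult_distrib)
  have "c = 0"
  proof (rule ccontr)
    assume "c \<noteq> 0"
    then have "summable (\<lambda>n. (\<phi> n)\<^sup>2)" using s by simp
    with \<phi>2 show False by contradiction
  qed
  then have "x n = green f n + d * of_real (\<psi> n)" for n using cd [of n] by (simp add: algebra_simps)
  then show thesis by (rule that)
qed

text \<open>Beyond the support of \<open>f'\<close>, the Green potential of \<open>f'\<close> is \<open>\<psi>\<close> times the pairing of \<open>\<phi>\<close> with \<open>f'\<close>.
Given \<open>x = green (J x) + c \<psi>\<close>, a finitely supported \<open>f'\<close> near \<open>J x\<close> whose pairing with \<open>\<phi>\<close> is
\<open>- c\<close> therefore turns \<open>green f' + c \<psi>\<close> into a finitely supported approximation of \<open>x\<close>.\<close>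

lemma max_subset_jacobi_matrix:
  assumes \<phi>2: "\<not> summable (\<lambda>n. (\<phi> n)\<^sup>2)"
  shows "jacobi_max a b \<subseteq> jacobi_matrix a b"
proof
  fix t assume "t \<in> jacobi_max a b"
  then obtain x where t: "t = (x, J x)" and x: "x \<in> ell2" and f: "J x \<in> ell2"
    unfolding jacobi_max_def by auto
  obtain c where c: "\<And>n. x n = green (J x) n + c * of_real (\<psi> n)"
    by (rule inhomogeneous_decaying [OF \<phi>2 x f]) auto
  \<comment> \<open>Collects the factors of \<open>\<delta>\<close> in the two error estimates below.\<close>
  define A where "A = (\<bar>a 0\<bar> + \<bar>b 0\<bar> + \<bar>a 0\<bar>) * (h_norm * h_norm) + 2 + h_norm * h_norm"
  have A: "A > 0" unfolding A_def using h_norm_nonneg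
    by (intro add_pos_nonneg add_nonneg_pos mult_nonneg_nonneg add_nonneg_nonneg abs_ge_zero) simp_all
  have appr: "\<exists>u. finite {n. u n \<noteq> 0} \<and> ell2_norm (\<lambda>n. x n - u n) < e \<and> ell2_norm (\<lambda>n. J x n - J u n) < e"
    if e: "e > 0" for e
  proof -
    define \<delta> where "\<delta> = e / (2 * A)"
    have \<delta>: "\<delta> > 0" unfolding \<delta>_def using e A by simp
    obtain f' L where L: "\<And>n. n \<ge> L \<Longrightarrow> f' n = 0" and near: "ell2_norm (\<lambda>n. J x n - f' n) < \<delta>"
      and pair: "(\<Sum>n<L. of_real (\<phi> n) * f' n) = - c"
      by (rule ell2_approx_prescribed_pairing [OF \<phi>2 f \<delta>, of "- c"]) (rule that)
    have f': "f' \<in> ell2" using L by (intro ell2_finite_support finite_support_of_bound)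
    define g where "g = (\<lambda>n. J x n - f' n)"
    have g: "g \<in> ell2" unfolding g_def by (intro ell2_diff f f')
    have gn: "ell2_norm g \<le> \<delta>" using near unfolding g_def by simp
    define u where "u n = green f' n + c * of_real (\<psi> n)" for n
    have u0: "u n = 0" if "n \<ge> L" for n
    proof -
      have "(\<Sum>m\<le>n. of_real (\<phi> m) * f' m) = (\<Sum>m<L. of_real (\<phi> m) * f' m)"
        using that L by (intro sum.mono_neutral_right) auto
      moreover have "(\<Sum>m. of_real (\<psi> (m + Suc n)) * f' (m + Suc n)) = 0"
        using that L by (simp add: trans_le_add2)
      ultimately show ?thesis unfolding u_def green_def pair by simp
    qed
    have d: "x n - u n = green g n" for n
      unfolding u_def g_def using c[of n]
        green_diff [OF summable_h_ell2 [OF f] summable_h_ell2 [OF f']] by simp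
    have gb: "cmod (green g n) \<le> h_norm * \<delta> * h n" for n
      by (rule order_trans [OF green_bound_ell2 [OF g]])
         (use gn h_pos[of n] h_norm_nonneg in \<open>intro mult_right_mono mult_left_mono, auto\<close>)
    have gb': "cmod (green g n) \<le> h_norm * \<delta> * h_norm" for n
      by (rule order_trans [OF gb]) (use \<delta> h_norm_nonneg h_le in \<open>intro mult_left_mono, auto\<close>)
    have "ell2_norm (\<lambda>n. x n - u n) \<le> h_norm * \<delta> * h_norm"
      unfolding d by (rule ell2_norm_dominated [OF h_summable gb]) (use \<delta> h_norm_nonneg in auto)
    also have "\<dots> = \<delta> * (h_norm * h_norm)" by simp
    also have "\<dots> \<le> \<delta> * A"
      unfolding A_def using \<delta> h_norm_nonneg by (intro mult_left_mono add_increasing) auto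
    also have "\<dots> < e" unfolding \<delta>_def using A e by simp
    finally have 1: "ell2_norm (\<lambda>n. x n - u n) < e" .
    \<comment> \<open>The Green potential satisfies the recurrence except possibly at \<open>0\<close>.\<close>
    define r where "r n = (if n = 0 then J (green g) 0 - g 0 else 0)" for n :: nat
    have r: "r \<in> ell2" by (rule ell2_finite_support) (simp add: r_def)
    have Jd: "J x n - J u n = g n + r n" for n
    proof -
      have "J x n - J u n = J (green g) n" unfolding jacobi_action_diff [symmetric] d ..
      also have "\<dots> = g n + r n"
        by (cases n) (auto simp: r_def J_green [OF summable_h_ell2 [OF g]])
      finally show ?thesis .
    qed
    have "ell2_norm r = cmod (r 0)"
      unfolding ell2_norm_def by (subst suminf_finite [of "{0}"]) (auto simp: r_def)
    also have "\<dots> \<le> (\<bar>a 0\<bar> + \<bar>b 0\<bar> + \<bar>a 0\<bar>) * (h_norm * \<delta> * h_norm) + \<delta>"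
      using norm_jacobi_action_le [of "green g", OF gb', of a b 0] cmod_le_ell2_norm [OF g, of 0] gn
      unfolding r_def by (auto intro!: order_trans [OF norm_triangle_ineq4])
    finally have rn: "ell2_norm r \<le> (\<bar>a 0\<bar> + \<bar>b 0\<bar> + \<bar>a 0\<bar>) * (h_norm * \<delta> * h_norm) + \<delta>" .
    have "ell2_norm (\<lambda>n. J x n - J u n) \<le> ell2_norm g + ell2_norm r"
      unfolding Jd by (rule ell2_norm_triangle [OF g r])
    also have "\<dots> \<le> \<delta> + ((\<bar>a 0\<bar> + \<bar>b 0\<bar> + \<bar>a 0\<bar>) * (h_norm * \<delta> * h_norm) + \<delta>)"
      using gn rn by simp
    also have "\<dots> = \<delta> * (A - h_norm * h_norm)" unfolding A_def by (simp add: algebra_simps)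
    also have "\<dots> \<le> \<delta> * A" using \<delta> h_norm_nonneg by (intro mult_left_mono) auto
    also have "\<dots> < e" unfolding \<delta>_def using A e by simp
    finally have 2: "ell2_norm (\<lambda>n. J x n - J u n) < e" .
    show ?thesis using 1 2 finite_support_of_bound [of L u, OF u0] by blast
  qed
  then show "t \<in> jacobi_matrix a b"
    unfolding t in_jacobi_matrix_iff by (intro conjI allI impI x f appr)
qed

lemma self_adjoint_iff: "self_adjoint (jacobi_matrix a b) \<longleftrightarrow> \<not> summable (\<lambda>n. (\<phi> n)\<^sup>2)"
proof
  assume "self_adjoint (jacobi_matrix a b)"
  then show "\<not> summable (\<lambda>n. (\<phi> n)\<^sup>2)" using not_self_adjoint by auto
next
  assume "\<not> summable (\<lambda>n. (\<phi> n)\<^sup>2)"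
  then show "self_adjoint (jacobi_matrix a b)"
    unfolding self_adjoint_iff_max_subset by (rule max_subset_jacobi_matrix)
qed

section \<open>Discreteness of the spectrum\<close>

text \<open>The perturbation by \<open>z\<close> is cut off below \<open>M\<close>. Far enough out the Green kernel has Hilbert-Schmidt
norm below \<open>1 / (2 (\<bar>z\<bar> + 1))\<close>, and after dividing by the weight \<open>h\<close> the integral equation becomes a
contraction of bounded sequences.\<close>

lemma fixed_point_tail:
  assumes y: "y \<in> ell2"
  obtains x M where "\<And>n. x n = green (\<lambda>m. if m \<ge> M then z * x m + y m else 0) n + c * of_real (\<psi> n)"
    "x \<in> ell2"
proof -
  have "(\<lambda>M. \<Sum>m. (h (m + M))\<^sup>2) \<longlonglongrightarrow> 0"
    using suminf_exist_split2 [OF h_summable] .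
  moreover have "1 / (2 * (cmod z + 1)) > 0" by (simp add: add_nonneg_pos)
  ultimately have "eventually (\<lambda>M. (\<Sum>m. (h (m + M))\<^sup>2) < 1 / (2 * (cmod z + 1))) sequentially"
    by (rule order_tendstoD(2))
  then obtain M where M: "(\<Sum>m. (h (m + M))\<^sup>2) < 1 / (2 * (cmod z + 1))"
    unfolding eventually_sequentially by blast
  define f where "f \<xi> m = (if m \<ge> M then z * (of_real (h m) * \<xi> m) + y m else 0)" for \<xi> :: "nat \<Rightarrow> complex" and m
  define F where "F \<xi> n = (green (f \<xi>) n + c * of_real (\<psi> n)) / of_real (h n)" for \<xi> :: "nat \<Rightarrow> complex" and n
  have f_summable: "summable (\<lambda>m. h m * cmod (f \<xi> m))" if "\<And>m. cmod (\<xi> m) \<le> B" for \<xi> B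
  proof (rule summable_h_ell2)
    have "(\<lambda>m. z * (of_real (h m) * \<xi> m) + y m) \<in> ell2"
    proof (intro ell2_add ell2_scale y ell2_dominated [OF h_summable])
      fix m show "cmod (of_real (h m) * \<xi> m) \<le> B * h m"
        using h_pos[of m] that[of m] by (simp add: norm_mult)
    qed
    then have "summable (\<lambda>m. (cmod (z * (of_real (h m) * \<xi> m) + y m))\<^sup>2)" by (simp add: ell2_def)
    then show "f \<xi> \<in> ell2" unfolding ell2_def mem_Collect_eq
      by (rule summable_comparison_test') (simp add: f_def)
  qed
  have F_bound: "cmod (F \<xi> n) \<le> (\<Sum>m. h m * cmod (f \<xi> m)) + cmod c" if "\<And>m. cmod (\<xi> m) \<le> B" for \<xi> B n
  proof -
    have "cmod (green (f \<xi>) n + c * of_real (\<psi> n)) \<le> h n * (\<Sum>m. h m * cmod (f \<xi> m)) + cmod c * h n"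
      by (intro norm_triangle_mono green_bound f_summable [OF that])
         (simp add: norm_mult \<psi>_le mult_left_mono)
    then show ?thesis unfolding F_def using h_pos[of n] by (simp add: norm_divide field_simps)
  qed
  have bnd: "\<exists>B. \<forall>m. cmod (\<xi> m) \<le> B" if "bounded (range \<xi>)" for \<xi> :: "nat \<Rightarrow> complex"
    using that unfolding bounded_iff by blast
  obtain \<xi> where \<xi>b: "bounded (range \<xi>)" and \<xi>: "F \<xi> = \<xi>"
  proof (rule sup_contraction_fixed_point [of F])
    show "bounded (range (F \<xi>))" if "bounded (range \<xi>)" for \<xi>
      using F_bound bnd [OF that] unfolding bounded_iff by blast
  next
    fix u v :: "nat \<Rightarrow> complex" and d n
    assume u: "bounded (range u)" and v: "bounded (range v)" and uv: "\<And>m. cmod (u m - v m) \<le> d"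
    have d: "d \<ge> 0" using order_trans [OF norm_ge_zero uv [of 0]] .
    have su: "summable (\<lambda>m. h m * cmod (f u m))" and sv: "summable (\<lambda>m. h m * cmod (f v m))"
      using bnd u v f_summable by blast+
    define g where "g = (\<lambda>m. f u m - f v m)"
    have g: "cmod (g m) \<le> (if m \<ge> M then cmod z * (h m * d) else 0)" for m
      using h_pos[of m] uv[of m]
      by (simp add: g_def f_def norm_mult mult_left_mono flip: right_diff_distrib)
    have sG: "summable (\<lambda>m. h m * (if m \<ge> M then cmod z * (h m * d) else 0))"
      by (rule summable_comparison_test' [OF summable_mult2 [OF h_summable, of "cmod z * d"]])
         (simp add: power2_eq_square abs_mult abs_of_pos [OF h_pos] less_imp_le [OF h_pos] d mult_ac)
    have sg: "summable (\<lambda>m. h m * cmod (g m))"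
      by (rule summable_comparison_test' [OF sG])
         (use g h_pos in \<open>simp add: abs_mult mult_left_mono less_imp_le abs_of_pos\<close>)
    have "(\<Sum>m. h m * cmod (g m)) \<le> (\<Sum>m. h m * (if m \<ge> M then cmod z * (h m * d) else 0))"
      using g h_pos by (intro suminf_le sg sG mult_left_mono) (auto intro: less_imp_le)
    also have "\<dots> = (\<Sum>m. h (m + M) * (cmod z * (h (m + M) * d)))"
      using suminf_split_initial_segment [OF sG, of M] by simp
    also have "\<dots> = (\<Sum>m. (h (m + M))\<^sup>2) * (cmod z * d)"
      by (subst suminf_mult2) (use h_summable in \<open>auto simp: power2_eq_square mult_ac intro: summable_ignore_initial_segment\<close>)
    also have "\<dots> \<le> 1 / (2 * (cmod z + 1)) * (cmod z * d)"
      using M d by (intro mult_right_mono) auto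
    also have "\<dots> \<le> d / 2"
    proof -
      have "cmod z / (cmod z + 1) \<le> 1" by (simp add: divide_le_eq add_nonneg_pos)
      then have "cmod z / (cmod z + 1) * (d / 2) \<le> 1 * (d / 2)"
        using d by (intro mult_right_mono) auto
      moreover have "1 / (2 * (cmod z + 1)) * (cmod z * d) = cmod z / (cmod z + 1) * (d / 2)"
        by (simp add: mult.commute [of d])
      ultimately show ?thesis by linarith
    qed
    finally have le: "(\<Sum>m. h m * cmod (g m)) \<le> d / 2" .
    have "cmod (F u n - F v n) = cmod (green g n) / h n"
      unfolding F_def g_def green_diff [OF su sv]
      using h_pos[of n] by (simp add: norm_divide flip: diff_divide_distrib)
    also have "\<dots> \<le> (\<Sum>m. h m * cmod (g m))"
      using green_bound [OF sg, of n] h_pos[of n] by (simp add: divide_le_eq mult.commute)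
    finally show "cmod (F u n - F v n) \<le> d / 2" using le by simp
  qed
  obtain B where B: "\<And>m. cmod (\<xi> m) \<le> B" using bnd [OF \<xi>b] by blast
  define x where "x n = of_real (h n) * \<xi> n" for n
  have xb: "cmod (x n) \<le> B * h n" for n unfolding x_def using B[of n] h_pos[of n] by (simp add: norm_mult)
  have fx: "f \<xi> = (\<lambda>m. if m \<ge> M then z * x m + y m else 0)"
    unfolding f_def x_def ..
  have "x n = green (\<lambda>m. if m \<ge> M then z * x m + y m else 0) n + c * of_real (\<psi> n)" for n
  proof -
    have "x n = of_real (h n) * F \<xi> n" unfolding x_def \<xi> ..
    then show ?thesis unfolding F_def fx using h_pos[of n] by simp
  qed
  then show thesis using that ell2_dominated [OF h_summable xb] by blast
qed

lemma ell2_cong_eventually: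
  assumes "x \<in> ell2" "\<And>n. n \<ge> M \<Longrightarrow> x' n = x n" shows "x' \<in> ell2"
proof -
  have "(\<lambda>n. x' n - x n) \<in> ell2"
    by (intro ell2_finite_support finite_support_of_bound [of M]) (use assms in auto)
  from ell2_add [OF this assms(1)] show ?thesis by simp
qed

text \<open>At every complex energy the recurrence keeps a square-summable solution. A solution of the equation
with cut-off perturbation is correct beyond \<open>M\<close> and is continued backwards from there. For \<open>y = 0\<close>
and \<open>c \<noteq> 0\<close> it cannot vanish: near infinity its fixed-point equation would reduce to \<open>c \<psi> = 0\<close>.\<close>

lemma decaying_solution:
  fixes z c :: complex
  assumes y: "y \<in> ell2"
  obtains x where "x \<in> ell2" "\<And>n. J x (Suc n) = z * x (Suc n) + y (Suc n)"
    "y = (\<lambda>n. 0) \<Longrightarrow> c \<noteq> 0 \<Longrightarrow> x \<noteq> (\<lambda>n. 0)"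
proof -
  obtain x M where x: "\<And>n. x n = green (\<lambda>m. if m \<ge> M then z * x m + y m else 0) n + c * of_real (\<psi> n)" "x \<in> ell2"
    by (rule fixed_point_tail [OF y]) blast
  define f where "f = (\<lambda>m. if m \<ge> M then z * x m + y m else 0)"
  have "(\<lambda>m. z * x m + y m) \<in> ell2" by (intro ell2_add ell2_scale x(2) y)
  then have f: "f \<in> ell2" by (rule ell2_cong_eventually [of _ M]) (simp add: f_def)
  have xe: "x = (\<lambda>n. green f n + c * of_real (\<psi> n))" using x(1) unfolding f_def by blast
  have "J x (Suc n) = f (Suc n)" for n
    by (subst xe) (simp add: jacobi_action_add jacobi_action_scale J_\<psi> J_green [OF summable_h_ell2 [OF f]])
  then have "J x (Suc n) = z * x (Suc n) + y (Suc n)" if "n \<ge> M" for n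
    using that by (simp add: f_def)
  from jacobi_extend_backward [OF _ this] obtain x' where
    x': "\<And>n. n \<ge> M \<Longrightarrow> x' n = x n" "\<And>n. J x' (Suc n) = z * x' (Suc n) + y (Suc n)"
    using a_pos by (metis less_irrefl)
  show thesis
  proof (rule that)
    show "x' \<in> ell2" by (rule ell2_cong_eventually [OF x(2) x'(1)])
    show "J x' (Suc n) = z * x' (Suc n) + y (Suc n)" for n by (rule x'(2))
    assume y0: "y = (\<lambda>n. 0)" and c: "c \<noteq> 0"
    show "x' \<noteq> (\<lambda>n. 0)"
    proof
      assume "x' = (\<lambda>n. 0)"
      then have x0: "x n = 0" if "n \<ge> M" for n using x'(1)[OF that] by simp
      then have "f = (\<lambda>n. 0)" unfolding f_def y0 by auto
      then have "\<psi> n = 0" if "n \<ge> M" for n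
        using x0[OF that] fun_cong [OF xe, of n] c by (simp add: green_def)
      then show False using wronskian[of M] by simp
    qed
  qed
qed

text \<open>Only the equation at \<open>0\<close> remains to be satisfied, and adding a multiple of a homogeneous decaying
solution \<open>v\<close> achieves this: its defect \<open>d\<close> at \<open>0\<close> is non-zero, as otherwise \<open>v\<close> would be an
eigenvector.\<close>

lemma solve_off_eigenvalue:
  assumes noev: "\<And>x. x \<in> ell2 \<Longrightarrow> (\<And>n. J x n = z * x n) \<Longrightarrow> x = (\<lambda>n. 0)"
    and y: "y \<in> ell2"
  obtains x where "x \<in> ell2" "\<And>n. J x n = z * x n + y n"
proof -
  obtain x where x: "x \<in> ell2" "\<And>n. J x (Suc n) = z * x (Suc n) + y (Suc n)"
    by (rule decaying_solution [OF y, of z 0]) blast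
  have z0: "(\<lambda>n. 0) \<in> ell2" by (rule ell2_finite_support) simp
  obtain v where v: "v \<in> ell2" "\<And>n. J v (Suc n) = z * v (Suc n)" "v \<noteq> (\<lambda>n. 0)"
    by (rule decaying_solution [OF z0, of z 1]) auto
  define d where "d = J v 0 - z * v 0"
  have "d \<noteq> 0"
  proof
    assume "d = 0"
    then have "J v n = z * v n" for n by (cases n) (auto simp: v d_def)
    with noev v show False by blast
  qed
  define t where "t = (z * x 0 + y 0 - J x 0) / d"
  show thesis
  proof
    show "(\<lambda>n. x n + t * v n) \<in> ell2" by (intro ell2_add ell2_scale x v)
    show "J (\<lambda>n. x n + t * v n) n = z * (x n + t * v n) + y n" for n
    proof (cases n)
      case 0
      have "t * d = z * x 0 + y 0 - J x 0" unfolding t_def using \<open>d \<noteq> 0\<close> by simp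
      then show ?thesis unfolding 0 jacobi_action_add jacobi_action_scale d_def
        by (simp add: algebra_simps)
    next
      case (Suc m)
      then show ?thesis unfolding Suc jacobi_action_add jacobi_action_scale x v
        by (simp add: algebra_simps)
    qed
  qed
qed

text \<open>This makes sets that are bounded in the graph norm precompact in \<open>\<ell>\<^sup>2\<close>. The coefficient of \<open>\<psi>\<close> in the
decomposition of \<open>x\<close> is read off at an index \<open>j\<close> where \<open>\<psi>\<close> does not vanish.\<close>

lemma domain_dominated:
  assumes \<phi>2: "\<not> summable (\<lambda>n. (\<phi> n)\<^sup>2)"
  obtains C where "C \<ge> 0"
    "\<And>x n. x \<in> ell2 \<Longrightarrow> J x \<in> ell2 \<Longrightarrow> cmod (x n) \<le> C * (ell2_norm x + ell2_norm (J x)) * h n"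
proof -
  obtain j where j: "\<psi> j \<noteq> 0" using wronskian[of 0] by force
  define C where "C = h_norm + (1 + h j * h_norm) / \<bar>\<psi> j\<bar>"
  have C0: "C \<ge> 0" unfolding C_def using h_norm_nonneg h_pos[of j] by simp
  have "cmod (x n) \<le> C * (ell2_norm x + ell2_norm (J x)) * h n" if x: "x \<in> ell2" and f: "J x \<in> ell2" for x n
  proof -
    obtain c where c: "\<And>n. x n = green (J x) n + c * of_real (\<psi> n)"
      by (rule inhomogeneous_decaying [OF \<phi>2 x f]) auto
    let ?X = "ell2_norm x" and ?F = "ell2_norm (J x)"
    have X: "?X \<ge> 0" and F: "?F \<ge> 0" using x f by (auto simp: ell2_norm_nonneg)
    have "cmod c * \<bar>\<psi> j\<bar> = cmod (x j - green (J x) j)"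
      using c[of j] by (simp add: norm_mult)
    also have "\<dots> \<le> ?X + h_norm * ?F * h j"
      by (rule order_trans [OF norm_triangle_ineq4])
         (intro add_mono cmod_le_ell2_norm [OF x] green_bound_ell2 [OF f])
    also have "\<dots> \<le> (1 + h j * h_norm) * (?X + ?F)"
      using X F h_pos[of j] h_norm_nonneg by (simp add: algebra_simps)
    finally have cb: "cmod c \<le> (1 + h j * h_norm) / \<bar>\<psi> j\<bar> * (?X + ?F)"
      using j by (simp add: pos_le_divide_eq)
    have "cmod (x n) \<le> cmod (green (J x) n) + cmod c * \<bar>\<psi> n\<bar>"
      using c[of n] norm_triangle_ineq[of "green (J x) n" "c * of_real (\<psi> n)"] by (simp add: norm_mult)
    also have "\<dots> \<le> h_norm * ?F * h n + (1 + h j * h_norm) / \<bar>\<psi> j\<bar> * (?X + ?F) * h n"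
      using cb h_pos[of j] h_norm_nonneg X F by (intro add_mono green_bound_ell2 [OF f] mult_mono \<psi>_le) auto
    also have "\<dots> \<le> h_norm * (?X + ?F) * h n + (1 + h j * h_norm) / \<bar>\<psi> j\<bar> * (?X + ?F) * h n"
      using X F h_norm_nonneg h_pos[of n] by (intro add_right_mono mult_right_mono mult_left_mono) auto
    also have "\<dots> = C * (?X + ?F) * h n" unfolding C_def by (simp add: algebra_simps)
    finally show ?thesis .
  qed
  then show thesis using that C0 by blast
qed

text \<open>It suffices to choose the subsequence so that the entries at \<open>0\<close> converge, since the recurrence then
forces all other entries to converge. No mass escapes to infinity, because all \<open>x k\<close> are dominated by
one multiple of \<open>h\<close>.\<close>

lemma approximate_eigenvectors_converge:
  fixes x :: "nat \<Rightarrow> nat \<Rightarrow> complex" and z :: "nat \<Rightarrow> complex"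
  assumes \<phi>2: "\<not> summable (\<lambda>n. (\<phi> n)\<^sup>2)"
    and x: "\<And>k. x k \<in> ell2" and Jx: "\<And>k. J (x k) \<in> ell2" and unit: "\<And>k. ell2_norm (x k) = 1"
    and z: "z \<longlonglongrightarrow> w" and res: "(\<lambda>k. ell2_norm (\<lambda>n. J (x k) n - z k * x k n)) \<longlonglongrightarrow> 0"
  obtains r y where "strict_mono r" "y \<in> ell2" "\<And>n. J y n = w * y n" "ell2_norm y = 1"
    "(\<lambda>k. ell2_inner (x (r k)) y) \<longlonglongrightarrow> 1"
proof -
  define f where "f k n = J (x k) n - z k * x k n" for k n
  have f: "f k \<in> ell2" for k unfolding f_def by (intro ell2_diff ell2_scale x Jx)
  have Jf: "J (x k) = (\<lambda>n. z k * x k n + f k n)" for k unfolding f_def by simp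
  have fn: "(\<lambda>k. ell2_norm (f k)) \<longlonglongrightarrow> 0" using res unfolding f_def .
  obtain B1 where B1: "\<And>k. cmod (z k) \<le> B1"
    using convergent_imp_Bseq [OF convergentI [OF z]] unfolding Bseq_def by blast
  obtain B2 where B2: "\<And>k. ell2_norm (f k) \<le> B2"
    using convergent_imp_Bseq [OF convergentI [OF fn]] unfolding Bseq_def real_norm_def
    by (meson abs_le_D1)
  obtain C where C: "C \<ge> 0"
    "\<And>x n. x \<in> ell2 \<Longrightarrow> J x \<in> ell2 \<Longrightarrow> cmod (x n) \<le> C * (ell2_norm x + ell2_norm (J x)) * h n"
    by (rule domain_dominated [OF \<phi>2]) blast
  define D where "D = C * (1 + (B1 + B2))"
  have dom: "cmod (x k n) \<le> D * h n" for k n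
  proof -
    have "ell2_norm (J (x k)) \<le> cmod (z k) * ell2_norm (x k) + ell2_norm (f k)"
      unfolding Jf using ell2_norm_triangle [OF ell2_scale [OF x, of "z k" k] f [of k]]
      by (simp add: ell2_norm_scale x)
    then have "ell2_norm (J (x k)) \<le> B1 + B2" using B1[of k] B2[of k] unit[of k] by simp
    then have "C * (ell2_norm (x k) + ell2_norm (J (x k))) * h n \<le> D * h n"
      unfolding D_def using C(1) unit[of k] h_pos[of n] by (intro mult_right_mono mult_left_mono) auto
    with C(2) [OF x Jx, of k n] show ?thesis by simp
  qed
  have "bounded (range (\<lambda>k. x k 0))" using dom [of _ 0] by (auto simp: bounded_iff)
  from bounded_imp_convergent_subsequence [OF this]
  obtain l r where r: "strict_mono r" and l: "((\<lambda>k. x k 0) \<circ> r) \<longlonglongrightarrow> l" by blast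
  have zr: "(\<lambda>k. z (r k)) \<longlonglongrightarrow> w" using LIMSEQ_subseq_LIMSEQ [OF z r] by (simp add: o_def)
  have f0: "(\<lambda>k. f (r k) n) \<longlonglongrightarrow> 0" for n
  proof (rule Lim_null_comparison)
    show "(\<lambda>k. ell2_norm (f (r k))) \<longlonglongrightarrow> 0" using LIMSEQ_subseq_LIMSEQ [OF fn r] by (simp add: o_def)
    show "\<forall>\<^sub>F k in sequentially. norm (f (r k) n) \<le> ell2_norm (f (r k))"
      using cmod_le_ell2_norm [OF f] by simp
  qed
  have conv: "convergent (\<lambda>k. x (r k) n) \<and> convergent (\<lambda>k. x (r k) (Suc n))" for n
  proof (induction n)
    case 0
    have "J (x (r k)) 0 = z (r k) * x (r k) 0 + f (r k) 0" for k unfolding Jf ..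
    then have "x (r k) 1 = (z (r k) * x (r k) 0 + f (r k) 0 - of_real (b 0) * x (r k) 0) / of_real (a 0)" for k
      using a_pos[of 0] by (simp add: jacobi_action_0 field_simps)
    moreover have "(\<lambda>k. (z (r k) * x (r k) 0 + f (r k) 0 - of_real (b 0) * x (r k) 0) / of_real (a 0))
        \<longlonglongrightarrow> (w * l + 0 - of_real (b 0) * l) / of_real (a 0)"
      by (intro tendsto_intros zr f0 l [unfolded o_def]) (use a_pos[of 0] in simp)
    ultimately show ?case using l by (auto simp: o_def convergent_def)
  next
    case (Suc n)
    obtain l1 l2 where l1: "(\<lambda>k. x (r k) n) \<longlonglongrightarrow> l1" and l2: "(\<lambda>k. x (r k) (Suc n)) \<longlonglongrightarrow> l2"
      using Suc by (auto simp: convergent_def)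
    have "J (x (r k)) (Suc n) = z (r k) * x (r k) (Suc n) + f (r k) (Suc n)" for k unfolding Jf ..
    then have "x (r k) (Suc (Suc n)) = (z (r k) * x (r k) (Suc n) + f (r k) (Suc n)
        - of_real (b (Suc n)) * x (r k) (Suc n) - of_real (a n) * x (r k) n) / of_real (a (Suc n))" for k
      using a_pos[of "Suc n"] by (simp add: jacobi_action_Suc field_simps)
    moreover have "(\<lambda>k. (z (r k) * x (r k) (Suc n) + f (r k) (Suc n)
        - of_real (b (Suc n)) * x (r k) (Suc n) - of_real (a n) * x (r k) n) / of_real (a (Suc n)))
        \<longlonglongrightarrow> (w * l2 + 0 - of_real (b (Suc n)) * l2 - of_real (a n) * l1) / of_real (a (Suc n))"
      by (intro tendsto_intros zr f0 l1 l2) (use a_pos[of "Suc n"] in simp)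
    ultimately show ?case using Suc by (auto simp: convergent_def)
  qed
  define y where "y n = lim (\<lambda>k. x (r k) n)" for n
  have y: "(\<lambda>k. x (r k) n) \<longlonglongrightarrow> y n" for n
    using conv[of n] unfolding y_def by (simp add: convergent_LIMSEQ_iff)
  have yb: "cmod (y n) \<le> D * h n" for n
    by (rule Lim_bounded [OF tendsto_norm [OF y[of n]], of 0]) (use dom in simp)
  have y2: "y \<in> ell2" by (rule ell2_dominated [OF h_summable yb])
  have "J y n = w * y n" for n
  proof (rule LIMSEQ_unique)
    show "(\<lambda>k. J (x (r k)) n) \<longlonglongrightarrow> J y n"
      unfolding jacobi_action_def by (cases n; simp; intro tendsto_intros y)
    have "(\<lambda>k. z (r k) * x (r k) n + f (r k) n) \<longlonglongrightarrow> w * y n + 0"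
      by (intro tendsto_intros zr y f0)
    then show "(\<lambda>k. J (x (r k)) n) \<longlonglongrightarrow> w * y n" unfolding Jf by simp
  qed
  moreover have "ell2_norm y = 1"
  proof -
    have D2: "summable (\<lambda>n. D\<^sup>2 * (h n)\<^sup>2)" using h_summable by (rule summable_mult)
    have "(\<lambda>k. \<Sum>n. (cmod (x (r k) n))\<^sup>2) \<longlonglongrightarrow> (\<Sum>n. (cmod (y n))\<^sup>2)"
    proof (rule suminf_tendsto_dominated [OF _ _ D2])
      show "(\<lambda>k. (cmod (x (r k) n))\<^sup>2) \<longlonglongrightarrow> (cmod (y n))\<^sup>2" for n by (intro tendsto_intros y)
      show "norm ((cmod (x (r k) n))\<^sup>2) \<le> D\<^sup>2 * (h n)\<^sup>2" for k n
        using power_mono [OF dom [of "r k" n] norm_ge_zero, of 2] by (simp add: power_mult_distrib)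
    qed
    moreover have "(\<Sum>n. (cmod (x k n))\<^sup>2) = 1" for k
      using unit[of k] unfolding ell2_norm_def by simp
    ultimately have "(\<Sum>n. (cmod (y n))\<^sup>2) = 1" by (simp add: LIMSEQ_const_iff)
    then show ?thesis unfolding ell2_norm_def by simp
  qed
  moreover have "(\<lambda>k. ell2_inner (x (r k)) y) \<longlonglongrightarrow> 1"
  proof -
    have D2: "summable (\<lambda>n. D\<^sup>2 * (h n)\<^sup>2)" using h_summable by (rule summable_mult)
    have "(\<lambda>k. \<Sum>n. x (r k) n * cnj (y n)) \<longlonglongrightarrow> (\<Sum>n. y n * cnj (y n))"
    proof (rule suminf_tendsto_dominated [OF _ _ D2])
      show "(\<lambda>k. x (r k) n * cnj (y n)) \<longlonglongrightarrow> y n * cnj (y n)" for n by (intro tendsto_intros y)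
      fix k n
      have "cmod (x (r k) n) * cmod (y n) \<le> (D * h n) * (D * h n)"
        using order_trans [OF norm_ge_zero dom [of k n]] by (intro mult_mono dom yb) auto
      then show "norm (x (r k) n * cnj (y n)) \<le> D\<^sup>2 * (h n)\<^sup>2"
        by (simp add: norm_mult power2_eq_square mult_ac)
    qed
    then show ?thesis
      using ell2_inner_self [OF y2] \<open>ell2_norm y = 1\<close> unfolding ell2_inner_def by simp
  qed
  ultimately show thesis using that r y2 by blast
qed

text \<open>Off the eigenvalues \<open>J - z\<close> is bijective, and it is bounded below because otherwise normalised
approximate eigenvectors would converge to an eigenvector.\<close>

lemma spectrum_eigenvalue:
  assumes \<phi>2: "\<not> summable (\<lambda>n. (\<phi> n)\<^sup>2)" and z: "z \<in> op_spectrum (jacobi_max a b)"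
  obtains x where "x \<in> ell2" "\<And>n. J x n = z * x n" "x \<noteq> (\<lambda>n. 0)"
proof (rule ccontr)
  assume "\<not> thesis"
  then have noev: "\<And>x. x \<in> ell2 \<Longrightarrow> (\<And>n. J x n = z * x n) \<Longrightarrow> x = (\<lambda>n. 0)"
    using that by blast
  have "\<exists>!x. (x, \<lambda>n. z * x n + y n) \<in> jacobi_max a b" if y: "y \<in> ell2" for y
  proof -
    obtain x where x: "x \<in> ell2" "\<And>n. J x n = z * x n + y n"
      by (rule solve_off_eigenvalue [OF noev y]) auto
    have "(x, \<lambda>n. z * x n + y n) \<in> jacobi_max a b"
    proof -
      have "J x = (\<lambda>n. z * x n + y n)" using x by blast
      moreover have "(\<lambda>n. z * x n + y n) \<in> ell2" by (intro ell2_add ell2_scale x y)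
      ultimately show ?thesis unfolding jacobi_max_def using x by auto
    qed
    moreover have "x' = x" if "(x', \<lambda>n. z * x' n + y n) \<in> jacobi_max a b" for x'
    proof -
      have x2: "x' \<in> ell2" and "(\<lambda>n. z * x' n + y n) = J x'"
        using that unfolding jacobi_max_def by auto
      then have x': "J x' n = z * x' n + y n" for n by metis
      have "(\<lambda>n. x' n - x n) = (\<lambda>n. 0)"
        by (rule noev) (simp_all add: ell2_diff x x2 jacobi_action_diff x' algebra_simps)
      then show ?thesis by (simp add: fun_eq_iff)
    qed
    ultimately show ?thesis by blast
  qed
  moreover have "\<exists>C. \<forall>(x, u)\<in>jacobi_max a b. ell2_norm x \<le> C * ell2_norm (\<lambda>n. u n - z * x n)"
  proof (rule ccontr)
    assume "\<nexists>C. \<forall>(x, u)\<in>jacobi_max a b. ell2_norm x \<le> C * ell2_norm (\<lambda>n. u n - z * x n)"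
    then have "\<forall>k. \<exists>x. x \<in> ell2 \<and> J x \<in> ell2 \<and> ell2_norm x > real (Suc k) * ell2_norm (\<lambda>n. J x n - z * x n)"
      unfolding jacobi_max_def by (auto simp: not_le)
    from choice [OF this] obtain v where v: "\<And>k. v k \<in> ell2" "\<And>k. J (v k) \<in> ell2"
      "\<And>k. ell2_norm (v k) > real (Suc k) * ell2_norm (\<lambda>n. J (v k) n - z * v k n)" by blast
    have res: "(\<lambda>n. J (v k) n - z * v k n) \<in> ell2" for k by (intro ell2_diff ell2_scale v)
    have pos: "ell2_norm (v k) > 0" for k
    proof -
      have "0 \<le> real (Suc k) * ell2_norm (\<lambda>n. J (v k) n - z * v k n)"
        by (intro mult_nonneg_nonneg ell2_norm_nonneg res) simp
      then show ?thesis using v(3)[of k] by linarith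
    qed
    define t where "t k = complex_of_real (1 / ell2_norm (v k))" for k
    define x where "x k n = t k * v k n" for k n
    have x: "x k \<in> ell2" for k unfolding x_def by (intro ell2_scale v)
    have Jx': "J (x k) n = t k * J (v k) n" for k n unfolding x_def by (rule jacobi_action_scale)
    then have "J (x k) = (\<lambda>n. t k * J (v k) n)" for k by blast
    then have Jx: "J (x k) \<in> ell2" for k by (simp add: ell2_scale v)
    have unit: "ell2_norm (x k) = 1" for k
      using pos[of k] ell2_norm_scale [OF v(1), of "t k" k] unfolding x_def t_def
      by (simp add: norm_divide)
    have "ell2_norm (\<lambda>n. J (x k) n - z * x k n) \<le> 1 / real (Suc k)" for k
    proof -
      have "(\<lambda>n. J (x k) n - z * x k n) = (\<lambda>n. t k * (J (v k) n - z * v k n))"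
        unfolding Jx' x_def by (simp add: algebra_simps)
      then have "ell2_norm (\<lambda>n. J (x k) n - z * x k n)
        = ell2_norm (\<lambda>n. J (v k) n - z * v k n) / ell2_norm (v k)"
        using ell2_norm_scale [OF res, of "t k" k] pos[of k] by (simp add: t_def norm_divide)
      also have "\<dots> \<le> 1 / real (Suc k)"
        using v(3)[of k] pos[of k] by (simp add: divide_simps mult.commute del: of_nat_Suc)
      finally show ?thesis .
    qed
    then have "(\<lambda>k. ell2_norm (\<lambda>n. J (x k) n - z * x k n)) \<longlonglongrightarrow> 0"
      by (intro real_tendsto_sandwich [OF _ _ tendsto_const LIMSEQ_inverse_real_of_nat] always_eventually allI)
         (simp_all add: inverse_eq_divide ell2_norm_nonneg ell2_diff ell2_scale x Jx)
    from approximate_eigenvectors_converge [OF \<phi>2 x Jx unit tendsto_const this]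
    obtain y where "y \<in> ell2" "\<And>n. J y n = z * y n" "ell2_norm y = 1" by metis
    moreover from this have "y = (\<lambda>n. 0)" by (intro noev)
    ultimately show False by (simp add: ell2_norm_def)
  qed
  ultimately show False using z unfolding op_spectrum_def resolvent_set_def by blast
qed

text \<open>Eigenspaces are one-dimensional, as an eigenvector is determined by its entry at \<open>0\<close>. If eigenvalues
accumulated at \<open>z\<close>, unit eigenvectors would converge to a unit eigenvector for \<open>z\<close>, to which all
of them are orthogonal.\<close>

lemma essential_spectrum_empty:
  assumes sa: "self_adjoint (jacobi_matrix a b)"
  shows "essential_spectrum (jacobi_matrix a b) = {}"
proof -
  have \<phi>2: "\<not> summable (\<lambda>n. (\<phi> n)\<^sup>2)" using sa self_adjoint_iff by simp
  have max: "jacobi_matrix a b = jacobi_max a b"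
    using sa adjoint_jacobi_matrix unfolding self_adjoint_def by blast
  have sym: "ell2_inner (J u) y = ell2_inner u (J y)"
    if "u \<in> ell2" "J u \<in> ell2" "y \<in> ell2" "J y \<in> ell2" for u y
  proof -
    have "(y, J y) \<in> op_adjoint (jacobi_matrix a b)" "(u, J u) \<in> jacobi_matrix a b"
      unfolding adjoint_jacobi_matrix unfolding max jacobi_max_def using that by auto
    then show ?thesis unfolding op_adjoint_def by auto
  qed
  have eig: "\<exists>x. x \<in> ell2 \<and> J x \<in> ell2 \<and> J x = (\<lambda>n. z * x n) \<and> ell2_norm x = 1"
    if z: "z \<in> op_spectrum (jacobi_max a b)" for z
  proof -
    obtain x where x: "x \<in> ell2" "\<And>n. J x n = z * x n" "x \<noteq> (\<lambda>n. 0)"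
      by (rule spectrum_eigenvalue [OF \<phi>2 z]) blast
    have n0: "ell2_norm x \<noteq> 0" using x(3) ell2_norm_eq_zero [OF x(1)] by auto
    then have pos: "ell2_norm x > 0" using ell2_norm_nonneg [OF x(1)] by simp
    define u where "u n = complex_of_real (1 / ell2_norm x) * x n" for n
    have u: "u \<in> ell2" unfolding u_def by (intro ell2_scale x)
    have Ju: "J u = (\<lambda>n. z * u n)" unfolding u_def jacobi_action_scale x by (auto simp: jacobi_action_scale x)
    have "ell2_norm u = 1"
      using ell2_norm_scale [OF x(1), of "complex_of_real (1 / ell2_norm x)"] pos
      unfolding u_def by (simp add: norm_divide)
    then show ?thesis using u Ju by (intro exI [of _ u]) (auto simp: ell2_scale)
  qed
  have "z \<in> discrete_spectrum (jacobi_max a b)" if z: "z \<in> op_spectrum (jacobi_max a b)" for z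
  proof -
    obtain e where e: "e \<in> ell2" "J e \<in> ell2" "J e = (\<lambda>n. z * e n)" "ell2_norm e = 1"
      using eig [OF z] by blast
    have e0: "e \<noteq> (\<lambda>n. 0)" using e(4) by (auto simp: ell2_norm_def)
    have e_eig: "e \<in> eigenspace (jacobi_max a b) z"
      unfolding eigenspace_def jacobi_max_def using e by auto
    have "finite_dimensional (eigenspace (jacobi_max a b) z)"
      unfolding finite_dimensional_def
    proof (intro exI [of _ "{e}"] conjI ballI)
      show "finite {e}" by simp
      fix x assume "x \<in> eigenspace (jacobi_max a b) z"
      then have "(\<lambda>n. z * x n) = J x" unfolding eigenspace_def jacobi_max_def by auto
      then have x: "J x n = z * x n" for n by metis
      have ez: "J e n = z * e n" for n using e(3) by metis
      have zero: "u = (\<lambda>n. 0)" if u: "\<And>n. J u n = z * u n" "u 0 = 0" for u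
      proof -
        have "u 1 = 0" using u(1)[of 0] u(2) a_pos[of 0] by (simp add: jacobi_action_0)
        then show ?thesis using jacobi_homogeneous_zero [of a b u z] u a_pos by (metis less_irrefl)
      qed
      have "e 0 \<noteq> 0" using zero [OF ez] e0 by blast
      have "(\<lambda>n. x n - x 0 / e 0 * e n) = (\<lambda>n. 0)"
      proof (rule zero)
        show "J (\<lambda>n. x n - x 0 / e 0 * e n) n = z * (x n - x 0 / e 0 * e n)" for n
          unfolding jacobi_action_diff jacobi_action_scale x ez by (simp add: algebra_simps)
        show "x 0 - x 0 / e 0 * e 0 = 0" using \<open>e 0 \<noteq> 0\<close> by simp
      qed
      from fun_cong [OF this] have multiple: "x n = x 0 / e 0 * e n" for n
        unfolding right_minus_eq .
      have "x = (\<lambda>n. \<Sum>f\<in>{e}. x 0 / e 0 * f n)"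
      proof
        fix n show "x n = (\<Sum>f\<in>{e}. x 0 / e 0 * f n)" using multiple [of n] by simp
      qed
      then show "\<exists>c. x = (\<lambda>n. \<Sum>f\<in>{e}. c f * f n)" by (intro exI [of _ "\<lambda>_. x 0 / e 0"])
    qed
    moreover have "z isolated_in op_spectrum (jacobi_max a b)"
    proof (rule ccontr)
      assume "\<not> z isolated_in op_spectrum (jacobi_max a b)"
      then have "z islimpt op_spectrum (jacobi_max a b)" using z by (simp add: isolated_in_islimpt_iff)
      then obtain \<zeta> where \<zeta>: "\<And>k. \<zeta> k \<in> op_spectrum (jacobi_max a b) - {z}" "\<zeta> \<longlonglongrightarrow> z"
        unfolding islimpt_sequential by blast
      have "\<forall>k. \<exists>x. x \<in> ell2 \<and> J x \<in> ell2 \<and> J x = (\<lambda>n. \<zeta> k * x n) \<and> ell2_norm x = 1"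
        using eig \<zeta>(1) by blast
      then obtain x where x: "\<And>k. x k \<in> ell2" "\<And>k. J (x k) \<in> ell2"
        "\<And>k. J (x k) = (\<lambda>n. \<zeta> k * x k n)" "\<And>k. ell2_norm (x k) = 1" by metis
      have "(\<lambda>k. ell2_norm (\<lambda>n. J (x k) n - \<zeta> k * x k n)) \<longlonglongrightarrow> 0"
        unfolding x(3) by (simp add: ell2_norm_def)
      from approximate_eigenvectors_converge [OF \<phi>2 x(1,2,4) \<zeta>(2) this]
      obtain r y where r: "strict_mono r" and y: "y \<in> ell2" "\<And>n. J y n = z * y n" "ell2_norm y = 1"
        and lim: "(\<lambda>k. ell2_inner (x (r k)) y) \<longlonglongrightarrow> 1" by metis
      have Jy: "J y = (\<lambda>n. z * y n)" using y by blast
      have Jy2: "J y \<in> ell2" unfolding Jy by (intro ell2_scale y)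
      have left: "ell2_inner (\<lambda>n. c * u n) v = c * ell2_inner u v" if "u \<in> ell2" "v \<in> ell2" for c u v
        unfolding ell2_inner_def using suminf_mult [OF ell2_summable_inner [OF that], of c] by (simp add: mult.assoc)
      have right: "ell2_inner u (\<lambda>n. c * v n) = cnj c * ell2_inner u v" if "u \<in> ell2" "v \<in> ell2" for c u v
        unfolding ell2_inner_def using suminf_mult [OF ell2_summable_inner [OF that], of "cnj c"]
        by (simp add: mult_ac)
      have real: "cnj z = z"
        using sym [OF y(1) Jy2 y(1) Jy2] ell2_inner_self [OF y(1)] y(3)
        unfolding Jy by (simp add: left right y)
      have "ell2_inner (x k) y = 0" for k
        using sym [OF x(1,2) y(1) Jy2, of k] \<zeta>(1)[of k] unfolding x(3) Jy
        by (simp add: left right x y real)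
      then show False using lim by (simp add: LIMSEQ_const_iff)
    qed
    ultimately show ?thesis unfolding discrete_spectrum_def using e_eig e0 by blast
  qed
  then show ?thesis unfolding essential_spectrum_def max by blast
qed

end

section \<open>Discrete Levinson dichotomy\<close>

text \<open>A diagonal system with multipliers \<open>p \<ge> q\<close> and a summable error. Relative to the product of the \<open>p\<close>,
one step multiplies the size by at most \<open>1 + 4 e\<close>. As long as the total error \<open>F\<close> is at most \<open>1 / 8\<close>,
the accumulated product of these factors stays below \<open>1 + 8 F \<le> 2\<close>. The error term is stated with
the values at \<open>Suc k\<close>, so that the same hypotheses serve for running the system backwards.\<close>

lemma perturbed_diagonal_forward:
  fixes p q e X Y :: "nat \<Rightarrow> real"
  assumes q: "\<And>k. 0 < q k" and qp: "\<And>k. q k \<le> p k"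
    and e: "\<And>k. 0 \<le> e k" and E: "\<And>k. (\<Sum>j<k. e j) \<le> 1 / 8"
    and X: "\<And>k. \<bar>X (Suc k) - p k * X k\<bar> \<le> e k * (\<bar>X (Suc k)\<bar> + \<bar>Y (Suc k)\<bar>)"
    and Y: "\<And>k. \<bar>Y (Suc k) - q k * Y k\<bar> \<le> e k * (\<bar>X (Suc k)\<bar> + \<bar>Y (Suc k)\<bar>)"
  shows "\<bar>X k\<bar> + \<bar>Y k\<bar> \<le> 2 * (\<Prod>j<k. p j) * (\<bar>X 0\<bar> + \<bar>Y 0\<bar>)"
    and "\<bar>X k - (\<Prod>j<k. p j) * X 0\<bar> \<le> (\<Prod>j<k. p j) * (\<bar>X 0\<bar> + \<bar>Y 0\<bar>) / 4"
proof -
  define s where "s k = \<bar>X k\<bar> + \<bar>Y k\<bar>" for k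
  define P where "P k = (\<Prod>j<k. p j)" for k
  define F where "F k = (\<Sum>j<k. e j)" for k
  have s: "s k \<ge> 0" for k unfolding s_def by simp
  have p: "p k > 0" for k using q[of k] qp[of k] by simp
  have P: "P k > 0" and PS: "P (Suc k) = p k * P k" for k
    unfolding P_def by (auto intro: prod_pos p)
  have F0: "F k \<ge> 0" and F1: "F k \<le> 1 / 8" and FS: "F (Suc k) = F k + e k" for k
    unfolding F_def using E by (auto intro: sum_nonneg e)
  have e8: "e k \<le> 1 / 8" for k using F0[of k] F1[of "Suc k"] FS[of k] by simp
  have step: "s (Suc k) \<le> p k * s k * (1 + 4 * e k)" for k
  proof -
    have "\<bar>X (Suc k)\<bar> \<le> p k * \<bar>X k\<bar> + e k * s (Suc k)"
    proof -
      have "\<bar>X (Suc k)\<bar> \<le> \<bar>p k * X k\<bar> + e k * s (Suc k)" using X[of k] unfolding s_def by linarith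
      then show ?thesis using p[of k] by (simp add: abs_mult)
    qed
    moreover have "\<bar>Y (Suc k)\<bar> \<le> p k * \<bar>Y k\<bar> + e k * s (Suc k)"
    proof -
      have "\<bar>Y (Suc k)\<bar> \<le> \<bar>q k * Y k\<bar> + e k * s (Suc k)" using Y[of k] unfolding s_def by linarith
      moreover have "\<bar>q k * Y k\<bar> \<le> p k * \<bar>Y k\<bar>"
        using q[of k] qp[of k] by (simp add: abs_mult mult_right_mono)
      ultimately show ?thesis by linarith
    qed
    moreover have "p k * s k = p k * \<bar>X k\<bar> + p k * \<bar>Y k\<bar>" unfolding s_def by (rule distrib_left)
    moreover have "s (Suc k) * (1 - 2 * e k) = s (Suc k) - 2 * (e k * s (Suc k))"
      by (simp add: right_diff_distrib)
    ultimately have 1: "s (Suc k) * (1 - 2 * e k) \<le> p k * s k"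
      using s_def [of "Suc k"] by linarith
    have "(1 - 2 * e k) * (1 + 4 * e k) = 1 + 2 * e k * (1 - 4 * e k)" by (simp add: algebra_simps)
    moreover have "0 \<le> 2 * e k * (1 - 4 * e k)" using e[of k] e8[of k] by (intro mult_nonneg_nonneg) auto
    ultimately have "1 \<le> (1 - 2 * e k) * (1 + 4 * e k)" by linarith
    then have "s (Suc k) * 1 \<le> s (Suc k) * ((1 - 2 * e k) * (1 + 4 * e k))"
      using s by (rule mult_left_mono)
    also have "\<dots> = s (Suc k) * (1 - 2 * e k) * (1 + 4 * e k)" by simp
    also have "\<dots> \<le> p k * s k * (1 + 4 * e k)" using 1 e[of k] by (intro mult_right_mono) auto
    finally show ?thesis by simp
  qed
  have grow: "s k \<le> P k * s 0 * (1 + 8 * F k)" for k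
  proof (induction k)
    case 0 show ?case by (simp add: P_def F_def)
  next
    case (Suc k)
    have "s (Suc k) \<le> p k * s k * (1 + 4 * e k)" by (rule step)
    also have "\<dots> \<le> p k * (P k * s 0 * (1 + 8 * F k)) * (1 + 4 * e k)"
      using Suc p[of k] e[of k] by (intro mult_right_mono mult_left_mono) auto
    also have "\<dots> = P (Suc k) * s 0 * ((1 + 8 * F k) * (1 + 4 * e k))" by (simp add: PS)
    also have "\<dots> \<le> P (Suc k) * s 0 * (1 + 8 * F (Suc k))"
    proof (rule mult_left_mono)
      have "4 * e k * (8 * F k) \<le> 4 * e k * 1" using e[of k] F1[of k] by (intro mult_left_mono) auto
      then show "(1 + 8 * F k) * (1 + 4 * e k) \<le> 1 + 8 * F (Suc k)"
        unfolding FS by (simp add: algebra_simps)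
      show "0 \<le> P (Suc k) * s 0" using P[of "Suc k"] s by simp
    qed
    finally show ?case .
  qed
  have bound: "s k \<le> 2 * P k * s 0" for k
  proof -
    have "P k * s 0 * (1 + 8 * F k) \<le> P k * s 0 * 2"
      using P[of k] s[of 0] F1[of k] by (intro mult_left_mono) auto
    with grow[of k] show ?thesis by simp
  qed
  then show "\<bar>X k\<bar> + \<bar>Y k\<bar> \<le> 2 * (\<Prod>j<k. p j) * (\<bar>X 0\<bar> + \<bar>Y 0\<bar>)" unfolding s_def P_def .
  have "\<bar>X k - P k * X 0\<bar> \<le> P k * s 0 * (2 * F k)" for k
  proof (induction k)
    case 0 show ?case by (simp add: P_def F_def)
  next
    case (Suc k)
    have "X (Suc k) - P (Suc k) * X 0 = (X (Suc k) - p k * X k) + p k * (X k - P k * X 0)"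
      by (simp add: PS algebra_simps)
    then have "\<bar>X (Suc k) - P (Suc k) * X 0\<bar> \<le> \<bar>X (Suc k) - p k * X k\<bar> + p k * \<bar>X k - P k * X 0\<bar>"
      using p[of k] by (metis abs_triangle_ineq abs_mult abs_of_pos)
    also have "\<dots> \<le> e k * (2 * P (Suc k) * s 0) + p k * (P k * s 0 * (2 * F k))"
    proof (rule add_mono)
      have "\<bar>X (Suc k) - p k * X k\<bar> \<le> e k * s (Suc k)" using X unfolding s_def .
      also have "\<dots> \<le> e k * (2 * P (Suc k) * s 0)" by (rule mult_left_mono [OF bound e])
      finally show "\<bar>X (Suc k) - p k * X k\<bar> \<le> e k * (2 * P (Suc k) * s 0)" .
      show "p k * \<bar>X k - P k * X 0\<bar> \<le> p k * (P k * s 0 * (2 * F k))"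
        using p[of k] by (intro mult_left_mono Suc) simp
    qed
    also have "\<dots> = P (Suc k) * s 0 * (2 * F (Suc k))" by (simp add: PS FS algebra_simps)
    finally show ?case .
  qed
  also have "P k * s 0 * (2 * F k) \<le> P k * s 0 * (1 / 4)"
    using P[of k] s[of 0] F1[of k] by (intro mult_left_mono) auto
  finally show "\<bar>X k - (\<Prod>j<k. p j) * X 0\<bar> \<le> (\<Prod>j<k. p j) * (\<bar>X 0\<bar> + \<bar>Y 0\<bar>) / 4"
    unfolding s_def P_def by simp
qed

text \<open>Read backwards from \<open>L\<close>, the roles of the components are exchanged: dividing by \<open>q\<close> dominates dividing
by \<open>p\<close>, so sizes are compared with the product of the \<open>q\<close>.\<close>

lemma perturbed_diagonal_backward:
  fixes p q e X Y :: "nat \<Rightarrow> real"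
  assumes q: "\<And>k. 0 < q k" and qp: "\<And>k. q k \<le> p k"
    and e: "\<And>k. 0 \<le> e k" and E: "\<And>k. (\<Sum>j<k. e j) \<le> 1 / 8"
    and X: "\<And>k. \<bar>X (Suc k) - p k * X k\<bar> \<le> e k * (\<bar>X (Suc k)\<bar> + \<bar>Y (Suc k)\<bar>)"
    and Y: "\<And>k. \<bar>Y (Suc k) - q k * Y k\<bar> \<le> e k * (\<bar>X (Suc k)\<bar> + \<bar>Y (Suc k)\<bar>)"
    and k: "k \<le> L"
  shows "(\<bar>X k\<bar> + \<bar>Y k\<bar>) * (\<Prod>j<L. q j) \<le> 2 * (\<Prod>j<k. q j) * (\<bar>X L\<bar> + \<bar>Y L\<bar>)"
    and "\<bar>Y k * (\<Prod>j<L. q j) - (\<Prod>j<k. q j) * Y L\<bar> \<le> (\<Prod>j<k. q j) * (\<bar>X L\<bar> + \<bar>Y L\<bar>) / 2"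
proof -
  define s where "s k = \<bar>X k\<bar> + \<bar>Y k\<bar>" for k
  define Q where "Q k = (\<Prod>j<k. q j)" for k
  define F where "F k = (\<Sum>j\<in>{k..<L}. e j)" for k
  have s: "s k \<ge> 0" for k unfolding s_def by simp
  have Q: "Q k > 0" and QS: "Q (Suc k) = q k * Q k" for k
    unfolding Q_def by (auto intro: prod_pos q)
  have F0: "F k \<ge> 0" for k unfolding F_def by (intro sum_nonneg e)
  have F1: "F k \<le> 1 / 8" for k
  proof -
    have "F k \<le> (\<Sum>j<L. e j)" unfolding F_def by (intro sum_mono2) (auto simp: e)
    with E [of L] show ?thesis by linarith
  qed
  have FS: "F k = F (Suc k) + e k" if "k < L" for k
    unfolding F_def using that by (simp add: sum.atLeast_Suc_lessThan)
  have step: "q k * s k \<le> s (Suc k) * (1 + 2 * e k)" for k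
  proof -
    have "q k * \<bar>X k\<bar> \<le> \<bar>p k * X k\<bar>" using q[of k] qp[of k] by (simp add: abs_mult mult_right_mono)
    then have "q k * \<bar>X k\<bar> \<le> \<bar>X (Suc k)\<bar> + e k * s (Suc k)" using X[of k] unfolding s_def by linarith
    moreover have "\<bar>q k * Y k\<bar> \<le> \<bar>Y (Suc k)\<bar> + e k * s (Suc k)" using Y[of k] unfolding s_def by linarith
    ultimately show ?thesis using q[of k] unfolding s_def by (simp add: abs_mult algebra_simps)
  qed
  have grow: "s k * Q L \<le> Q k * s L * (1 + 4 * F k)" if "k \<le> L" for k
    using that
  proof (induction rule: inc_induct)
    case base show ?case by (simp add: F_def mult.commute)
  next
    case (step k)
    have "q k * (s k * Q L) = (q k * s k) * Q L" by simp
    also have "\<dots> \<le> s (Suc k) * (1 + 2 * e k) * Q L"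
      using \<open>\<And>k. q k * s k \<le> s (Suc k) * (1 + 2 * e k)\<close> Q[of L] by (intro mult_right_mono) auto
    also have "\<dots> = (s (Suc k) * Q L) * (1 + 2 * e k)" by simp
    also have "\<dots> \<le> (Q (Suc k) * s L * (1 + 4 * F (Suc k))) * (1 + 2 * e k)"
      using step.IH e[of k] by (intro mult_right_mono) auto
    also have "\<dots> = q k * (Q k * s L) * ((1 + 4 * F (Suc k)) * (1 + 2 * e k))" by (simp add: QS)
    also have "\<dots> \<le> q k * (Q k * s L) * (1 + 4 * F k)"
    proof (rule mult_left_mono)
      have "2 * e k * (4 * F (Suc k)) \<le> 2 * e k * 1" using e[of k] F1[of "Suc k"] by (intro mult_left_mono) auto
      then show "(1 + 4 * F (Suc k)) * (1 + 2 * e k) \<le> 1 + 4 * F k"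
        unfolding FS [OF step.hyps(2)] by (simp add: algebra_simps)
      show "0 \<le> q k * (Q k * s L)" using q[of k] Q[of k] s[of L] by simp
    qed
    finally show ?case using q[of k] by (simp add: mult.assoc)
  qed
  have bound: "s k * Q L \<le> 2 * Q k * s L" if "k \<le> L" for k
  proof -
    have "Q k * s L * (1 + 4 * F k) \<le> Q k * s L * 2"
      using Q[of k] s[of L] F1[of k] by (intro mult_left_mono) auto
    with grow[OF that] show ?thesis by simp
  qed
  then show "(\<bar>X k\<bar> + \<bar>Y k\<bar>) * (\<Prod>j<L. q j) \<le> 2 * (\<Prod>j<k. q j) * (\<bar>X L\<bar> + \<bar>Y L\<bar>)"
    using k unfolding s_def Q_def .
  have "\<bar>Y k * Q L - Q k * Y L\<bar> \<le> Q k * s L * (2 * F k)" if "k \<le> L" for k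
    using that
  proof (induction rule: inc_induct)
    case base show ?case by (simp add: F_def mult.commute)
  next
    case (step k)
    have "q k * (Y k * Q L - Q k * Y L)
        = (Y (Suc k) * Q L - Q (Suc k) * Y L) - (Y (Suc k) - q k * Y k) * Q L"
      by (simp add: QS algebra_simps)
    moreover have "q k * \<bar>Y k * Q L - Q k * Y L\<bar> = \<bar>q k * (Y k * Q L - Q k * Y L)\<bar>"
      using q[of k] by (simp add: abs_mult)
    moreover have "\<bar>Y (Suc k) - q k * Y k\<bar> * Q L = \<bar>(Y (Suc k) - q k * Y k) * Q L\<bar>"
      using Q[of L] by (simp add: abs_mult)
    ultimately have "q k * \<bar>Y k * Q L - Q k * Y L\<bar>
        \<le> \<bar>Y (Suc k) * Q L - Q (Suc k) * Y L\<bar> + \<bar>Y (Suc k) - q k * Y k\<bar> * Q L"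
      by (simp only: abs_triangle_ineq4)
    also have "\<dots> \<le> Q (Suc k) * s L * (2 * F (Suc k)) + e k * s (Suc k) * Q L"
      using Y[of k] Q[of L] unfolding s_def [of "Suc k"] by (intro add_mono step.IH mult_right_mono) auto
    also have "e k * s (Suc k) * Q L = e k * (s (Suc k) * Q L)" by simp
    also have "\<dots> \<le> e k * (2 * Q (Suc k) * s L)"
      using bound [of "Suc k"] step.hyps e[of k] by (intro mult_left_mono) auto
    also have "Q (Suc k) * s L * (2 * F (Suc k)) + e k * (2 * Q (Suc k) * s L)
        = q k * (Q k * s L * (2 * F k))"
      unfolding FS [OF step.hyps(2)] QS by (simp add: algebra_simps)
    finally show ?case using q[of k] by simp
  qed
  from this [OF k] have "\<bar>Y k * Q L - Q k * Y L\<bar> \<le> Q k * s L * (2 * F k)" .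
  also have "\<dots> \<le> Q k * s L * (1 / 2)"
    using Q[of k] s[of L] F1[of k] by (intro mult_left_mono) auto
  finally show "\<bar>Y k * (\<Prod>j<L. q j) - (\<Prod>j<k. q j) * Y L\<bar> \<le> (\<Prod>j<k. q j) * (\<bar>X L\<bar> + \<bar>Y L\<bar>) / 2"
    unfolding s_def Q_def by simp
qed

text \<open>The solution that equals \<open>(0, Q\<^sub>L)\<close> at \<open>L\<close> has size at most \<open>2 Q\<^sub>k\<close> for all \<open>k \<le> L\<close>, and its second component at
\<open>0\<close> stays away from zero. The initial values of these solutions are bounded, and a limit point of
them for \<open>L\<close> tending to infinity is the initial value of a solution small for all \<open>k\<close>. The functions
\<open>X k\<close> and \<open>Y k\<close> give the components at \<open>k\<close> in terms of the initial value.\<close>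

lemma recessive_solution_exists:
  fixes p q e :: "nat \<Rightarrow> real" and X Y :: "nat \<Rightarrow> real \<times> real \<Rightarrow> real"
  assumes q: "\<And>k. 0 < q k" and qp: "\<And>k. q k \<le> p k"
    and e: "\<And>k. 0 \<le> e k" and E: "\<And>k. (\<Sum>j<k. e j) \<le> 1 / 8"
    and X: "\<And>k c. \<bar>X (Suc k) c - p k * X k c\<bar> \<le> e k * (\<bar>X (Suc k) c\<bar> + \<bar>Y (Suc k) c\<bar>)"
    and Y: "\<And>k c. \<bar>Y (Suc k) c - q k * Y k c\<bar> \<le> e k * (\<bar>X (Suc k) c\<bar> + \<bar>Y (Suc k) c\<bar>)"
    and contX: "\<And>k. continuous_on UNIV (X k)" and contY: "\<And>k. continuous_on UNIV (Y k)"
    and init: "\<And>c. X 0 c = fst c" "\<And>c. Y 0 c = snd c"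
    and surj: "\<And>k x y. \<exists>c. X k c = x \<and> Y k c = y"
  obtains c where "snd c \<ge> 1 / 2" "\<And>k. \<bar>X k c\<bar> + \<bar>Y k c\<bar> \<le> 2 * (\<Prod>j<k. q j)"
proof -
  define Q where "Q k = (\<Prod>j<k. q j)" for k
  have Q: "Q k > 0" for k unfolding Q_def by (intro prod_pos) (simp add: q)
  have "\<forall>L. \<exists>c. X L c = 0 \<and> Y L c = Q L" using surj by blast
  then obtain d where d: "\<And>L. X L (d L) = 0" "\<And>L. Y L (d L) = Q L" by metis
  have small: "\<bar>X k (d L)\<bar> + \<bar>Y k (d L)\<bar> \<le> 2 * Q k" if "k \<le> L" for k L
  proof -
    have "(\<bar>X k (d L)\<bar> + \<bar>Y k (d L)\<bar>) * Q L \<le> 2 * Q k * (\<bar>X L (d L)\<bar> + \<bar>Y L (d L)\<bar>)"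
      unfolding Q_def
      by (rule perturbed_diagonal_backward(1) [of q p e "\<lambda>k. X k (d L)" "\<lambda>k. Y k (d L)", OF q qp e E X Y that])
    also have "\<dots> = 2 * Q k * Q L" using d Q[of L] by simp
    finally show ?thesis using Q[of L] by simp
  qed
  have large: "snd (d L) \<ge> 1 / 2" for L
  proof -
    have "\<bar>Y 0 (d L) * Q L - Q 0 * Y L (d L)\<bar> \<le> Q 0 * (\<bar>X L (d L)\<bar> + \<bar>Y L (d L)\<bar>) / 2"
      unfolding Q_def
      by (rule perturbed_diagonal_backward(2) [of q p e "\<lambda>k. X k (d L)" "\<lambda>k. Y k (d L)", OF q qp e E X Y]) simp
    then have "\<bar>snd (d L) * Q L - Q L\<bar> \<le> Q L / 2" using d Q[of L] init by (simp add: Q_def [of 0])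
    then have "1 / 2 * Q L \<le> snd (d L) * Q L" by linarith
    then show ?thesis using Q[of L] by (simp only: mult_le_cancel_right_pos)
  qed
  have "norm (d L) \<le> 2" for L
    using small [of 0 L] norm_Pair_le [of "fst (d L)" "snd (d L)"] init by (simp add: Q_def)
  then have "bounded (range d)" by (auto simp: bounded_iff)
  from bounded_imp_convergent_subsequence [OF this]
  obtain c r where r: "strict_mono r" and c: "(d \<circ> r) \<longlonglongrightarrow> c" by blast
  have lim: "(\<lambda>j. g (d (r j))) \<longlonglongrightarrow> g c" if "continuous_on UNIV g" for g :: "real \<times> real \<Rightarrow> real"
    using continuous_on_tendsto_compose [OF that c] by (simp add: o_def)
  show thesis
  proof (rule that)
    show "snd c \<ge> 1 / 2"
      by (rule LIMSEQ_le_const [OF lim [of snd]]) (use large in \<open>auto intro: continuous_intros\<close>)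
    show "\<bar>X k c\<bar> + \<bar>Y k c\<bar> \<le> 2 * (\<Prod>j<k. q j)" for k
    proof (rule LIMSEQ_le_const2 [OF lim [of "\<lambda>c. \<bar>X k c\<bar> + \<bar>Y k c\<bar>"]])
      show "continuous_on UNIV (\<lambda>c. \<bar>X k c\<bar> + \<bar>Y k c\<bar>)" by (intro continuous_intros contX contY)
      show "\<exists>N. \<forall>n\<ge>N. \<bar>X k (d (r n))\<bar> + \<bar>Y k (d (r n))\<bar> \<le> 2 * (\<Prod>j<k. q j)"
        using small seq_suble [OF r] order_trans unfolding Q_def by (intro exI [of _ k]) blast
    qed
  qed
qed

section \<open>Sequences of bounded variation\<close>

definition bv :: "(nat \<Rightarrow> real) \<Rightarrow> bool" where
  "bv f \<longleftrightarrow> summable (\<lambda>n. \<bar>f (Suc n) - f n\<bar>)"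

lemma bv_add: assumes "bv f" "bv g" shows "bv (\<lambda>n. f n + g n)"
  unfolding bv_def
  by (rule summable_comparison_test' [OF summable_add [OF assms [unfolded bv_def]]])
     (simp add: abs_triangle_ineq4 [THEN order_trans])

lemma bv_cmult: assumes "bv f" shows "bv (\<lambda>n. c * f n)"
  using summable_mult [OF assms [unfolded bv_def], of "\<bar>c\<bar>"]
  unfolding bv_def by (simp add: abs_mult flip: right_diff_distrib)

lemma bv_diff: assumes "bv f" "bv g" shows "bv (\<lambda>n. f n - g n)"
  using bv_add [OF assms(1) bv_cmult [OF assms(2), of "-1"]] by simp

lemma bv_mult:
  assumes f: "bv f" and g: "bv g" and cf: "convergent f" and cg: "convergent g"
  shows "bv (\<lambda>n. f n * g n)"
proof -
  obtain F where F: "\<And>n. \<bar>f n\<bar> \<le> F"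
    using convergent_imp_Bseq [OF cf] unfolding Bseq_def real_norm_def by blast
  obtain G where G: "\<And>n. \<bar>g n\<bar> \<le> G"
    using convergent_imp_Bseq [OF cg] unfolding Bseq_def real_norm_def by blast
  have "summable (\<lambda>n. F * \<bar>g (Suc n) - g n\<bar> + G * \<bar>f (Suc n) - f n\<bar>)"
    by (intro summable_add summable_mult f [unfolded bv_def] g [unfolded bv_def])
  moreover have "norm \<bar>f (Suc n) * g (Suc n) - f n * g n\<bar> \<le> F * \<bar>g (Suc n) - g n\<bar> + G * \<bar>f (Suc n) - f n\<bar>" for n
  proof -
    have "f (Suc n) * g (Suc n) - f n * g n = f (Suc n) * (g (Suc n) - g n) + g n * (f (Suc n) - f n)"
      by (simp add: algebra_simps)
    then have "\<bar>f (Suc n) * g (Suc n) - f n * g n\<bar> \<le> \<bar>f (Suc n)\<bar> * \<bar>g (Suc n) - g n\<bar> + \<bar>g n\<bar> * \<bar>f (Suc n) - f n\<bar>"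
      by (metis abs_triangle_ineq abs_mult)
    also have "\<dots> \<le> F * \<bar>g (Suc n) - g n\<bar> + G * \<bar>f (Suc n) - f n\<bar>"
      by (intro add_mono mult_right_mono F G) auto
    finally show ?thesis by simp
  qed
  ultimately show ?thesis unfolding bv_def by (rule summable_comparison_test')
qed

text \<open>The square root is Lipschitz on the interval above \<open>l / 2\<close>, which contains all but finitely many terms.\<close>

lemma bv_sqrt:
  assumes f: "bv f" and l: "f \<longlonglongrightarrow> l" "l > 0"
  shows "bv (\<lambda>n. sqrt (f n))"
proof -
  have "eventually (\<lambda>n. f n > l / 2) sequentially" using order_tendstoD(1) [OF l(1), of "l / 2"] l(2) by simp
  then obtain N where N: "\<And>n. n \<ge> N \<Longrightarrow> f n > l / 2" unfolding eventually_sequentially by blast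
  define d where "d = sqrt (l / 2)"
  have d: "d > 0" unfolding d_def using l(2) by simp
  have "summable (\<lambda>n. 1 / d * \<bar>f (Suc n) - f n\<bar>)" using f unfolding bv_def by (rule summable_mult)
  moreover have "norm \<bar>sqrt (f (Suc n)) - sqrt (f n)\<bar> \<le> 1 / d * \<bar>f (Suc n) - f n\<bar>" if "n \<ge> N" for n
  proof -
    have pos: "f n > l / 2" "f (Suc n) > l / 2" using N that by auto
    then have sd: "sqrt (f n) \<ge> d" "sqrt (f (Suc n)) \<ge> 0" unfolding d_def using l(2) by auto
    have "f (Suc n) - f n = (sqrt (f (Suc n)) - sqrt (f n)) * (sqrt (f (Suc n)) + sqrt (f n))"
      using pos l(2) by (simp add: algebra_simps)
    then have "\<bar>f (Suc n) - f n\<bar> = \<bar>sqrt (f (Suc n)) - sqrt (f n)\<bar> * (sqrt (f (Suc n)) + sqrt (f n))"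
      using sd d by (metis abs_mult abs_of_nonneg add_nonneg_nonneg less_imp_le order_trans)
    also have "\<dots> \<ge> \<bar>sqrt (f (Suc n)) - sqrt (f n)\<bar> * d"
      using sd d by (intro mult_left_mono) linarith+
    finally show ?thesis using d by (simp add: field_simps)
  qed
  ultimately show ?thesis unfolding bv_def by (rule summable_comparison_test')
qed

section \<open>Asymptotic diagonalisation\<close>

text \<open>The discriminant and the two eigenvalues of the matrix with rows \<open>(A, B)\<close> and \<open>(C, D)\<close>. Working with
the four entries makes left eigenvectors explicit.\<close>

definition disc2 :: "real \<Rightarrow> real \<Rightarrow> real \<Rightarrow> real \<Rightarrow> real" where
  "disc2 A B C D = (A - D)\<^sup>2 + 4 * B * C"

definition eig_plus :: "real \<Rightarrow> real \<Rightarrow> real \<Rightarrow> real \<Rightarrow> real" where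
  "eig_plus A B C D = (A + D + sqrt (disc2 A B C D)) / 2"

definition eig_minus :: "real \<Rightarrow> real \<Rightarrow> real \<Rightarrow> real \<Rightarrow> real" where
  "eig_minus A B C D = (A + D - sqrt (disc2 A B C D)) / 2"

lemma eig_swap:
  "disc2 D C B A = disc2 A B C D" "eig_plus D C B A = eig_plus A B C D"
  "eig_minus D C B A = eig_minus A B C D"
  by (simp_all add: disc2_def eig_plus_def eig_minus_def power2_commute add.commute)

text \<open>The number \<open>l\<close> is \<open>A - \<mu>\<^sup>- = \<mu>\<^sup>+ - D\<close>, so \<open>(l, B)\<close> and \<open>(C, - l)\<close> are left eigenvectors for \<open>\<mu>\<^sup>+\<close> and \<open>\<mu>\<^sup>-\<close>.
The last identity gives their determinant.\<close>

lemma left_eigenvectors: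
  fixes A B C D :: real
  assumes "disc2 A B C D \<ge> 0"
  defines "l \<equiv> (A - D + sqrt (disc2 A B C D)) / 2"
  shows "l * A + B * C = eig_plus A B C D * l" "l * B + B * D = eig_plus A B C D * B"
    "C * A - l * C = eig_minus A B C D * C" "C * B - l * D = eig_minus A B C D * (- l)"
    "l * (- l) - B * C = - (sqrt (disc2 A B C D) * l)"
proof -
  define s where "s = sqrt (disc2 A B C D)"
  have s: "s * s = (A - D) * (A - D) + 4 * B * C"
    using assms(1) unfolding s_def by (simp add: disc2_def power2_eq_square)
  then have BC: "B * C = (s * s - (A - D) * (A - D)) / 4" "C * B = (s * s - (A - D) * (A - D)) / 4"
    by simp_all
  show "l * A + B * C = eig_plus A B C D * l" "l * B + B * D = eig_plus A B C D * B"
    "C * A - l * C = eig_minus A B C D * C" "C * B - l * D = eig_minus A B C D * (- l)"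
    "l * (- l) - B * C = - (sqrt (disc2 A B C D) * l)"
    unfolding BC l_def eig_plus_def eig_minus_def s_def [symmetric] by (simp_all add: field_simps)
qed

text \<open>The functions \<open>x k\<close> and \<open>y k\<close> are coordinates on the plane, uniformly equivalent to the standard ones,
in which the step \<open>T k\<close> multiplies by \<open>p k\<close> and \<open>q k\<close> up to the summable relative error \<open>e k\<close>.\<close>

definition asymptotically_diagonal ::
  "nat \<Rightarrow> (nat \<Rightarrow> real \<Rightarrow> real \<Rightarrow> real \<times> real) \<Rightarrow> (nat \<Rightarrow> real) \<Rightarrow> (nat \<Rightarrow> real) \<Rightarrow>
   (nat \<Rightarrow> real \<Rightarrow> real \<Rightarrow> real) \<Rightarrow> (nat \<Rightarrow> real \<Rightarrow> real \<Rightarrow> real) \<Rightarrow> (nat \<Rightarrow> real) \<Rightarrow> real \<Rightarrow> bool" where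
  "asymptotically_diagonal K T p q x y e c \<longleftrightarrow>
    c > 0 \<and> summable e \<and> (\<forall>k. 0 \<le> e k) \<and>
    (\<forall>k\<ge>K. 0 < q k \<and> q k \<le> p k \<and>
       (\<forall>u v. \<bar>x k u v\<bar> + \<bar>y k u v\<bar> \<le> c * (\<bar>u\<bar> + \<bar>v\<bar>)) \<and>
       (\<forall>u v. \<bar>u\<bar> + \<bar>v\<bar> \<le> c * (\<bar>x k u v\<bar> + \<bar>y k u v\<bar>)) \<and>
       (\<forall>u v u' v'. T k u v = (u', v') \<longrightarrow>
          \<bar>x (Suc k) u' v' - p k * x k u v\<bar> \<le> e k * (\<bar>x (Suc k) u' v'\<bar> + \<bar>y (Suc k) u' v'\<bar>) \<and>
          \<bar>y (Suc k) u' v' - q k * y k u v\<bar> \<le> e k * (\<bar>x (Suc k) u' v'\<bar> + \<bar>y (Suc k) u' v'\<bar>)))"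

definition near_identity_step ::
  "(nat \<Rightarrow> real) \<Rightarrow> (nat \<Rightarrow> real) \<Rightarrow> (nat \<Rightarrow> real) \<Rightarrow> (nat \<Rightarrow> real) \<Rightarrow> (nat \<Rightarrow> real) \<Rightarrow>
   nat \<Rightarrow> real \<Rightarrow> real \<Rightarrow> real \<times> real" where
  "near_identity_step \<epsilon> A B C D k u v
    = (u + \<epsilon> k * (A k * u + B k * v), v + \<epsilon> k * (C k * u + D k * v))"

text \<open>Taken with the left eigenvectors at \<open>k\<close>, the new coordinates are exactly multiplied by the eigenvalues.
The only error comes from passing to the eigenvectors at \<open>Suc k\<close>, and it is summable because these
have bounded variation. A non-zero determinant in the limit makes the change of coordinates uniformly
invertible.\<close>

lemma left_eigenvector_coordinates:
  fixes A B C D \<epsilon> \<mu> \<nu> l1 l2 m1 m2 :: "nat \<Rightarrow> real"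
  assumes bv: "bv l1" "bv l2" "bv m1" "bv m2"
    and lim: "l1 \<longlonglongrightarrow> a1" "l2 \<longlonglongrightarrow> a2" "m1 \<longlonglongrightarrow> b1" "m2 \<longlonglongrightarrow> b2"
    and det: "a1 * b2 - a2 * b1 \<noteq> 0"
    and pq: "\<And>k. k \<ge> K0 \<Longrightarrow> 0 < 1 + \<epsilon> k * \<nu> k" "\<And>k. k \<ge> K0 \<Longrightarrow> \<epsilon> k * \<nu> k \<le> \<epsilon> k * \<mu> k"
    and l: "\<And>k. k \<ge> K0 \<Longrightarrow> l1 k * A k + l2 k * C k = \<mu> k * l1 k"
      "\<And>k. k \<ge> K0 \<Longrightarrow> l1 k * B k + l2 k * D k = \<mu> k * l2 k"
    and m: "\<And>k. k \<ge> K0 \<Longrightarrow> m1 k * A k + m2 k * C k = \<nu> k * m1 k"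
      "\<And>k. k \<ge> K0 \<Longrightarrow> m1 k * B k + m2 k * D k = \<nu> k * m2 k"
  obtains K e c where "K \<ge> K0"
    "asymptotically_diagonal K (near_identity_step \<epsilon> A B C D)
      (\<lambda>k. 1 + \<epsilon> k * \<mu> k) (\<lambda>k. 1 + \<epsilon> k * \<nu> k)
      (\<lambda>k u v. l1 k * u + l2 k * v) (\<lambda>k u v. m1 k * u + m2 k * v) e c"
    "\<And>k. k \<ge> K \<Longrightarrow> l1 k * m2 k - l2 k * m1 k \<noteq> 0"
proof -
  have bounded: "\<exists>F. \<forall>n. \<bar>f n\<bar> \<le> F" if "f \<longlonglongrightarrow> f0" for f :: "nat \<Rightarrow> real" and f0
    using convergent_imp_Bseq [OF convergentI [OF that]] unfolding Bseq_def real_norm_def by blast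
  obtain F1 F2 F3 F4 where F: "\<And>n. \<bar>l1 n\<bar> \<le> F1" "\<And>n. \<bar>l2 n\<bar> \<le> F2" "\<And>n. \<bar>m1 n\<bar> \<le> F3" "\<And>n. \<bar>m2 n\<bar> \<le> F4"
    using bounded [OF lim(1)] bounded [OF lim(2)] bounded [OF lim(3)] bounded [OF lim(4)] by blast
  define M where "M = F1 + F2 + F3 + F4"
  have F0: "0 \<le> F1" "0 \<le> F2" "0 \<le> F3" "0 \<le> F4" using F [of 0] by linarith+
  have M_bound: "F1 * s + F2 * t + (F3 * s + F4 * t) \<le> M * (s + t)"
    "F4 * s + F2 * t + (F1 * t + F3 * s) \<le> M * (s + t)" if "0 \<le> s" "0 \<le> t" for s t
    using that F0 by (simp_all add: M_def algebra_simps)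
  define \<Delta> where "\<Delta> n = l1 n * m2 n - l2 n * m1 n" for n
  define \<delta> where "\<delta> = \<bar>a1 * b2 - a2 * b1\<bar> / 2"
  have \<delta>: "\<delta> > 0" unfolding \<delta>_def using det by simp
  have "(\<lambda>n. \<bar>\<Delta> n\<bar>) \<longlonglongrightarrow> \<bar>a1 * b2 - a2 * b1\<bar>" unfolding \<Delta>_def by (intro tendsto_intros lim)
  moreover have "\<delta> < \<bar>a1 * b2 - a2 * b1\<bar>" using \<delta> unfolding \<delta>_def by simp
  ultimately have "eventually (\<lambda>n. \<bar>\<Delta> n\<bar> > \<delta>) sequentially" by (rule order_tendstoD(1))
  then obtain K1 where K1: "\<And>n. n \<ge> K1 \<Longrightarrow> \<bar>\<Delta> n\<bar> > \<delta>" unfolding eventually_sequentially by blast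
  \<comment> \<open>\<open>M\<close> bounds the change of coordinates and \<open>M / \<delta>\<close> its inverse, by Cramer's rule.\<close>
  define c where "c = M + 1 + M / \<delta>"
  have M0: "M \<ge> 0" unfolding M_def using F0 by simp
  have c: "c > 0" "M \<le> c" "M / \<delta> \<le> c" unfolding c_def using M0 \<delta> by (auto intro: add_pos_nonneg)
  define g where "g k = \<bar>l1 (Suc k) - l1 k\<bar> + \<bar>l2 (Suc k) - l2 k\<bar> + \<bar>m1 (Suc k) - m1 k\<bar> + \<bar>m2 (Suc k) - m2 k\<bar>" for k
  have "summable g" unfolding g_def using bv unfolding bv_def by (intro summable_add)
  then have se: "summable (\<lambda>k. c * g k)" by (rule summable_mult)
  have g0: "0 \<le> g k" for k unfolding g_def by simp
  have upper: "\<bar>l1 k * u + l2 k * v\<bar> + \<bar>m1 k * u + m2 k * v\<bar> \<le> c * (\<bar>u\<bar> + \<bar>v\<bar>)" for k u v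
  proof -
    have "\<bar>l1 k * u + l2 k * v\<bar> \<le> F1 * \<bar>u\<bar> + F2 * \<bar>v\<bar>" "\<bar>m1 k * u + m2 k * v\<bar> \<le> F3 * \<bar>u\<bar> + F4 * \<bar>v\<bar>"
      by (rule order_trans [OF abs_triangle_ineq], unfold abs_mult, intro add_mono mult_right_mono F abs_ge_zero)+
    moreover have "F1 * \<bar>u\<bar> + F2 * \<bar>v\<bar> + (F3 * \<bar>u\<bar> + F4 * \<bar>v\<bar>) \<le> M * (\<bar>u\<bar> + \<bar>v\<bar>)"
      by (rule M_bound(1)) auto
    moreover have "M * (\<bar>u\<bar> + \<bar>v\<bar>) \<le> c * (\<bar>u\<bar> + \<bar>v\<bar>)" using c by (intro mult_right_mono) auto
    ultimately show ?thesis by linarith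
  qed
  have lower: "\<bar>u\<bar> + \<bar>v\<bar> \<le> c * (\<bar>l1 k * u + l2 k * v\<bar> + \<bar>m1 k * u + m2 k * v\<bar>)" if "k \<ge> K1" for k u v
  proof -
    define x y where "x = l1 k * u + l2 k * v" and "y = m1 k * u + m2 k * v"
    have "\<Delta> k * u = m2 k * x - l2 k * y" "\<Delta> k * v = l1 k * y - m1 k * x"
      unfolding \<Delta>_def x_def y_def by (simp_all add: algebra_simps)
    then have "\<bar>\<Delta> k\<bar> * \<bar>u\<bar> \<le> \<bar>m2 k\<bar> * \<bar>x\<bar> + \<bar>l2 k\<bar> * \<bar>y\<bar>" "\<bar>\<Delta> k\<bar> * \<bar>v\<bar> \<le> \<bar>l1 k\<bar> * \<bar>y\<bar> + \<bar>m1 k\<bar> * \<bar>x\<bar>"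
      by (metis abs_triangle_ineq4 abs_mult)+
    moreover have "\<bar>m2 k\<bar> * \<bar>x\<bar> + \<bar>l2 k\<bar> * \<bar>y\<bar> \<le> F4 * \<bar>x\<bar> + F2 * \<bar>y\<bar>"
      "\<bar>l1 k\<bar> * \<bar>y\<bar> + \<bar>m1 k\<bar> * \<bar>x\<bar> \<le> F1 * \<bar>y\<bar> + F3 * \<bar>x\<bar>"
      by (intro add_mono mult_right_mono F abs_ge_zero)+
    moreover have "F4 * \<bar>x\<bar> + F2 * \<bar>y\<bar> + (F1 * \<bar>y\<bar> + F3 * \<bar>x\<bar>) \<le> M * (\<bar>x\<bar> + \<bar>y\<bar>)"
      by (rule M_bound(2)) auto
    ultimately have "\<bar>\<Delta> k\<bar> * (\<bar>u\<bar> + \<bar>v\<bar>) \<le> M * (\<bar>x\<bar> + \<bar>y\<bar>)" by (simp add: distrib_left)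
    moreover have "\<delta> * (\<bar>u\<bar> + \<bar>v\<bar>) \<le> \<bar>\<Delta> k\<bar> * (\<bar>u\<bar> + \<bar>v\<bar>)" using K1 [OF that] by (intro mult_right_mono) auto
    ultimately have "\<delta> * (\<bar>u\<bar> + \<bar>v\<bar>) \<le> M * (\<bar>x\<bar> + \<bar>y\<bar>)" by linarith
    then have "\<bar>u\<bar> + \<bar>v\<bar> \<le> M / \<delta> * (\<bar>x\<bar> + \<bar>y\<bar>)"
      using \<delta> by (simp only: pos_le_divide_eq times_divide_eq_left mult.commute [of \<delta>])
    also have "\<dots> \<le> c * (\<bar>x\<bar> + \<bar>y\<bar>)" using c by (intro mult_right_mono) auto
    finally show ?thesis unfolding x_def y_def .
  qed
  have step: "\<bar>(d1 * u' + d2 * v')\<bar> \<le> c * g k * (\<bar>l1 (Suc k) * u' + l2 (Suc k) * v'\<bar> + \<bar>m1 (Suc k) * u' + m2 (Suc k) * v'\<bar>)"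
    if k: "k \<ge> K1" and d: "\<bar>d1\<bar> \<le> g k" "\<bar>d2\<bar> \<le> g k" for k u' v' d1 d2
  proof -
    have "\<bar>d1 * u' + d2 * v'\<bar> \<le> \<bar>d1\<bar> * \<bar>u'\<bar> + \<bar>d2\<bar> * \<bar>v'\<bar>" by (metis abs_triangle_ineq abs_mult)
    also have "\<dots> \<le> g k * \<bar>u'\<bar> + g k * \<bar>v'\<bar>" by (intro add_mono mult_right_mono d abs_ge_zero)
    also have "\<dots> = g k * (\<bar>u'\<bar> + \<bar>v'\<bar>)" by (simp add: distrib_left)
    also have "\<dots> \<le> g k * (c * (\<bar>l1 (Suc k) * u' + l2 (Suc k) * v'\<bar> + \<bar>m1 (Suc k) * u' + m2 (Suc k) * v'\<bar>))"
      using lower [of "Suc k" u' v'] k g0 by (intro mult_left_mono) auto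
    finally show ?thesis by (simp add: mult_ac)
  qed
  have eigen: "n1 * (u + \<epsilon> k * (A k * u + B k * v)) + n2 * (v + \<epsilon> k * (C k * u + D k * v))
      = (1 + \<epsilon> k * r) * (n1 * u + n2 * v)"
    if "n1 * A k + n2 * C k = r * n1" "n1 * B k + n2 * D k = r * n2" for n1 n2 r k u v
    using that by algebra
  define K where "K = max K0 K1"
  have "asymptotically_diagonal K
    (near_identity_step \<epsilon> A B C D)
    (\<lambda>k. 1 + \<epsilon> k * \<mu> k) (\<lambda>k. 1 + \<epsilon> k * \<nu> k)
    (\<lambda>k u v. l1 k * u + l2 k * v) (\<lambda>k u v. m1 k * u + m2 k * v) (\<lambda>k. c * g k) c"
    unfolding asymptotically_diagonal_def
  proof (intro conjI allI impI)
    fix k assume "K \<le> k"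
    then have k: "k \<ge> K0" "k \<ge> K1" unfolding K_def by auto
    show "0 < 1 + \<epsilon> k * \<nu> k" "1 + \<epsilon> k * \<nu> k \<le> 1 + \<epsilon> k * \<mu> k" using pq k by auto
    fix u v
    show "\<bar>l1 k * u + l2 k * v\<bar> + \<bar>m1 k * u + m2 k * v\<bar> \<le> c * (\<bar>u\<bar> + \<bar>v\<bar>)" by (rule upper)
    show "\<bar>u\<bar> + \<bar>v\<bar> \<le> c * (\<bar>l1 k * u + l2 k * v\<bar> + \<bar>m1 k * u + m2 k * v\<bar>)" by (rule lower [OF k(2)])
    fix u' v' assume "near_identity_step \<epsilon> A B C D k u v = (u', v')"
    then have u': "u + \<epsilon> k * (A k * u + B k * v) = u'" and v': "v + \<epsilon> k * (C k * u + D k * v) = v'"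
      by (auto simp: near_identity_step_def)
    have "l1 (Suc k) * u' + l2 (Suc k) * v' - (1 + \<epsilon> k * \<mu> k) * (l1 k * u + l2 k * v)
      = (l1 (Suc k) - l1 k) * u' + (l2 (Suc k) - l2 k) * v'"
      using eigen [OF l [OF k(1)], of u v] unfolding u' v' by (simp add: algebra_simps)
    then show "\<bar>l1 (Suc k) * u' + l2 (Suc k) * v' - (1 + \<epsilon> k * \<mu> k) * (l1 k * u + l2 k * v)\<bar>
      \<le> c * g k * (\<bar>l1 (Suc k) * u' + l2 (Suc k) * v'\<bar> + \<bar>m1 (Suc k) * u' + m2 (Suc k) * v'\<bar>)"
      using step [OF k(2), of "l1 (Suc k) - l1 k" "l2 (Suc k) - l2 k"] by (simp add: g_def)
    have "m1 (Suc k) * u' + m2 (Suc k) * v' - (1 + \<epsilon> k * \<nu> k) * (m1 k * u + m2 k * v)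
      = (m1 (Suc k) - m1 k) * u' + (m2 (Suc k) - m2 k) * v'"
      using eigen [OF m [OF k(1)], of u v] unfolding u' v' by (simp add: algebra_simps)
    then show "\<bar>m1 (Suc k) * u' + m2 (Suc k) * v' - (1 + \<epsilon> k * \<nu> k) * (m1 k * u + m2 k * v)\<bar>
      \<le> c * g k * (\<bar>l1 (Suc k) * u' + l2 (Suc k) * v'\<bar> + \<bar>m1 (Suc k) * u' + m2 (Suc k) * v'\<bar>)"
      using step [OF k(2), of "m1 (Suc k) - m1 k" "m2 (Suc k) - m2 k"] by (simp add: g_def)
  qed (use c se g0 in auto)
  moreover have "l1 k * m2 k - l2 k * m1 k \<noteq> 0" if "k \<ge> K" for k
    using K1 [of k] \<delta> that unfolding K_def \<Delta>_def by auto
  ultimately show thesis using that [of K] unfolding K_def by simp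
qed

text \<open>The left eigenvectors \<open>(l, B)\<close> and \<open>(C, - l)\<close> stay independent in the limit if \<open>l\<close> does not tend to
zero, which is guaranteed for \<open>A0 \<ge> D0\<close>. In the opposite case the two standard coordinates are
exchanged.\<close>

lemma asymptotic_diagonalisation:
  fixes A B C D \<epsilon> :: "nat \<Rightarrow> real"
  assumes bv: "bv A" "bv B" "bv C" "bv D"
    and lim: "A \<longlonglongrightarrow> A0" "B \<longlonglongrightarrow> B0" "C \<longlonglongrightarrow> C0" "D \<longlonglongrightarrow> D0"
    and disc: "disc2 A0 B0 C0 D0 > 0"
    and \<epsilon>: "\<epsilon> \<longlonglongrightarrow> 0" "\<And>k. \<epsilon> k > 0"
  obtains K l1 l2 m1 m2 e c where
    "\<And>k. k \<ge> K \<Longrightarrow> disc2 (A k) (B k) (C k) (D k) > 0"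
    "asymptotically_diagonal K
      (near_identity_step \<epsilon> A B C D)
      (\<lambda>k. 1 + \<epsilon> k * eig_plus (A k) (B k) (C k) (D k)) (\<lambda>k. 1 + \<epsilon> k * eig_minus (A k) (B k) (C k) (D k))
      (\<lambda>k u v. l1 k * u + l2 k * v) (\<lambda>k u v. m1 k * u + m2 k * v) e c"
    "\<And>k. k \<ge> K \<Longrightarrow> l1 k * m2 k - l2 k * m1 k \<noteq> (0::real)"
proof -
  define S where "S k = sqrt (disc2 (A k) (B k) (C k) (D k))" for k
  define S0 where "S0 = sqrt (disc2 A0 B0 C0 D0)"
  have S0: "S0 > 0" unfolding S0_def using disc by simp
  have cA: "convergent A" "convergent B" "convergent C" "convergent D"
    using lim by (auto simp: convergent_def)
  have dl: "(\<lambda>k. disc2 (A k) (B k) (C k) (D k)) \<longlonglongrightarrow> disc2 A0 B0 C0 D0"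
    unfolding disc2_def by (intro tendsto_intros lim)
  have cAD: "convergent (\<lambda>k. A k - D k)" using tendsto_diff [OF lim(1,4)] by (auto simp: convergent_def)
  have "bv (\<lambda>k. (A k - D k) * (A k - D k) + 4 * (B k * C k))"
    by (intro bv_add bv_mult bv_cmult bv_diff bv cA cAD)
  then have dbv: "bv (\<lambda>k. disc2 (A k) (B k) (C k) (D k))"
    unfolding disc2_def by (simp add: power2_eq_square mult.assoc)
  have Sl: "S \<longlonglongrightarrow> S0" unfolding S_def S0_def by (intro tendsto_real_sqrt dl)
  have Sbv: "bv S" unfolding S_def by (rule bv_sqrt [OF dbv dl disc])
  have "eventually (\<lambda>k. disc2 (A k) (B k) (C k) (D k) > 0) sequentially"
    using order_tendstoD(1) [OF dl disc] .
  moreover have "eventually (\<lambda>k. 1 + \<epsilon> k * eig_minus (A k) (B k) (C k) (D k) > 0) sequentially"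
  proof -
    have "(\<lambda>k. 1 + \<epsilon> k * ((A k + D k - S k) / 2)) \<longlonglongrightarrow> 1 + 0 * ((A0 + D0 - S0) / 2)"
      by (intro tendsto_intros \<epsilon> lim Sl) simp
    from order_tendstoD(1) [OF this, of 0] show ?thesis unfolding eig_minus_def S_def by simp
  qed
  ultimately have "eventually (\<lambda>k. disc2 (A k) (B k) (C k) (D k) > 0
      \<and> 1 + \<epsilon> k * eig_minus (A k) (B k) (C k) (D k) > 0) sequentially" by (rule eventually_conj)
  then obtain K0 where K0: "\<And>k. k \<ge> K0 \<Longrightarrow> disc2 (A k) (B k) (C k) (D k) > 0"
    "\<And>k. k \<ge> K0 \<Longrightarrow> 1 + \<epsilon> k * eig_minus (A k) (B k) (C k) (D k) > 0"
    unfolding eventually_sequentially by blast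
  have le: "\<epsilon> k * eig_minus (A k) (B k) (C k) (D k) \<le> \<epsilon> k * eig_plus (A k) (B k) (C k) (D k)" if "k \<ge> K0" for k
    using K0(1) [OF that] \<epsilon>(2)[of k] by (intro mult_left_mono) (auto simp: eig_minus_def eig_plus_def)
  show thesis
  proof (cases "A0 \<ge> D0")
    case True
    define l where "l k = (A k - D k + S k) / 2" for k
    have ll: "l \<longlonglongrightarrow> (A0 - D0 + S0) / 2" unfolding l_def by (intro tendsto_intros lim Sl) simp
    have lbv: "bv l" unfolding l_def using bv_cmult [OF bv_add [OF bv_diff [OF bv(1,4)] Sbv], of "1/2"] by simp
    have eqs: "l k * A k + B k * C k = eig_plus (A k) (B k) (C k) (D k) * l k"
      "l k * B k + B k * D k = eig_plus (A k) (B k) (C k) (D k) * B k"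
      "C k * A k - l k * C k = eig_minus (A k) (B k) (C k) (D k) * C k"
      "C k * B k - l k * D k = eig_minus (A k) (B k) (C k) (D k) * - l k" if "k \<ge> K0" for k
      using left_eigenvectors(1-4) [OF less_imp_le [OF K0(1) [OF that]]] unfolding l_def S_def by simp_all
    have "(A0 - D0 + S0) / 2 * (- ((A0 - D0 + S0) / 2)) - B0 * C0 = - (S0 * ((A0 - D0 + S0) / 2))"
      using left_eigenvectors(5) [OF less_imp_le [OF disc]] unfolding S0_def .
    then have det: "(A0 - D0 + S0) / 2 * (- ((A0 - D0 + S0) / 2)) - B0 * C0 \<noteq> 0"
      using S0 True by simp
    obtain K e c where K: "K \<ge> K0" and diag: "asymptotically_diagonal K (near_identity_step \<epsilon> A B C D)
      (\<lambda>k. 1 + \<epsilon> k * eig_plus (A k) (B k) (C k) (D k)) (\<lambda>k. 1 + \<epsilon> k * eig_minus (A k) (B k) (C k) (D k))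
      (\<lambda>k u v. l k * u + B k * v) (\<lambda>k u v. C k * u + - l k * v) e c"
      and nz: "\<And>k. k \<ge> K \<Longrightarrow> l k * - l k - B k * C k \<noteq> 0"
    proof (rule left_eigenvector_coordinates [OF lbv bv(2) bv(3) _ ll lim(2,3) _ det])
      show "bv (\<lambda>k. - l k)" using bv_cmult [OF lbv, of "-1"] by simp
      show "(\<lambda>k. - l k) \<longlonglongrightarrow> - ((A0 - D0 + S0) / 2)" by (intro tendsto_minus ll)
      fix k assume k: "k \<ge> K0"
      show "0 < 1 + \<epsilon> k * eig_minus (A k) (B k) (C k) (D k)" by (rule K0(2) [OF k])
      show "\<epsilon> k * eig_minus (A k) (B k) (C k) (D k) \<le> \<epsilon> k * eig_plus (A k) (B k) (C k) (D k)" by (rule le [OF k])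
      show "l k * A k + B k * C k = eig_plus (A k) (B k) (C k) (D k) * l k"
        "l k * B k + B k * D k = eig_plus (A k) (B k) (C k) (D k) * B k" by (rule eqs [OF k])+
      show "C k * A k + - l k * C k = eig_minus (A k) (B k) (C k) (D k) * C k"
        "C k * B k + - l k * D k = eig_minus (A k) (B k) (C k) (D k) * - l k"
        using eqs(3,4) [OF k] by linarith+
    qed (rule that, assumption+)
    show thesis by (rule that [OF _ diag]) (use K0(1) K nz in auto)
  next
    case False
    define l where "l k = (D k - A k + S k) / 2" for k
    have ll: "l \<longlonglongrightarrow> (D0 - A0 + S0) / 2" unfolding l_def by (intro tendsto_intros lim Sl) simp
    have lbv: "bv l" unfolding l_def using bv_cmult [OF bv_add [OF bv_diff [OF bv(4,1)] Sbv], of "1/2"] by simp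
    have K0': "0 \<le> disc2 (D k) (C k) (B k) (A k)" if "k \<ge> K0" for k
      using less_imp_le [OF K0(1) [OF that]] unfolding eig_swap [where A = "A k" and B = "B k" and C = "C k" and D = "D k"] .
    have eqs: "l k * D k + C k * B k = eig_plus (A k) (B k) (C k) (D k) * l k"
      "l k * C k + C k * A k = eig_plus (A k) (B k) (C k) (D k) * C k"
      "B k * D k - l k * B k = eig_minus (A k) (B k) (C k) (D k) * B k"
      "B k * C k - l k * A k = eig_minus (A k) (B k) (C k) (D k) * - l k" if "k \<ge> K0" for k
      using left_eigenvectors(1-4) [OF K0' [OF that]] unfolding eig_swap [where A = "A k" and B = "B k" and C = "C k" and D = "D k"] l_def S_def by simp_all
    have "(D0 - A0 + S0) / 2 * (- ((D0 - A0 + S0) / 2)) - C0 * B0 = - (S0 * ((D0 - A0 + S0) / 2))"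
      using left_eigenvectors(5) [of D0 C0 B0 A0] disc unfolding S0_def eig_swap [where A = A0 and B = B0 and C = C0 and D = D0] by simp
    moreover have "S0 * ((D0 - A0 + S0) / 2) > 0" using S0 False by simp
    ultimately have det: "C0 * B0 - (D0 - A0 + S0) / 2 * (- ((D0 - A0 + S0) / 2)) \<noteq> 0" by linarith
    obtain K e c where K: "K \<ge> K0" and diag: "asymptotically_diagonal K (near_identity_step \<epsilon> A B C D)
      (\<lambda>k. 1 + \<epsilon> k * eig_plus (A k) (B k) (C k) (D k)) (\<lambda>k. 1 + \<epsilon> k * eig_minus (A k) (B k) (C k) (D k))
      (\<lambda>k u v. C k * u + l k * v) (\<lambda>k u v. - l k * u + B k * v) e c"
      and nz: "\<And>k. k \<ge> K \<Longrightarrow> C k * B k - l k * - l k \<noteq> 0"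
    proof (rule left_eigenvector_coordinates [OF bv(3) lbv _ bv(2) lim(3) ll _ lim(2) det])
      show "bv (\<lambda>k. - l k)" using bv_cmult [OF lbv, of "-1"] by simp
      show "(\<lambda>k. - l k) \<longlonglongrightarrow> - ((D0 - A0 + S0) / 2)" by (intro tendsto_minus ll)
      fix k assume k: "k \<ge> K0"
      show "0 < 1 + \<epsilon> k * eig_minus (A k) (B k) (C k) (D k)" by (rule K0(2) [OF k])
      show "\<epsilon> k * eig_minus (A k) (B k) (C k) (D k) \<le> \<epsilon> k * eig_plus (A k) (B k) (C k) (D k)" by (rule le [OF k])
      show "C k * A k + l k * C k = eig_plus (A k) (B k) (C k) (D k) * C k"
        "C k * B k + l k * D k = eig_plus (A k) (B k) (C k) (D k) * l k"
        using eqs(1,2) [OF k] by linarith+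
      show "- l k * A k + B k * C k = eig_minus (A k) (B k) (C k) (D k) * - l k"
        "- l k * B k + B k * D k = eig_minus (A k) (B k) (C k) (D k) * B k"
        using eqs(3,4) [OF k] by linarith+
    qed (rule that, assumption+)
    show thesis by (rule that [OF _ diag]) (use K0(1) K nz in auto)
  qed
qed

section \<open>Dominant and recessive solutions\<close>

text \<open>The Levinson bounds are applied from an index \<open>K'\<close> on beyond which the total error is at most
\<open>1 / 8\<close>. The dominant solution starts there with coordinates \<open>(1, 0)\<close>; the recessive one has a
non-zero second coordinate, so the two are independent, and dividing \<open>\<phi>\<close> by their Wronskian \<open>W\<close>
normalises them.\<close>

lemma solution_dichotomy:
  fixes a b :: "nat \<Rightarrow> real" and \<tau> :: "nat \<Rightarrow> nat" and \<sigma> :: real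
  assumes a: "\<And>n. a n > 0" and \<sigma>: "\<bar>\<sigma>\<bar> = 1"
    and diag: "asymptotically_diagonal K T p q
      (\<lambda>k u v. l1 k * u + l2 k * v) (\<lambda>k u v. m1 k * u + m2 k * v) e c"
    and det: "\<And>k. k \<ge> K \<Longrightarrow> l1 k * m2 k - l2 k * m1 k \<noteq> 0"
    and step: "\<And>u k. sol a b u \<Longrightarrow> k \<ge> K \<Longrightarrow> T k (\<sigma> ^ k * u (\<tau> k)) (\<sigma> ^ k * u (Suc (\<tau> k)))
      = (\<sigma> ^ Suc k * u (\<tau> (Suc k)), \<sigma> ^ Suc k * u (Suc (\<tau> (Suc k))))"
  obtains K' \<phi> \<psi> C where "K' \<ge> K" "C > 0" "sol a b \<phi>" "sol a b \<psi>" "a 0 * (\<phi> 0 * \<psi> 1 - \<phi> 1 * \<psi> 0) = 1"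
    "\<And>k. k \<ge> K' \<Longrightarrow> (\<Prod>j\<in>{K'..<k}. p j) \<le> C * (\<bar>\<phi> (\<tau> k)\<bar> + \<bar>\<phi> (Suc (\<tau> k))\<bar>)"
    "\<And>k. k \<ge> K' \<Longrightarrow> \<bar>\<phi> (\<tau> k)\<bar> + \<bar>\<phi> (Suc (\<tau> k))\<bar> \<le> C * (\<Prod>j\<in>{K'..<k}. p j)"
    "\<And>k. k \<ge> K' \<Longrightarrow> \<bar>\<psi> (\<tau> k)\<bar> + \<bar>\<psi> (Suc (\<tau> k))\<bar> \<le> C * (\<Prod>j\<in>{K'..<k}. q j)"
proof -
  have c: "c > 0" and se: "summable e" and e0: "\<And>k. 0 \<le> e k"
    and q0: "\<And>k. k \<ge> K \<Longrightarrow> 0 < q k" and qp: "\<And>k. k \<ge> K \<Longrightarrow> q k \<le> p k"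
    and up: "\<And>k u v. k \<ge> K \<Longrightarrow> \<bar>l1 k * u + l2 k * v\<bar> + \<bar>m1 k * u + m2 k * v\<bar> \<le> c * (\<bar>u\<bar> + \<bar>v\<bar>)"
    and low: "\<And>k u v. k \<ge> K \<Longrightarrow> \<bar>u\<bar> + \<bar>v\<bar> \<le> c * (\<bar>l1 k * u + l2 k * v\<bar> + \<bar>m1 k * u + m2 k * v\<bar>)"
    and dyn: "\<And>k u v u' v'. k \<ge> K \<Longrightarrow> T k u v = (u', v') \<Longrightarrow>
          \<bar>(l1 (Suc k) * u' + l2 (Suc k) * v') - p k * (l1 k * u + l2 k * v)\<bar>
            \<le> e k * (\<bar>l1 (Suc k) * u' + l2 (Suc k) * v'\<bar> + \<bar>m1 (Suc k) * u' + m2 (Suc k) * v'\<bar>) \<and>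
          \<bar>(m1 (Suc k) * u' + m2 (Suc k) * v') - q k * (m1 k * u + m2 k * v)\<bar>
            \<le> e k * (\<bar>l1 (Suc k) * u' + l2 (Suc k) * v'\<bar> + \<bar>m1 (Suc k) * u' + m2 (Suc k) * v'\<bar>)"
    using diag unfolding asymptotically_diagonal_def by auto
  have "(\<lambda>M. \<Sum>j. e (j + M)) \<longlonglongrightarrow> 0" by (rule suminf_exist_split2 [OF se])
  then have "eventually (\<lambda>M. (\<Sum>j. e (j + M)) < 1 / 8) sequentially" by (rule order_tendstoD) simp
  then obtain M where M: "\<And>n. n \<ge> M \<Longrightarrow> (\<Sum>j. e (j + n)) < 1 / 8" unfolding eventually_sequentially by blast
  define K' where "K' = max K M"
  have K'K: "K' \<ge> K" unfolding K'_def by simp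
  have sge: "K' + k \<ge> K" for k using K'K by simp
  have E: "(\<Sum>j<k. e (K' + j)) \<le> 1 / 8" for k
  proof -
    have "(\<Sum>j<k. e (j + K')) \<le> (\<Sum>j. e (j + K'))"
      by (intro sum_le_suminf summable_ignore_initial_segment se) (auto simp: e0)
    also have "\<dots> \<le> 1 / 8" using M [of K'] unfolding K'_def by simp
    finally show ?thesis by (simp add: add.commute)
  qed
  \<comment> \<open>The factor \<open>\<sigma> ^ k\<close> removes the sign that a step of the recurrence carries.\<close>
  define x where "x u k = \<sigma> ^ k * (l1 k * u (\<tau> k) + l2 k * u (Suc (\<tau> k)))" for u k
  define y where "y u k = \<sigma> ^ k * (m1 k * u (\<tau> k) + m2 k * u (Suc (\<tau> k)))" for u k
  have abs_\<sigma>: "\<bar>\<sigma> ^ k\<bar> = 1" for k by (simp add: power_abs \<sigma>)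
  have \<sigma>2: "\<sigma> ^ k * \<sigma> ^ k = 1" for k using abs_\<sigma> [of k] by (metis abs_mult_self_eq mult_1)
  have xe: "x u k = l1 k * (\<sigma> ^ k * u (\<tau> k)) + l2 k * (\<sigma> ^ k * u (Suc (\<tau> k)))"
    and ye: "y u k = m1 k * (\<sigma> ^ k * u (\<tau> k)) + m2 k * (\<sigma> ^ k * u (Suc (\<tau> k)))" for u k
    unfolding x_def y_def by (simp_all add: algebra_simps)
  have xlin: "x (\<lambda>n. s * u n + t * v n) k = s * x u k + t * x v k"
    and ylin: "y (\<lambda>n. s * u n + t * v n) k = s * y u k + t * y v k" for s t u v k
    unfolding x_def y_def by (simp_all add: algebra_simps)
  have xy_up: "\<bar>x u k\<bar> + \<bar>y u k\<bar> \<le> c * (\<bar>u (\<tau> k)\<bar> + \<bar>u (Suc (\<tau> k))\<bar>)" if "k \<ge> K" for u k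
    using up [OF that] unfolding x_def y_def abs_mult abs_\<sigma> by simp
  have xy_low: "\<bar>u (\<tau> k)\<bar> + \<bar>u (Suc (\<tau> k))\<bar> \<le> c * (\<bar>x u k\<bar> + \<bar>y u k\<bar>)" if "k \<ge> K" for u k
    using low [OF that] unfolding x_def y_def abs_mult abs_\<sigma> by simp
  have xstep: "\<bar>x u (Suc k) - p k * x u k\<bar> \<le> e k * (\<bar>x u (Suc k)\<bar> + \<bar>y u (Suc k)\<bar>)"
    and ystep: "\<bar>y u (Suc k) - q k * y u k\<bar> \<le> e k * (\<bar>x u (Suc k)\<bar> + \<bar>y u (Suc k)\<bar>)"
    if "sol a b u" "k \<ge> K" for u k
    using dyn [OF that(2) step [OF that]] unfolding xe ye by blast+
  have attain: "\<exists>u. sol a b u \<and> x u k = \<xi> \<and> y u k = \<eta>" if "k \<ge> K" for k \<xi> \<eta>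
  proof -
    define \<Delta> where "\<Delta> = l1 k * m2 k - l2 k * m1 k"
    have \<Delta>: "\<Delta> \<noteq> 0" unfolding \<Delta>_def by (rule det [OF that])
    obtain u where u: "sol a b u" "u (\<tau> k) = \<sigma> ^ k * (m2 k * \<xi> - l2 k * \<eta>) / \<Delta>"
      "u (Suc (\<tau> k)) = \<sigma> ^ k * (l1 k * \<eta> - m1 k * \<xi>) / \<Delta>"
      using sol_exists [where a = a and b = b and n = "\<tau> k", OF a] by blast
    have "\<sigma> ^ k * u (\<tau> k) = (\<sigma> ^ k * \<sigma> ^ k) * (m2 k * \<xi> - l2 k * \<eta>) / \<Delta>"
      "\<sigma> ^ k * u (Suc (\<tau> k)) = (\<sigma> ^ k * \<sigma> ^ k) * (l1 k * \<eta> - m1 k * \<xi>) / \<Delta>" unfolding u by simp_all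
    then have uu: "\<sigma> ^ k * u (\<tau> k) = (m2 k * \<xi> - l2 k * \<eta>) / \<Delta>"
      "\<sigma> ^ k * u (Suc (\<tau> k)) = (l1 k * \<eta> - m1 k * \<xi>) / \<Delta>" unfolding \<sigma>2 by simp_all
    have "x u k = \<Delta> * \<xi> / \<Delta>" "y u k = \<Delta> * \<eta> / \<Delta>"
      unfolding xe ye uu \<Delta>_def by (simp_all add: algebra_simps flip: add_divide_distrib diff_divide_distrib)
    then show ?thesis using u(1) \<Delta> by auto
  qed
  obtain u1 where u1: "sol a b u1" "x u1 K' = 1" "y u1 K' = 0" using attain [OF K'K] by blast
  obtain u2 where u2: "sol a b u2" "x u2 K' = 0" "y u2 K' = 1" using attain [OF K'K] by blast
  define w where "w s t n = s * u1 n + t * u2 n" for s t n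
  have w: "sol a b (w s t)" for s t unfolding w_def by (rule sol_combination [OF u1(1) u2(1)])
  have xw: "x (w s t) k = s * x u1 k + t * x u2 k" and yw: "y (w s t) k = s * y u1 k + t * y u2 k" for s t k
    unfolding w_def by (rule xlin, rule ylin)
  have spans: "u = w (x u K') (y u K')" if u: "sol a b u" for u
  proof -
    define v where "v n = 1 * u n + (-1) * w (x u K') (y u K') n" for n
    have "x v K' = 0" "y v K' = 0"
      unfolding v_def by (simp_all only: xlin ylin) (simp_all add: xw yw u1 u2)
    then have z: "v (\<tau> K') = 0" "v (Suc (\<tau> K')) = 0" using xy_low [OF K'K, of v] by auto
    show ?thesis
      by (rule sol_unique [OF a u w]) (use z in \<open>auto simp: v_def\<close>)
  qed
  obtain d where d: "snd d \<ge> 1 / 2"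
    "\<And>k. \<bar>x (w (fst d) (snd d)) (K' + k)\<bar> + \<bar>y (w (fst d) (snd d)) (K' + k)\<bar> \<le> 2 * (\<Prod>j<k. q (K' + j))"
  proof (rule recessive_solution_exists [of "\<lambda>k. q (K' + k)" "\<lambda>k. p (K' + k)" "\<lambda>k. e (K' + k)"
        "\<lambda>k d. x (w (fst d) (snd d)) (K' + k)" "\<lambda>k d. y (w (fst d) (snd d)) (K' + k)"])
    show "\<exists>d. x (w (fst d) (snd d)) (K' + k) = \<xi> \<and> y (w (fst d) (snd d)) (K' + k) = \<eta>" for k \<xi> \<eta>
    proof -
      obtain u where u: "sol a b u" "x u (K' + k) = \<xi>" "y u (K' + k) = \<eta>" using attain [OF sge] by blast
      show ?thesis using u(2,3) spans [OF u(1)] by (intro exI [of _ "(x u K', y u K')"]) auto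
    qed
    show "continuous_on UNIV (\<lambda>d. x (w (fst d) (snd d)) (K' + k))"
      "continuous_on UNIV (\<lambda>d. y (w (fst d) (snd d)) (K' + k))" for k
      unfolding xw yw by (intro continuous_intros)+
    show "0 < q (K' + k)" "q (K' + k) \<le> p (K' + k)" "0 \<le> e (K' + k)" for k
      by (rule q0 [OF sge], rule qp [OF sge], rule e0)
    show "(\<Sum>j<k. e (K' + j)) \<le> 1 / 8" for k by (rule E)
    show "x (w (fst d) (snd d)) (K' + 0) = fst d" "y (w (fst d) (snd d)) (K' + 0) = snd d" for d
      by (simp_all add: xw yw u1 u2)
    show "\<bar>x (w (fst d) (snd d)) (K' + Suc k) - p (K' + k) * x (w (fst d) (snd d)) (K' + k)\<bar>
        \<le> e (K' + k) * (\<bar>x (w (fst d) (snd d)) (K' + Suc k)\<bar> + \<bar>y (w (fst d) (snd d)) (K' + Suc k)\<bar>)"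
      "\<bar>y (w (fst d) (snd d)) (K' + Suc k) - q (K' + k) * y (w (fst d) (snd d)) (K' + k)\<bar>
        \<le> e (K' + k) * (\<bar>x (w (fst d) (snd d)) (K' + Suc k)\<bar> + \<bar>y (w (fst d) (snd d)) (K' + Suc k)\<bar>)" for k d
      unfolding add_Suc_right by (rule xstep [OF w sge], rule ystep [OF w sge])
  qed (rule that, assumption+)
  define \<psi> where "\<psi> = w (fst d) (snd d)"
  define W where "W = a 0 * (u1 0 * \<psi> 1 - u1 1 * \<psi> 0)"
  have \<psi>: "sol a b \<psi>" unfolding \<psi>_def by (rule w)
  have "W \<noteq> 0"
  proof
    assume "W = 0"
    then have "a (\<tau> K') * (u1 (\<tau> K') * \<psi> (Suc (\<tau> K')) - u1 (Suc (\<tau> K')) * \<psi> (\<tau> K')) = 0"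
      using sol_wronskian [OF u1(1) \<psi>, of "\<tau> K'"] unfolding W_def by simp
    then have 0: "u1 (\<tau> K') * \<psi> (Suc (\<tau> K')) - u1 (Suc (\<tau> K')) * \<psi> (\<tau> K') = 0" using a[of "\<tau> K'"] by simp
    have "x u1 K' * y \<psi> K' - x \<psi> K' * y u1 K' = (\<sigma> ^ K' * \<sigma> ^ K') * (l1 K' * m2 K' - l2 K' * m1 K')
        * (u1 (\<tau> K') * \<psi> (Suc (\<tau> K')) - u1 (Suc (\<tau> K')) * \<psi> (\<tau> K'))"
      unfolding x_def y_def by (simp add: algebra_simps)
    also have "\<dots> = 0" unfolding 0 by simp
    finally have "y \<psi> K' = 0" using u1 by simp
    then show False using d(1) unfolding \<psi>_def yw by (simp add: u1 u2)
  qed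
  define \<phi> where "\<phi> n = (1 / W) * u1 n + 0 * u1 n" for n
  have \<phi>: "sol a b \<phi>" unfolding \<phi>_def by (rule sol_combination [OF u1(1) u1(1)])
  have \<phi>abs: "\<bar>\<phi> (\<tau> k)\<bar> + \<bar>\<phi> (Suc (\<tau> k))\<bar> = (\<bar>u1 (\<tau> k)\<bar> + \<bar>u1 (Suc (\<tau> k))\<bar>) / \<bar>W\<bar>" for k
    unfolding \<phi>_def by (simp add: add_divide_distrib)
  have prod_shift: "(\<Prod>j<k. g (K' + j)) = (\<Prod>j\<in>{K'..<K' + k}. g j)" for g :: "nat \<Rightarrow> real" and k
    by (induction k) auto
  have P: "(\<Prod>j\<in>{K'..<k}. p j) > 0" and Q: "(\<Prod>j\<in>{K'..<k}. q j) > 0" for k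
  proof -
    have "0 < q j \<and> 0 < p j" if "j \<in> {K'..<k}" for j
      using that K'K q0 [of j] qp [of j] by simp
    then show "(\<Prod>j\<in>{K'..<k}. p j) > 0" "(\<Prod>j\<in>{K'..<k}. q j) > 0" by (auto intro: prod_pos)
  qed
  have u1b: "\<bar>x u1 k\<bar> + \<bar>y u1 k\<bar> \<le> 2 * (\<Prod>j\<in>{K'..<k}. p j)"
    "\<bar>x u1 k - (\<Prod>j\<in>{K'..<k}. p j)\<bar> \<le> (\<Prod>j\<in>{K'..<k}. p j) / 4" if kK: "k \<ge> K'" for k
  proof -
    obtain i where i: "k = K' + i" using le_Suc_ex [OF kK] by blast
    note fw = perturbed_diagonal_forward [of "\<lambda>k. q (K' + k)" "\<lambda>k. p (K' + k)" "\<lambda>k. e (K' + k)"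
        "\<lambda>k. x u1 (K' + k)" "\<lambda>k. y u1 (K' + k)", OF q0 [OF sge] qp [OF sge] e0 E]
    show "\<bar>x u1 k\<bar> + \<bar>y u1 k\<bar> \<le> 2 * (\<Prod>j\<in>{K'..<k}. p j)"
      using fw(1) [of i] xstep [OF u1(1) sge] ystep [OF u1(1) sge] unfolding i prod_shift by (simp add: u1)
    show "\<bar>x u1 k - (\<Prod>j\<in>{K'..<k}. p j)\<bar> \<le> (\<Prod>j\<in>{K'..<k}. p j) / 4"
      using fw(2) [of i] xstep [OF u1(1) sge] ystep [OF u1(1) sge] unfolding i prod_shift by (simp add: u1)
  qed
  define C where "C = 2 * c / \<bar>W\<bar> + 2 * c * \<bar>W\<bar> + 2 * c"
  have C: "C \<ge> 2 * c / \<bar>W\<bar>" "C \<ge> 2 * c * \<bar>W\<bar>" "C \<ge> 2 * c" "C > 0"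
    unfolding C_def using c \<open>W \<noteq> 0\<close> by (auto intro!: add_pos_pos)
  show thesis
  proof (rule that [OF K'K C(4) \<phi> \<psi>])
    show "a 0 * (\<phi> 0 * \<psi> 1 - \<phi> 1 * \<psi> 0) = 1"
      using \<open>W \<noteq> 0\<close> unfolding \<phi>_def by (simp add: W_def flip: diff_divide_distrib)
    fix k assume k: "k \<ge> K'"
    then have kK: "k \<ge> K" using K'K by simp
    let ?P = "\<Prod>j\<in>{K'..<k}. p j" and ?Q = "\<Prod>j\<in>{K'..<k}. q j"
    have "3 / 4 * ?P \<le> \<bar>x u1 k\<bar> + \<bar>y u1 k\<bar>" using u1b(2) [OF k] by linarith
    also have "\<dots> \<le> c * (\<bar>u1 (\<tau> k)\<bar> + \<bar>u1 (Suc (\<tau> k))\<bar>)" by (rule xy_up [OF kK])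
    finally have "?P \<le> 2 * c * (\<bar>u1 (\<tau> k)\<bar> + \<bar>u1 (Suc (\<tau> k))\<bar>)" using P [of k] by linarith
    also have "\<dots> = 2 * c * \<bar>W\<bar> * (\<bar>\<phi> (\<tau> k)\<bar> + \<bar>\<phi> (Suc (\<tau> k))\<bar>)"
      unfolding \<phi>abs using \<open>W \<noteq> 0\<close> by simp
    also have "\<dots> \<le> C * (\<bar>\<phi> (\<tau> k)\<bar> + \<bar>\<phi> (Suc (\<tau> k))\<bar>)" by (intro mult_right_mono C) auto
    finally show "?P \<le> C * (\<bar>\<phi> (\<tau> k)\<bar> + \<bar>\<phi> (Suc (\<tau> k))\<bar>)" .
    have "\<bar>\<phi> (\<tau> k)\<bar> + \<bar>\<phi> (Suc (\<tau> k))\<bar> \<le> c * (2 * ?P) / \<bar>W\<bar>"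
      unfolding \<phi>abs using xy_low [OF kK, of u1] u1b(1) [OF k] c
      by (intro divide_right_mono order_trans [OF xy_low [OF kK, of u1]] mult_left_mono) auto
    also have "\<dots> = 2 * c / \<bar>W\<bar> * ?P" by simp
    also have "\<dots> \<le> C * ?P" using P [of k] by (intro mult_right_mono C) auto
    finally show "\<bar>\<phi> (\<tau> k)\<bar> + \<bar>\<phi> (Suc (\<tau> k))\<bar> \<le> C * ?P" .
    obtain i where i: "k = K' + i" using le_Suc_ex [OF k] by blast
    have "\<bar>\<psi> (\<tau> k)\<bar> + \<bar>\<psi> (Suc (\<tau> k))\<bar> \<le> c * (\<bar>x \<psi> k\<bar> + \<bar>y \<psi> k\<bar>)" by (rule xy_low [OF kK])
    also have "\<dots> \<le> c * (2 * ?Q)"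
      using d(2) [of i] c unfolding prod_shift \<psi>_def i by (intro mult_left_mono) auto
    also have "\<dots> = 2 * c * ?Q" by simp
    also have "\<dots> \<le> C * ?Q" using Q [of k] by (intro mult_right_mono C) auto
    finally show "\<bar>\<psi> (\<tau> k)\<bar> + \<bar>\<psi> (Suc (\<tau> k))\<bar> \<le> C * ?Q" .
  qed
qed

section \<open>Transfer matrices\<close>

lemma mat2_vec:
  fixes M :: "real^2^2"
  shows "(M *v v) $ 1 = M $ 1 $ 1 * v $ 1 + M $ 1 $ 2 * v $ 2"
    "(M *v v) $ 2 = M $ 2 $ 1 * v $ 1 + M $ 2 $ 2 * v $ 2"
  by (simp_all add: matrix_vector_mult_def sum_2)

lemma transfer_matrix_step:
  assumes a: "\<And>n. a n > 0" and u: "sol a b u"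
  shows "transfer_matrix a b (Suc n) 0 *v vector [u n, u (Suc n)] = vector [u (Suc n), u (Suc (Suc n))]"
proof -
  have "a n * u n + b (Suc n) * u (Suc n) + a (Suc n) * u (Suc (Suc n)) = 0" using u unfolding sol_def by blast
  then have "u (Suc (Suc n)) = - (a n / a (Suc n)) * u n + (0 - b (Suc n)) / a (Suc n) * u (Suc n)"
    using a[of "Suc n"] by (simp add: field_simps)
  then show ?thesis
    by (simp add: vec_eq_iff forall_2 mat2_vec transfer_matrix_def vector_2)
qed

lemma left_prod_transfer_step:
  assumes a: "\<And>n. a n > 0" and u: "sol a b u"
  shows "left_prod (\<lambda>k. transfer_matrix a b (Suc n + k) 0) m *v vector [u n, u (Suc n)]
    = vector [u (n + m), u (Suc (n + m))]"
proof (induction m)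
  case (Suc m)
  then show ?case using transfer_matrix_step [OF a u, of "n + m"]
    by (simp add: matrix_vector_mul_assoc [symmetric])
qed simp

lemma det_transfer_matrix: "det (transfer_matrix a b (Suc n) x) = a n / a (Suc n)"
  by (simp add: det_2 transfer_matrix_def vector_2)

text \<open>The factors \<open>a (j - 1) / a j\<close> telescope.\<close>

lemma det_left_prod_transfer:
  assumes a: "\<And>n. a n > 0"
  shows "det (left_prod (\<lambda>k. transfer_matrix a b (Suc n + k) x) m) = a n / a (n + m)"
proof (induction m)
  case 0 show ?case using a[of n] by simp
next
  case (Suc m)
  then show ?case using a[of "n + m"] by (simp add: det_mul det_transfer_matrix)
qed

lemma left_prod_add: "left_prod M (m + n) = left_prod (\<lambda>k. M (m + k)) n ** left_prod M m"
  by (induction n) (simp_all add: matrix_mul_assoc)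

lemma tendsto_matrix_mult:
  fixes A B :: "nat \<Rightarrow> real^2^2"
  assumes "A \<longlonglongrightarrow> A0" "B \<longlonglongrightarrow> B0" shows "(\<lambda>n. A n ** B n) \<longlonglongrightarrow> A0 ** B0"
  unfolding matrix_matrix_mult_def
  by (intro vec_tendstoI) (auto intro!: tendsto_intros assms)

lemma tendsto_left_prod:
  assumes "\<And>k. (\<lambda>n. M n k) \<longlonglongrightarrow> L k"
  shows "(\<lambda>n. left_prod (M n) m) \<longlonglongrightarrow> left_prod L m"
  by (induction m) (auto intro: tendsto_matrix_mult assms)

lemma periodic_multiple:
  fixes f :: "int \<Rightarrow> 'a"
  assumes "\<And>j. f (j + int N) = f j" shows "f (j + int (n * N)) = f j"
proof (induction n)
  case (Suc n)
  have "f (j + int (Suc n * N)) = f ((j + int (n * N)) + int N)" by (simp add: algebra_simps)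
  then show ?case using assms Suc by simp
qed simp

lemma periodic_bounded:
  fixes f :: "int \<Rightarrow> real"
  assumes N: "N > 0" and f: "\<And>j. f (j + int N) = f j"
  obtains F where "\<And>n. \<bar>f (int n)\<bar> \<le> F"
proof -
  have "\<bar>f (int n)\<bar> \<le> (\<Sum>r<N. \<bar>f (int r)\<bar>)" for n
  proof -
    have "int n = int (n mod N) + int (n div N * N)" by (metis of_nat_add mod_div_mult_eq)
    then have "f (int n) = f (int (n mod N))" using periodic_multiple [of f N, OF f] by metis
    moreover have "\<bar>f (int (n mod N))\<bar> \<le> (\<Sum>r<N. \<bar>f (int r)\<bar>)"
      using N by (intro member_le_sum) auto
    ultimately show ?thesis by simp
  qed
  then show thesis by (rule that)
qed

text \<open>With \<open>L\<close> the product of the first \<open>i\<close> factors, periodicity gives that the monodromy \<open>Xi\<close> based at \<open>i\<close>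
satisfies \<open>Xi L = L X\<^sub>0\<close>. It is conjugate to \<open>X\<^sub>0\<close>, and a multiple of the identity is conjugate only to
itself.\<close>

lemma periodic_monodromy_conjugate:
  assumes \<alpha>: "\<And>j. \<alpha> (j + int N) = \<alpha> j" "\<And>j. \<alpha> j > 0" and \<beta>: "\<And>j. \<beta> (j + int N) = \<beta> j"
    and X0: "periodic_N_step_transfer N \<alpha> \<beta> 0 0 = \<sigma> *\<^sub>R mat 1"
  shows "periodic_N_step_transfer N \<alpha> \<beta> (int i) 0 = \<sigma> *\<^sub>R mat 1"
proof -
  define P where "P k = periodic_transfer_matrix \<alpha> \<beta> (int k) 0" for k
  define L where "L = left_prod P i"
  define Xi where "Xi = left_prod (\<lambda>k. P (i + k)) N"
  have per: "P (N + k) = P k" for k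
    using \<alpha>(1) [of "int k"] \<alpha>(1) [of "int k - 1"] \<beta> [of "int k"]
    unfolding P_def periodic_transfer_matrix_def by (simp add: algebra_simps)
  have X0': "left_prod P N = \<sigma> *\<^sub>R mat 1"
    using X0 unfolding periodic_N_step_transfer_def P_def by simp
  have "left_prod P (i + N) = Xi ** L" unfolding Xi_def L_def by (rule left_prod_add)
  moreover have "left_prod P (i + N) = L ** (\<sigma> *\<^sub>R mat 1)"
    using left_prod_add [of P N i] unfolding per X0' L_def by (simp add: add.commute)
  ultimately have eq: "Xi ** L = \<sigma> *\<^sub>R L"
    by (simp add: scalar_matrix_assoc [symmetric] matrix_scalar_ac)
  have "det (P k) \<noteq> 0" for k
    using \<alpha>(2) [of "int k"] \<alpha>(2) [of "int k - 1"]
    by (simp add: P_def periodic_transfer_matrix_def det_2 vector_2)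
  then have "det (left_prod P m) \<noteq> 0" for m by (induction m) (simp_all add: det_mul)
  then have "invertible L" unfolding L_def by (simp add: invertible_det_nz)
  then obtain L' where L': "L ** L' = mat 1" unfolding invertible_def by blast
  have "Xi = Xi ** L ** L'" by (simp add: matrix_mul_assoc [symmetric] L')
  also have "\<dots> = \<sigma> *\<^sub>R mat 1" unfolding eq by (simp add: scalar_matrix_assoc [symmetric] L')
  finally show ?thesis
    unfolding Xi_def P_def periodic_N_step_transfer_def by simp
qed

lemma N_step_transfer_tendsto:
  assumes N: "N > 0" and mod: "periodically_modulated N \<alpha> \<beta> a b"
  shows "(\<lambda>n. N_step_transfer N a b (n * N + i) 0) \<longlonglongrightarrow> periodic_N_step_transfer N \<alpha> \<beta> (int i) 0"
proof -
  have \<alpha>: "\<And>j. \<alpha> (j + int N) = \<alpha> j" and \<beta>: "\<And>j. \<beta> (j + int N) = \<beta> j"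
    and ra: "(\<lambda>n. \<bar>a (n - 1) / a n - \<alpha> (int n - 1) / \<alpha> (int n)\<bar>) \<longlonglongrightarrow> 0"
    and rb: "(\<lambda>n. \<bar>b n / a n - \<beta> (int n) / \<alpha> (int n)\<bar>) \<longlonglongrightarrow> 0"
    using mod unfolding periodically_modulated_def by auto
  have sub: "filterlim (\<lambda>n. n * N + i + k) sequentially sequentially" for k
  proof (rule filterlim_at_top_mono [OF filterlim_ident])
    show "eventually (\<lambda>n. n \<le> n * N + i + k) sequentially"
      using N by (intro always_eventually allI) (simp add: trans_le_add1)
  qed
  have pa: "\<alpha> (int (n * N + i + k)) = \<alpha> (int (i + k))" "\<alpha> (int (n * N + i + k) - 1) = \<alpha> (int (i + k) - 1)"
    "\<beta> (int (n * N + i + k)) = \<beta> (int (i + k))" for n k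
    using periodic_multiple [of \<alpha> N "int (i + k)" n] periodic_multiple [of \<alpha> N "int (i + k) - 1" n]
      periodic_multiple [of \<beta> N "int (i + k)" n] \<alpha> \<beta> by (simp_all add: algebra_simps)
  show ?thesis
    unfolding N_step_transfer_def periodic_N_step_transfer_def
  proof (rule tendsto_left_prod)
    fix k
    have la: "(\<lambda>n. a (n * N + i + k - 1) / a (n * N + i + k)) \<longlonglongrightarrow> \<alpha> (int (i + k) - 1) / \<alpha> (int (i + k))"
      using filterlim_compose [OF ra sub [of k]] unfolding pa
      by (simp add: LIM_zero_iff tendsto_rabs_zero_iff)
    have lb: "(\<lambda>n. b (n * N + i + k) / a (n * N + i + k)) \<longlonglongrightarrow> \<beta> (int (i + k)) / \<alpha> (int (i + k))"
      using filterlim_compose [OF rb sub [of k]] unfolding pa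
      by (simp add: LIM_zero_iff tendsto_rabs_zero_iff)
    show "(\<lambda>n. transfer_matrix a b (n * N + i + k) 0)
        \<longlonglongrightarrow> periodic_transfer_matrix \<alpha> \<beta> (int i + int k) 0"
      unfolding transfer_matrix_def periodic_transfer_matrix_def
    proof (intro vec_tendstoI)
      fix r s :: 2
      show "(\<lambda>n. (vector [vector [0, 1], vector [- (a (n * N + i + k - 1) / a (n * N + i + k)),
          (0 - b (n * N + i + k)) / a (n * N + i + k)]] :: real^2^2) $ r $ s)
        \<longlonglongrightarrow> (vector [vector [0, 1], vector [- (\<alpha> (int i + int k - 1) / \<alpha> (int i + int k)),
          (0 - \<beta> (int i + int k)) / \<alpha> (int i + int k)]] :: real^2^2) $ r $ s"
        using exhaust_2 [of r] exhaust_2 [of s] tendsto_minus [OF la] tendsto_minus [OF lb]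
        by (elim disjE) simp_all
    qed
  qed
qed

lemma mat_op_apply: "blinfun_apply (mat_op M) v = M *v v"
  unfolding mat_op_def by (simp add: bounded_linear_Blinfun_apply)

text \<open>The entry \<open>(r, s)\<close> is a component of the image of the unit vector at \<open>s\<close>.\<close>

lemma entry_le_norm_mat_op:
  "\<bar>M $ r $ s - M' $ r $ s\<bar> \<le> norm (mat_op M - mat_op M')"
proof -
  have "M $ r $ s - M' $ r $ s = (blinfun_apply (mat_op M - mat_op M') (axis s 1)) $ r"
    by (simp add: blinfun.diff_left mat_op_apply matrix_vector_mult_basis column_def)
  also have "\<bar>\<dots>\<bar> \<le> norm (blinfun_apply (mat_op M - mat_op M') (axis s 1))"
    by (rule component_le_norm_cart)
  also have "\<dots> \<le> norm (mat_op M - mat_op M') * norm (axis s (1::real))" by (rule norm_blinfun)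
  finally show ?thesis by (simp add: norm_axis_1)
qed

lemma D1_entries_bv:
  assumes "D1 (\<lambda>n. mat_op (R n))" shows "bv (\<lambda>n. R n $ r $ s)"
proof -
  have "summable (\<lambda>n. norm (mat_op (R (n + 2)) - mat_op (R (n + 1))))" using assms unfolding D1_def by blast
  then have "summable (\<lambda>n. \<bar>R (Suc (Suc n)) $ r $ s - R (Suc n) $ r $ s\<bar>)"
    by (rule summable_comparison_test') (use entry_le_norm_mat_op in simp)
  then show ?thesis unfolding bv_def by (subst summable_Suc_iff [symmetric])
qed

text \<open>The ratios of consecutive \<open>a\<close> approach a periodic sequence of positive numbers, which is bounded away
from zero and infinity. This settles large indices, and the
remaining finitely many ones are absorbed in \<open>H\<close>.\<close>

lemma modulation_bounds:
  assumes N: "N > 0" and a: "\<And>n. a n > 0" and mod: "periodically_modulated N \<alpha> \<beta> a b"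
  obtains G where "G \<ge> 1" "\<And>n. a (Suc n) \<le> G * a n" "\<And>n. a n \<le> G * a (Suc n)" "\<And>n. \<bar>b (Suc n)\<bar> \<le> G * a (Suc n)"
proof -
  have \<alpha>: "\<And>j. \<alpha> (j + int N) = \<alpha> j" "\<And>j. \<alpha> j > 0" and \<beta>: "\<And>j. \<beta> (j + int N) = \<beta> j"
    and ra: "(\<lambda>n. \<bar>a (n - 1) / a n - \<alpha> (int n - 1) / \<alpha> (int n)\<bar>) \<longlonglongrightarrow> 0"
    and rb: "(\<lambda>n. \<bar>b n / a n - \<beta> (int n) / \<alpha> (int n)\<bar>) \<longlonglongrightarrow> 0"
    using mod unfolding periodically_modulated_def by auto
  have \<alpha>': "\<alpha> (j + int N - 1) = \<alpha> (j - 1)" for j using \<alpha>(1) [of "j - 1"] by (simp add: algebra_simps)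
  obtain F1 where F1: "\<And>n. \<bar>\<alpha> (int n - 1) / \<alpha> (int n)\<bar> \<le> F1"
    by (rule periodic_bounded [OF N, of "\<lambda>j. \<alpha> (j - 1) / \<alpha> j"]) (use \<alpha>(1) \<alpha>' in auto)
  obtain F2 where F2: "\<And>n. \<bar>\<beta> (int n) / \<alpha> (int n)\<bar> \<le> F2"
    by (rule periodic_bounded [OF N, of "\<lambda>j. \<beta> j / \<alpha> j"]) (use \<alpha>(1) \<beta> in auto)
  obtain F3 where F3: "\<And>n. \<bar>\<alpha> (int n) / \<alpha> (int n - 1)\<bar> \<le> F3"
    by (rule periodic_bounded [OF N, of "\<lambda>j. \<alpha> j / \<alpha> (j - 1)"]) (use \<alpha>(1) \<alpha>' in auto)
  obtain E1 where E1: "\<And>n. \<bar>a (n - 1) / a n - \<alpha> (int n - 1) / \<alpha> (int n)\<bar> \<le> E1"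
    using convergent_imp_Bseq [OF convergentI [OF ra]] unfolding Bseq_def by auto
  obtain E2 where E2: "\<And>n. \<bar>b n / a n - \<beta> (int n) / \<alpha> (int n)\<bar> \<le> E2"
    using convergent_imp_Bseq [OF convergentI [OF rb]] unfolding Bseq_def by auto
  define c where "c = 1 / (\<bar>F3\<bar> + 1)"
  have c: "c > 0" unfolding c_def by simp
  have ge: "\<alpha> (int n - 1) / \<alpha> (int n) \<ge> c" for n
  proof -
    have "\<alpha> (int n) / \<alpha> (int n - 1) \<le> \<bar>F3\<bar> + 1" using F3 [of n] by linarith
    then have "\<alpha> (int n) \<le> (\<bar>F3\<bar> + 1) * \<alpha> (int n - 1)" using \<alpha>(2) [of "int n - 1"] by (simp add: divide_le_eq)
    then show ?thesis unfolding c_def using \<alpha>(2) [of "int n"] by (simp add: divide_le_eq le_divide_eq mult.commute)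
  qed
  have "eventually (\<lambda>n. \<bar>a (n - 1) / a n - \<alpha> (int n - 1) / \<alpha> (int n)\<bar> < c / 2) sequentially"
    using order_tendstoD(2) [OF ra, of "c / 2"] c by simp
  then obtain M where M: "\<And>n. n \<ge> M \<Longrightarrow> \<bar>a (n - 1) / a n - \<alpha> (int n - 1) / \<alpha> (int n)\<bar> < c / 2"
    unfolding eventually_sequentially by blast
  have late: "a (Suc n) \<le> 2 / c * a n" if "n \<ge> M" for n
  proof -
    have "a n / a (Suc n) \<ge> c / 2"
      using M [OF le_SucI [OF that]] ge [of "Suc n"] unfolding diff_Suc_1 by linarith
    then show ?thesis using a[of "Suc n"] c by (simp add: field_simps)
  qed
  define H where "H = (\<Sum>n<M. a (Suc n) / a n)"
  have early: "a (Suc n) \<le> H * a n" if "n < M" for n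
  proof -
    have "a (Suc n) / a n \<le> H" unfolding H_def
      using that by (intro member_le_sum) (auto simp: a less_imp_le)
    then show ?thesis using a[of n] by (simp add: divide_le_eq)
  qed
  have H: "H \<ge> 0" unfolding H_def by (intro sum_nonneg) (simp add: a less_imp_le)
  define G where "G = 1 + 2 / c + H + \<bar>E1\<bar> + \<bar>F1\<bar> + \<bar>E2\<bar> + \<bar>F2\<bar>"
  have c2: "2 / c > 0" using c by simp
  have G: "G \<ge> 1" "G \<ge> 2 / c" "G \<ge> H" "G \<ge> E1 + F1" "G \<ge> E2 + F2" unfolding G_def using H c2 by linarith+
  show thesis
  proof (rule that [OF G(1)])
    fix n
    show "a (Suc n) \<le> G * a n"
    proof (cases "n < M")
      case True
      have "H * a n \<le> G * a n" using G(3) a[of n] by (intro mult_right_mono) auto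
      then show ?thesis using early [OF True] by linarith
    next
      case False
      have "2 / c * a n \<le> G * a n" using G(2) a[of n] by (intro mult_right_mono) auto
      then show ?thesis using late [of n] False by linarith
    qed
    have "a n / a (Suc n) \<le> G" using E1 [of "Suc n"] F1 [of "Suc n"] G(4) unfolding diff_Suc_1 by linarith
    then show "a n \<le> G * a (Suc n)" using a[of "Suc n"] by (simp add: divide_le_eq)
    have "\<bar>b (Suc n) / a (Suc n)\<bar> \<le> G" using E2 [of "Suc n"] F2 [of "Suc n"] G(5) by linarith
    then show "\<bar>b (Suc n)\<bar> \<le> G * a (Suc n)" using a[of "Suc n"] by (simp add: divide_le_eq)
  qed
qed

lemma sol_growth:
  assumes a: "\<And>n. a n > 0" and G: "G \<ge> 1" "\<And>n. a n \<le> G * a (Suc n)" "\<And>n. \<bar>b (Suc n)\<bar> \<le> G * a (Suc n)"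
    and u: "sol a b u"
  shows "\<bar>u (n + r)\<bar> + \<bar>u (Suc (n + r))\<bar> \<le> (2 * G) ^ r * (\<bar>u n\<bar> + \<bar>u (Suc n)\<bar>)"
proof (induction r)
  case (Suc r)
  let ?m = "n + r"
  have "a ?m * u ?m + b (Suc ?m) * u (Suc ?m) + a (Suc ?m) * u (Suc (Suc ?m)) = 0"
    using u unfolding sol_def by blast
  then have "a (Suc ?m) * u (Suc (Suc ?m)) = - (a ?m * u ?m) - b (Suc ?m) * u (Suc ?m)" by linarith
  then have "a (Suc ?m) * \<bar>u (Suc (Suc ?m))\<bar> = \<bar>- (a ?m * u ?m) - b (Suc ?m) * u (Suc ?m)\<bar>"
    using a[of "Suc ?m"] by (metis abs_mult abs_of_pos)
  also have "\<dots> \<le> \<bar>a ?m * u ?m\<bar> + \<bar>b (Suc ?m) * u (Suc ?m)\<bar>" by linarith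
  also have "\<dots> = a ?m * \<bar>u ?m\<bar> + \<bar>b (Suc ?m)\<bar> * \<bar>u (Suc ?m)\<bar>" using a[of ?m] by (simp add: abs_mult)
  also have "\<dots> \<le> (G * a (Suc ?m)) * \<bar>u ?m\<bar> + (G * a (Suc ?m)) * \<bar>u (Suc ?m)\<bar>"
    by (intro add_mono mult_right_mono G) auto
  also have "\<dots> = a (Suc ?m) * (G * (\<bar>u ?m\<bar> + \<bar>u (Suc ?m)\<bar>))" by (simp add: algebra_simps)
  finally have 1: "\<bar>u (Suc (Suc ?m))\<bar> \<le> G * (\<bar>u ?m\<bar> + \<bar>u (Suc ?m)\<bar>)" using a[of "Suc ?m"] by simp
  have "1 * (\<bar>u ?m\<bar> + \<bar>u (Suc ?m)\<bar>) \<le> G * (\<bar>u ?m\<bar> + \<bar>u (Suc ?m)\<bar>)" using G(1) by (intro mult_right_mono) auto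
  then have "\<bar>u (Suc ?m)\<bar> + \<bar>u (Suc (Suc ?m))\<bar> \<le> 2 * G * (\<bar>u ?m\<bar> + \<bar>u (Suc ?m)\<bar>)" using 1 unfolding mult.assoc mult_1 by linarith
  also have "\<dots> \<le> 2 * G * ((2 * G) ^ r * (\<bar>u n\<bar> + \<bar>u (Suc n)\<bar>))" using Suc G(1) by (intro mult_left_mono) auto
  finally show ?case by (simp add: mult_ac)
qed simp

lemma bound_from_eventual_bound:
  fixes f g :: "nat \<Rightarrow> real"
  assumes g: "\<And>n. g n > 0" and late: "\<And>n. n \<ge> M \<Longrightarrow> \<bar>f n\<bar> \<le> C * g n"
  obtains C' where "C' > 0" "\<And>n. \<bar>f n\<bar> \<le> C' * g n"
proof -
  define H where "H = (\<Sum>n<M. \<bar>f n\<bar> / g n)"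
  have H: "H \<ge> 0" unfolding H_def by (intro sum_nonneg) (simp add: g less_imp_le)
  have "\<bar>f n\<bar> \<le> (H + \<bar>C\<bar> + 1) * g n" for n
  proof (cases "n < M")
    case True
    have "\<bar>f n\<bar> / g n \<le> H" unfolding H_def using True by (intro member_le_sum) (auto simp: g less_imp_le)
    then have "\<bar>f n\<bar> / g n \<le> H + \<bar>C\<bar> + 1" by linarith
    then show ?thesis using g[of n] by (simp add: divide_le_eq)
  next
    case False
    have "C * g n \<le> (H + \<bar>C\<bar> + 1) * g n" using H g[of n] by (intro mult_right_mono) auto
    then show ?thesis using late [of n] False by linarith
  qed
  then show thesis using that [of "H + \<bar>C\<bar> + 1"] H by simp
qed

lemma summable_div:
  fixes f :: "nat \<Rightarrow> real"
  assumes N: "N > 0" and f: "summable f" "\<And>n. f n \<ge> 0"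
  shows "summable (\<lambda>n. f (n div N))"
proof (rule bounded_imp_summable)
  fix n
  have grp: "(\<Sum>m<k * N. f (m div N)) = real N * (\<Sum>m<k. f m)" for k
  proof (induction k)
    case (Suc k)
    have "(\<Sum>m<Suc k * N. f (m div N)) = (\<Sum>m<k * N. f (m div N)) + (\<Sum>r<N. f ((k * N + r) div N))"
      using sum.nat_group [of "\<lambda>m. f (m div N)" N "Suc k"] sum.nat_group [of "\<lambda>m. f (m div N)" N k]
        sum.shift_bounds_nat_ivl [of "\<lambda>m. f (m div N)" 0 "k * N" N]
      by (simp add: lessThan_atLeast0 add.commute)
    also have "(\<Sum>r<N. f ((k * N + r) div N)) = real N * f k" using N by simp
    finally show ?case using Suc by (simp add: distrib_left)
  qed simp
  have "Suc n * 1 \<le> Suc n * N" using N by (intro mult_le_mono2) simp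
  then have "{..n} \<subseteq> {..<Suc n * N}" by auto
  then have "(\<Sum>m\<le>n. f (m div N)) \<le> (\<Sum>m<Suc n * N. f (m div N))"
    by (intro sum_mono2) (auto simp: f(2))
  also have "\<dots> = real N * (\<Sum>m<Suc n. f m)" by (rule grp)
  also have "\<dots> \<le> real N * suminf f" by (intro mult_left_mono sum_le_suminf f) (auto simp: f(2))
  finally show "(\<Sum>m\<le>n. f (m div N)) \<le> real N * suminf f" .
qed (rule f(2))

text \<open>Changing the starting index multiplies the products by a constant and shifts the series. Towards a
larger starting index the constant has to be divided out, which requires non-zero factors.\<close>

lemma summable_tail_products:
  fixes t :: "nat \<Rightarrow> real"
  assumes s: "summable (\<lambda>k. \<Prod>j=m..m + k. t j)" and nz: "\<And>j. j \<ge> m \<Longrightarrow> t j \<noteq> 0"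
  shows "summable (\<lambda>k. \<Prod>j=n..n + k. t j)"
proof (cases "m \<le> n")
  case True
  have split: "(\<Prod>j=m..m + (k + (n - m)). t j) = (\<Prod>j=m..<n. t j) * (\<Prod>j=n..n + k. t j)" for k
    using True prod.atLeastLessThan_concat [of m n "Suc (n + k)" t]
    by (simp add: atLeastLessThanSuc_atLeastAtMost add.commute)
  have "summable (\<lambda>k. \<Prod>j=m..m + (k + (n - m)). t j)" using s by (rule summable_ignore_initial_segment)
  then have "summable (\<lambda>k. (\<Prod>j=m..<n. t j) * (\<Prod>j=n..n + k. t j))" unfolding split .
  moreover have "(\<Prod>j=m..<n. t j) \<noteq> 0" using nz by simp
  ultimately show ?thesis by simp
next
  case False
  have split: "(\<Prod>j=n..n + (k + (m - n)). t j) = (\<Prod>j=n..<m. t j) * (\<Prod>j=m..m + k. t j)" for k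
    using False prod.atLeastLessThan_concat [of n m "Suc (m + k)" t]
    by (simp add: atLeastLessThanSuc_atLeastAtMost add.commute)
  have "summable (\<lambda>k. \<Prod>j=n..n + (k + (m - n)). t j)" unfolding split using s by (rule summable_mult)
  then show ?thesis by (subst (asm) summable_iff_shift)
qed

section \<open>Self-adjointness and discreteness\<close>

lemma asymptotically_diagonal_mono:
  assumes "asymptotically_diagonal K T p q x y e c" "K \<le> K'"
  shows "asymptotically_diagonal K' T p q x y e c"
  using assms unfolding asymptotically_diagonal_def by (meson order_trans)

text \<open>Applied to the transfer matrices, this shows that \<open>\<gamma>\<close> tends to infinity: an entry of \<open>R\<close> with a non-zero
limit is \<open>\<gamma>\<close> times a null sequence.\<close>

lemma rescaled_increment_tendsto_zero:
  fixes X R :: "nat \<Rightarrow> real^2^2"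
  assumes X: "X \<longlonglongrightarrow> X0" and R: "\<And>n. R n = \<gamma> n *\<^sub>R (X n - X0)" "R \<longlonglongrightarrow> R0" "R0 \<noteq> 0"
    and \<gamma>: "\<And>n. \<gamma> n > 0"
  shows "(\<lambda>n. 1 / \<gamma> n) \<longlonglongrightarrow> 0"
proof -
  obtain r s where rs: "R0 $ r $ s \<noteq> 0" using R(3) by (metis vec_eq_iff zero_index)
  have lim: "(\<lambda>n. R n $ r $ s) \<longlonglongrightarrow> R0 $ r $ s" by (intro tendsto_vec_nth R)
  have "(\<lambda>n. X n $ r $ s - X0 $ r $ s) \<longlonglongrightarrow> X0 $ r $ s - X0 $ r $ s"
    by (intro tendsto_diff tendsto_vec_nth X tendsto_const)
  then have "(\<lambda>n. (X n $ r $ s - X0 $ r $ s) / R n $ r $ s) \<longlonglongrightarrow> 0"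
    using tendsto_divide [OF _ lim rs, of "\<lambda>n. X n $ r $ s - X0 $ r $ s" 0] by simp
  moreover have "eventually (\<lambda>n. (X n $ r $ s - X0 $ r $ s) / R n $ r $ s = 1 / \<gamma> n) sequentially"
  proof (rule eventually_mono [OF tendsto_imp_eventually_ne [OF lim rs]])
    fix n assume "R n $ r $ s \<noteq> 0"
    moreover have "R n $ r $ s = \<gamma> n * (X n $ r $ s - X0 $ r $ s)" unfolding R(1) by simp
    ultimately show "(X n $ r $ s - X0 $ r $ s) / R n $ r $ s = 1 / \<gamma> n" using \<gamma>[of n] by simp
  qed
  ultimately show ?thesis by (rule Lim_transform_eventually)
qed

lemma prod_ratio_mono:
  fixes p q :: "nat \<Rightarrow> real"
  assumes q: "\<And>j. j \<ge> K \<Longrightarrow> 0 < q j" and qp: "\<And>j. j \<ge> K \<Longrightarrow> q j \<le> p j" and kl: "K \<le> k" "k \<le> l"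
  shows "(\<Prod>j\<in>{K..<k}. p j) * (\<Prod>j\<in>{K..<l}. q j) \<le> (\<Prod>j\<in>{K..<l}. p j) * (\<Prod>j\<in>{K..<k}. q j)"
proof -
  have split: "(\<Prod>j\<in>{K..<l}. g j) = (\<Prod>j\<in>{K..<k}. g j) * (\<Prod>j\<in>{k..<l}. g j)" for g :: "nat \<Rightarrow> real"
    using prod.atLeastLessThan_concat [OF kl, of g] by simp
  have "(\<Prod>j\<in>{k..<l}. q j) \<le> (\<Prod>j\<in>{k..<l}. p j)"
    using kl by (intro prod_mono) (auto intro: qp less_imp_le [OF q])
  moreover have "0 \<le> (\<Prod>j\<in>{K..<k}. p j) * (\<Prod>j\<in>{K..<k}. q j)"
  proof -
    have "0 \<le> p j" "0 \<le> q j" if "j \<in> {K..<k}" for j using q[of j] qp[of j] that by auto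
    then show ?thesis by (intro mult_nonneg_nonneg prod_nonneg) auto
  qed
  ultimately have "((\<Prod>j\<in>{K..<k}. p j) * (\<Prod>j\<in>{K..<k}. q j)) * (\<Prod>j\<in>{k..<l}. q j)
    \<le> ((\<Prod>j\<in>{K..<k}. p j) * (\<Prod>j\<in>{K..<k}. q j)) * (\<Prod>j\<in>{k..<l}. p j)" by (rule mult_left_mono)
  then show ?thesis unfolding split by (simp add: mult_ac)
qed

lemma discr_eq_disc2: "discr X = disc2 (X $ 1 $ 1) (X $ 1 $ 2) (X $ 2 $ 1) (X $ 2 $ 2)"
  by (simp add: discr_def disc2_def trace_def det_2 sum_2 power2_eq_square algebra_simps)

text \<open>Both sides are the determinant of \<open>Id + r M\<close>, where \<open>M\<close> has rows \<open>(A, B)\<close> and \<open>(C, D)\<close>.\<close>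

lemma eig_product:
  fixes A B C D r :: real
  assumes "disc2 A B C D \<ge> 0"
  shows "(1 + r * eig_plus A B C D) * (1 + r * eig_minus A B C D) = (1 + r * A) * (1 + r * D) - r * B * (r * C)"
proof -
  define s where "s = sqrt (disc2 A B C D)"
  have s: "s * s = (A - D) * (A - D) + 4 * B * C"
    using assms unfolding s_def by (simp add: disc2_def power2_eq_square)
  have "(1 + r * eig_plus A B C D) * (1 + r * eig_minus A B C D)
      = (1 + r * (A + D) / 2) * (1 + r * (A + D) / 2) - r * r * (s * s) / 4"
    unfolding eig_plus_def eig_minus_def s_def [symmetric] by (simp add: field_simps)
  also have "\<dots> = (1 + r * A) * (1 + r * D) - r * B * (r * C)" unfolding s by (simp add: field_simps)
  finally show ?thesis .
qed

text \<open>Sizes known at every \<open>N\<close>-th position determine the sizes everywhere up to constants, since neither the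
solutions nor \<open>a\<close> change by more than a bounded factor per step. For \<open>m \<le> n\<close>, with \<open>k \<le> l\<close> the
corresponding sample indices,
\<open>(P\<^sub>k Q\<^sub>l)\<^sup>2 \<le> (P\<^sub>k Q\<^sub>l) (P\<^sub>l Q\<^sub>k) = (P\<^sub>k Q\<^sub>k) (P\<^sub>l Q\<^sub>l)\<close>, and the right-hand side is a multiple of
\<open>1 / (a\<^sub>m a\<^sub>n)\<close> up to a bounded factor.\<close>

lemma sampled_bounds_dichotomy:
  fixes a b \<phi> \<psi> P Q :: "nat \<Rightarrow> real" and \<tau> :: "nat \<Rightarrow> nat"
  assumes N_pos: "N > 0" and a_pos: "\<And>n. a n > 0" and a_summable: "summable (\<lambda>n. 1 / a n)"
    and G: "G \<ge> 1" "\<And>n. a (Suc n) \<le> G * a n" "\<And>n. a n \<le> G * a (Suc n)"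
      "\<And>n. \<bar>b (Suc n)\<bar> \<le> G * a (Suc n)"
    and \<phi>: "sol a b \<phi>" and \<psi>: "sol a b \<psi>" and wr: "a 0 * (\<phi> 0 * \<psi> 1 - \<phi> 1 * \<psi> 0) = 1"
    and \<tau>K: "\<And>d. \<tau> (K + d) = \<tau> K + d * N"
    and \<phi>_low: "\<And>k. k \<ge> K \<Longrightarrow> P k \<le> C * (\<bar>\<phi> (\<tau> k)\<bar> + \<bar>\<phi> (Suc (\<tau> k))\<bar>)"
    and \<phi>_up: "\<And>k. k \<ge> K \<Longrightarrow> \<bar>\<phi> (\<tau> k)\<bar> + \<bar>\<phi> (Suc (\<tau> k))\<bar> \<le> C * P k"
    and \<psi>_up: "\<And>k. k \<ge> K \<Longrightarrow> \<bar>\<psi> (\<tau> k)\<bar> + \<bar>\<psi> (Suc (\<tau> k))\<bar> \<le> C * Q k"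
    and P0: "\<And>k. P k > 0" and Q0: "\<And>k. Q k > 0" and QP: "\<And>k. Q k \<le> P k"
    and ratio: "\<And>k l. K \<le> k \<Longrightarrow> k \<le> l \<Longrightarrow> P k * Q l \<le> P l * Q k"
    and PQ: "\<And>k. k \<ge> K \<Longrightarrow> P k * Q k = a (\<tau> K) / a (\<tau> k)"
  obtains h where "jacobi_dichotomy a b \<phi> \<psi> h"
    "summable (\<lambda>n. (\<phi> n)\<^sup>2) \<longleftrightarrow> summable (\<lambda>k. (P k)\<^sup>2)"
proof -
  \<comment> \<open>The index of the last sample position not exceeding \<open>n\<close>; it is \<open>K\<close> before the first one.\<close>
  define \<kappa> where "\<kappa> n = K + (n - \<tau> K) div N" for n
  have \<kappa>K: "\<kappa> n \<ge> K" for n unfolding \<kappa>_def by simp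
  have locate: "\<exists>r<N. n = \<tau> (\<kappa> n) + r" if "n \<ge> \<tau> K" for n
  proof (intro exI [of _ "(n - \<tau> K) mod N"] conjI)
    show "(n - \<tau> K) mod N < N" using N_pos by simp
    show "n = \<tau> (\<kappa> n) + (n - \<tau> K) mod N"
      unfolding \<kappa>_def \<tau>K using that div_mult_mod_eq [of "n - \<tau> K" N] by linarith
  qed
  have grow: "\<bar>u n\<bar> \<le> (2 * G) ^ N * (\<bar>u (\<tau> (\<kappa> n))\<bar> + \<bar>u (Suc (\<tau> (\<kappa> n)))\<bar>)"
    if u: "sol a b u" and n: "n \<ge> \<tau> K" for u n
  proof -
    obtain r where r: "r < N" "n = \<tau> (\<kappa> n) + r" using locate [OF n] by blast
    have "\<bar>u n\<bar> \<le> \<bar>u (\<tau> (\<kappa> n) + r)\<bar> + \<bar>u (Suc (\<tau> (\<kappa> n) + r))\<bar>" using r(2) by simp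
    also have "\<dots> \<le> (2 * G) ^ r * (\<bar>u (\<tau> (\<kappa> n))\<bar> + \<bar>u (Suc (\<tau> (\<kappa> n)))\<bar>)"
      by (rule sol_growth [OF a_pos G(1,3,4) u])
    also have "\<dots> \<le> (2 * G) ^ N * (\<bar>u (\<tau> (\<kappa> n))\<bar> + \<bar>u (Suc (\<tau> (\<kappa> n)))\<bar>)"
      using r(1) G(1) by (intro mult_right_mono power_increasing) auto
    finally show ?thesis .
  qed
  obtain C1 where C1: "C1 > 0" "\<And>n. \<bar>\<phi> n\<bar> \<le> C1 * P (\<kappa> n)"
  proof (rule bound_from_eventual_bound [of "\<lambda>n. P (\<kappa> n)" "\<tau> K" \<phi> "(2 * G) ^ N * C"])
    show "\<bar>\<phi> n\<bar> \<le> (2 * G) ^ N * C * P (\<kappa> n)" if "n \<ge> \<tau> K" for n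
      using order_trans [OF grow [OF \<phi> that] mult_left_mono [OF \<phi>_up [OF \<kappa>K]]] G(1)
      by (simp add: mult.assoc)
  qed (use P0 in auto)
  obtain C2 where C2: "C2 > 0" "\<And>n. \<bar>\<psi> n\<bar> \<le> C2 * Q (\<kappa> n)"
  proof (rule bound_from_eventual_bound [of "\<lambda>n. Q (\<kappa> n)" "\<tau> K" \<psi> "(2 * G) ^ N * C"])
    show "\<bar>\<psi> n\<bar> \<le> (2 * G) ^ N * C * Q (\<kappa> n)" if "n \<ge> \<tau> K" for n
      using order_trans [OF grow [OF \<psi> that] mult_left_mono [OF \<psi>_up [OF \<kappa>K]]] G(1)
      by (simp add: mult.assoc)
  qed (use Q0 in auto)
  have a_grow: "a (n + r) \<le> G ^ r * a n" for n r
  proof (induction r)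
    case (Suc r)
    have "a (n + Suc r) \<le> G * a (n + r)" using G(2) by simp
    also have "\<dots> \<le> G * (G ^ r * a n)" using Suc G(1) by (intro mult_left_mono) auto
    finally show ?case by (simp add: mult.assoc)
  qed simp
  obtain C3 where C3: "C3 > 0" "\<And>n. \<bar>P (\<kappa> n) * Q (\<kappa> n)\<bar> \<le> C3 * (1 / a n)"
  proof (rule bound_from_eventual_bound [of "\<lambda>n. 1 / a n" "\<tau> K" "\<lambda>n. P (\<kappa> n) * Q (\<kappa> n)" "a (\<tau> K) * G ^ N"])
    fix n assume n: "n \<ge> \<tau> K"
    obtain r where r: "r < N" "n = \<tau> (\<kappa> n) + r" using locate [OF n] by blast
    have "a n \<le> G ^ r * a (\<tau> (\<kappa> n))" using a_grow [of "\<tau> (\<kappa> n)" r] r(2) by simp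
    also have "\<dots> \<le> G ^ N * a (\<tau> (\<kappa> n))"
      using r(1) G(1) a_pos by (intro mult_right_mono power_increasing) (auto intro: less_imp_le)
    finally have "1 / a (\<tau> (\<kappa> n)) \<le> G ^ N * (1 / a n)"
      using a_pos [of n] a_pos [of "\<tau> (\<kappa> n)"] by (simp add: field_simps)
    from mult_left_mono [OF this less_imp_le [OF a_pos [of "\<tau> K"]]]
    show "\<bar>P (\<kappa> n) * Q (\<kappa> n)\<bar> \<le> a (\<tau> K) * G ^ N * (1 / a n)"
      unfolding PQ [OF \<kappa>K] using a_pos by (simp add: abs_of_pos)
  qed (use a_pos in auto)
  define D where "D = (C1 + C2 + 1)"
  define h where "h n = D * sqrt (C3 / a n)" for n
  have D: "D > 0" "C1 \<le> D" "C2 \<le> D" unfolding D_def using C1 C2 by auto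
  have h_pos: "h n > 0" for n unfolding h_def using D C3 a_pos by simp
  have PQ_le: "P (\<kappa> n) * Q (\<kappa> n) \<le> C3 / a n" for n using C3(2) [of n] by simp
  have cross: "P (\<kappa> m) * Q (\<kappa> n) \<le> sqrt (C3 / a m) * sqrt (C3 / a n)" if "m \<le> n" for m n
  proof -
    have mono: "\<kappa> m \<le> \<kappa> n" unfolding \<kappa>_def using that by (simp add: div_le_mono diff_le_mono)
    have "P (\<kappa> m) * Q (\<kappa> n) \<le> P (\<kappa> n) * Q (\<kappa> m)" by (rule ratio [OF \<kappa>K mono])
    then have "(P (\<kappa> m) * Q (\<kappa> n)) * (P (\<kappa> m) * Q (\<kappa> n)) \<le> (P (\<kappa> m) * Q (\<kappa> n)) * (P (\<kappa> n) * Q (\<kappa> m))"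
      using P0 Q0 by (intro mult_left_mono) (auto intro: less_imp_le)
    also have "\<dots> = (P (\<kappa> m) * Q (\<kappa> m)) * (P (\<kappa> n) * Q (\<kappa> n))" by (simp add: mult_ac)
    also have "\<dots> \<le> (C3 / a m) * (C3 / a n)"
      using P0 Q0 C3(1) a_pos by (intro mult_mono PQ_le) (auto intro!: less_imp_le)
    finally have "(P (\<kappa> m) * Q (\<kappa> n))\<^sup>2 \<le> (C3 / a m) * (C3 / a n)" by (simp add: power2_eq_square)
    then show ?thesis unfolding real_sqrt_mult [symmetric] by (rule real_le_rsqrt)
  qed
  have "jacobi_dichotomy a b \<phi> \<psi> h"
  proof
    show "\<bar>\<phi> m\<bar> * \<bar>\<psi> n\<bar> \<le> h m * h n" if "m \<le> n" for m n
    proof -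
      have "\<bar>\<phi> m\<bar> * \<bar>\<psi> n\<bar> \<le> (C1 * P (\<kappa> m)) * (C2 * Q (\<kappa> n))"
        using C1 P0 [of "\<kappa> m"] by (intro mult_mono C1 C2) auto
      also have "\<dots> = (C1 * C2) * (P (\<kappa> m) * Q (\<kappa> n))" by simp
      also have "\<dots> \<le> (D * D) * (sqrt (C3 / a m) * sqrt (C3 / a n))"
        using D C1(1) C2(1) P0 [of "\<kappa> m"] Q0 [of "\<kappa> n"] by (intro mult_mono cross that) auto
      finally show ?thesis unfolding h_def by (simp add: mult_ac)
    qed
    show "\<bar>\<psi> n\<bar> \<le> h n" for n
    proof -
      have "(Q (\<kappa> n))\<^sup>2 \<le> P (\<kappa> n) * Q (\<kappa> n)"
        using QP [of "\<kappa> n"] Q0 [of "\<kappa> n"] by (simp add: power2_eq_square)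
      also have "\<dots> \<le> C3 / a n" by (rule PQ_le)
      finally have "Q (\<kappa> n) \<le> sqrt (C3 / a n)" by (rule real_le_rsqrt)
      then have "C2 * Q (\<kappa> n) \<le> D * sqrt (C3 / a n)" using D C2(1) Q0 [of "\<kappa> n"] by (intro mult_mono) auto
      with C2(2) [of n] show ?thesis unfolding h_def by linarith
    qed
    have "(h n)\<^sup>2 = D\<^sup>2 * C3 * (1 / a n)" for n
      unfolding h_def using C3(1) a_pos [of n] by (simp add: power_mult_distrib)
    then show "summable (\<lambda>n. (h n)\<^sup>2)" using summable_mult [OF a_summable, of "D\<^sup>2 * C3"] by simp
  qed (use a_pos \<phi> \<psi> wr h_pos in auto)
  moreover have "summable (\<lambda>n. (\<phi> n)\<^sup>2) \<longleftrightarrow> summable (\<lambda>k. (P k)\<^sup>2)"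
  proof
    assume s: "summable (\<lambda>n. (\<phi> n)\<^sup>2)"
    have inj: "inj (\<lambda>d. \<tau> (K + d))" "inj (\<lambda>d. Suc (\<tau> (K + d)))"
      unfolding \<tau>K using N_pos by (auto simp: inj_def)
    have "summable (\<lambda>d. (\<phi> (\<tau> (K + d)))\<^sup>2)" "summable (\<lambda>d. (\<phi> (Suc (\<tau> (K + d))))\<^sup>2)"
      using summable_reindex [OF s inj(1)] summable_reindex [OF s inj(2)] by (simp_all add: o_def)
    then have "summable (\<lambda>d. 2 * C\<^sup>2 * ((\<phi> (\<tau> (K + d)))\<^sup>2 + (\<phi> (Suc (\<tau> (K + d))))\<^sup>2))"
      by (intro summable_mult summable_add)
    moreover have "norm ((P (K + d))\<^sup>2) \<le> 2 * C\<^sup>2 * ((\<phi> (\<tau> (K + d)))\<^sup>2 + (\<phi> (Suc (\<tau> (K + d))))\<^sup>2)" for d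
    proof -
      let ?x = "\<bar>\<phi> (\<tau> (K + d))\<bar>" and ?y = "\<bar>\<phi> (Suc (\<tau> (K + d)))\<bar>"
      have "(P (K + d))\<^sup>2 \<le> (C * (?x + ?y))\<^sup>2"
        using \<phi>_low [of "K + d"] P0 [of "K + d"] by (intro power_mono) auto
      also have "\<dots> = C\<^sup>2 * (?x + ?y)\<^sup>2" by (rule power_mult_distrib)
      also have "\<dots> \<le> C\<^sup>2 * (2 * (?x\<^sup>2 + ?y\<^sup>2))"
        using zero_le_power2 [of "?x - ?y"] unfolding power2_sum power2_diff by (intro mult_left_mono) auto
      finally show ?thesis by (simp add: algebra_simps)
    qed
    ultimately have "summable (\<lambda>d. (P (K + d))\<^sup>2)" by (rule summable_comparison_test')
    then show "summable (\<lambda>k. (P k)\<^sup>2)"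
      using summable_iff_shift [of "\<lambda>k. (P k)\<^sup>2" K] by (simp add: add.commute)
  next
    assume "summable (\<lambda>k. (P k)\<^sup>2)"
    then have "summable (\<lambda>d. (P (K + d))\<^sup>2)"
      using summable_iff_shift [of "\<lambda>k. (P k)\<^sup>2" K] by (simp add: add.commute)
    then have "summable (\<lambda>n. (P (K + n div N))\<^sup>2)"
      using summable_div [OF N_pos, of "\<lambda>d. (P (K + d))\<^sup>2"] by simp
    then have "summable (\<lambda>n. C1\<^sup>2 * (P (\<kappa> (n + \<tau> K)))\<^sup>2)"
      unfolding \<kappa>_def by (intro summable_mult) simp
    moreover have "norm ((\<phi> (n + \<tau> K))\<^sup>2) \<le> C1\<^sup>2 * (P (\<kappa> (n + \<tau> K)))\<^sup>2" for n
      using power_mono [OF C1(2) abs_ge_zero, of "n + \<tau> K" 2] by (simp add: power_mult_distrib)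
    ultimately have "summable (\<lambda>n. (\<phi> (n + \<tau> K))\<^sup>2)" by (rule summable_comparison_test')
    then show "summable (\<lambda>n. (\<phi> n)\<^sup>2)" by (subst (asm) summable_iff_shift)
  qed
  ultimately show thesis by (rule that)
qed

theorem theorem6p3:
  fixes N i :: nat and a b \<gamma> :: "nat \<Rightarrow> real" and \<alpha> \<beta> :: "int \<Rightarrow> real"
    and \<sigma> :: real and R :: "nat \<Rightarrow> real^2^2" and R_lim :: "real^2^2"
  assumes N_pos: "N > 0"
    and a_pos: "\<And>n. a n > 0"
    and modulated: "periodically_modulated N \<alpha> \<beta> a b"
    and \<sigma>: "\<sigma> \<in> {-1, 1}"
    and X0: "periodic_N_step_transfer N \<alpha> \<beta> 0 0 = \<sigma> *\<^sub>R mat 1"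
    and i: "i < N"
    and \<gamma>_pos: "\<And>n. \<gamma> n > 0"
    and \<gamma>_div: "\<not> summable (\<lambda>n. 1 / \<gamma> n)"
    and R_def: "\<And>n. R n = \<gamma> n *\<^sub>R (N_step_transfer N a b (n * N + i) 0 - \<sigma> *\<^sub>R mat 1)"
    and R_tendsto: "R \<longlonglongrightarrow> R_lim"
    and R_lim_nz: "R_lim \<noteq> 0"
    and R_D1: "D1 (\<lambda>n. mat_op (R n))"
    and discr_pos: "discr R_lim > 0"
    and a_summable: "summable (\<lambda>n. 1 / a n)"
  shows "(self_adjoint (jacobi_matrix a b) \<longleftrightarrow>
           (\<exists>n0\<ge>1. \<not> summable (\<lambda>k. \<Prod>j=n0..n0+k.
              (cmod (1 + (of_real (\<sigma> * trace (R j)) + csqrt (of_real (discr (R j))))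
                         / of_real (2 * \<gamma> j)))\<^sup>2))) \<and>
         (self_adjoint (jacobi_matrix a b) \<longrightarrow> essential_spectrum (jacobi_matrix a b) = {})"
proof -
  have \<sigma>2: "\<sigma> * \<sigma> = 1" and \<sigma>abs: "\<bar>\<sigma>\<bar> = 1" using \<sigma> by auto
  define X where "X n = N_step_transfer N a b (n * N + i) 0" for n
  have \<alpha>: "\<And>j. \<alpha> (j + int N) = \<alpha> j" "\<And>j. \<alpha> j > 0" "\<And>j. \<beta> (j + int N) = \<beta> j"
    using modulated unfolding periodically_modulated_def by auto
  have X: "X \<longlonglongrightarrow> \<sigma> *\<^sub>R mat 1"
    using N_step_transfer_tendsto [OF N_pos modulated, of i]
    unfolding periodic_monodromy_conjugate [OF \<alpha> X0] X_def .
  have RX: "R n = \<gamma> n *\<^sub>R (X n - \<sigma> *\<^sub>R mat 1)" for n unfolding X_def by (rule R_def)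
  define \<epsilon> where "\<epsilon> n = 1 / \<gamma> n" for n
  have \<epsilon>: "\<epsilon> \<longlonglongrightarrow> 0" "\<And>n. \<epsilon> n > 0"
    using rescaled_increment_tendsto_zero [OF X RX R_tendsto R_lim_nz \<gamma>_pos] \<gamma>_pos unfolding \<epsilon>_def by auto
  define S where "S r s n = \<sigma> * R n $ r $ s" for r s n
  have S_bv: "bv (S r s)" for r s unfolding S_def by (intro bv_cmult D1_entries_bv R_D1)
  have S_lim: "S r s \<longlonglongrightarrow> \<sigma> * R_lim $ r $ s" for r s
    unfolding S_def by (intro tendsto_mult tendsto_const tendsto_vec_nth R_tendsto)
  have \<sigma>disc: "disc2 (\<sigma> * A) (\<sigma> * B) (\<sigma> * C) (\<sigma> * D) = disc2 A B C D" for A B C D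
  proof -
    have "disc2 (\<sigma> * A) (\<sigma> * B) (\<sigma> * C) (\<sigma> * D) = (\<sigma> * \<sigma>) * disc2 A B C D"
      unfolding disc2_def by (simp add: power2_eq_square algebra_simps)
    then show ?thesis unfolding \<sigma>2 by simp
  qed
  have discS: "disc2 (S 1 1 n) (S 1 2 n) (S 2 1 n) (S 2 2 n) = discr (R n)" for n
    unfolding S_def \<sigma>disc discr_eq_disc2 ..
  have disc_lim: "disc2 (\<sigma> * R_lim $ 1 $ 1) (\<sigma> * R_lim $ 1 $ 2) (\<sigma> * R_lim $ 2 $ 1) (\<sigma> * R_lim $ 2 $ 2) > 0"
    using discr_pos unfolding \<sigma>disc discr_eq_disc2 .
  define p where "p k = 1 + \<epsilon> k * eig_plus (S 1 1 k) (S 1 2 k) (S 2 1 k) (S 2 2 k)" for k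
  define q where "q k = 1 + \<epsilon> k * eig_minus (S 1 1 k) (S 1 2 k) (S 2 1 k) (S 2 2 k)" for k
  define T where "T = near_identity_step \<epsilon> (S 1 1) (S 1 2) (S 2 1) (S 2 2)"
  obtain K0 l1 l2 m1 m2 e c where disc0: "\<And>k. k \<ge> K0 \<Longrightarrow> discr (R k) > 0"
    and diag0: "asymptotically_diagonal K0 T p q (\<lambda>k u v. l1 k * u + l2 k * v) (\<lambda>k u v. m1 k * u + m2 k * v) e c"
    and det0: "\<And>k. k \<ge> K0 \<Longrightarrow> l1 k * m2 k - l2 k * m1 k \<noteq> 0"
  proof (rule asymptotic_diagonalisation [OF S_bv S_bv S_bv S_bv S_lim S_lim S_lim S_lim disc_lim \<epsilon>])
    fix K l1 l2 m1 m2 e c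
    assume 1: "\<And>k. k \<ge> K \<Longrightarrow> disc2 (S 1 1 k) (S 1 2 k) (S 2 1 k) (S 2 2 k) > 0"
      and 2: "asymptotically_diagonal K (near_identity_step \<epsilon> (S 1 1) (S 1 2) (S 2 1) (S 2 2))
        (\<lambda>k. 1 + \<epsilon> k * eig_plus (S 1 1 k) (S 1 2 k) (S 2 1 k) (S 2 2 k))
        (\<lambda>k. 1 + \<epsilon> k * eig_minus (S 1 1 k) (S 1 2 k) (S 2 1 k) (S 2 2 k))
        (\<lambda>k u v. l1 k * u + l2 k * v) (\<lambda>k u v. m1 k * u + m2 k * v) e c"
      and 3: "\<And>k. k \<ge> K \<Longrightarrow> l1 k * m2 k - l2 k * m1 k \<noteq> 0"
    have "p = (\<lambda>k. 1 + \<epsilon> k * eig_plus (S 1 1 k) (S 1 2 k) (S 2 1 k) (S 2 2 k))"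
      "q = (\<lambda>k. 1 + \<epsilon> k * eig_minus (S 1 1 k) (S 1 2 k) (S 2 1 k) (S 2 2 k))"
      unfolding p_def q_def by (rule refl)+
    with 2 have 2: "asymptotically_diagonal K T p q
        (\<lambda>k u v. l1 k * u + l2 k * v) (\<lambda>k u v. m1 k * u + m2 k * v) e c"
      unfolding T_def by (simp only:)
    have 1: "discr (R k) > 0" if "k \<ge> K" for k using 1 [OF that] by (simp only: discS)
    show thesis by (rule that [of K l1 l2 m1 m2 e c]) (fact 1 2 3)+
  qed
  \<comment> \<open>From index \<open>1\<close> on, the predecessor of \<open>k N + i\<close> is a genuine index.\<close>
  define K1 where "K1 = max K0 1"
  have diag: "asymptotically_diagonal K1 T p q (\<lambda>k u v. l1 k * u + l2 k * v) (\<lambda>k u v. m1 k * u + m2 k * v) e c"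
    by (rule asymptotically_diagonal_mono [OF diag0]) (simp add: K1_def)
  have K1: "k \<ge> K0" "k \<ge> 1" if "k \<ge> K1" for k using that unfolding K1_def by auto
  define \<tau> where "\<tau> k = k * N + i - 1" for k
  have \<tau>1: "Suc (\<tau> k) = k * N + i" if "k \<ge> 1" for k
    using that N_pos unfolding \<tau>_def by (cases k) auto
  have \<tau>S: "\<tau> (Suc k) = \<tau> k + N" if "k \<ge> 1" for k
    using \<tau>1 [OF that] \<tau>1 [of "Suc k"] by simp
  have X\<tau>: "X k = left_prod (\<lambda>j. transfer_matrix a b (Suc (\<tau> k) + j) 0) N" if "k \<ge> 1" for k
    unfolding X_def N_step_transfer_def \<tau>1 [OF that] ..
  have X_entry: "X k $ r $ s = \<sigma> * (mat 1 :: real^2^2) $ r $ s + \<epsilon> k * R k $ r $ s" for k r s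
    unfolding RX \<epsilon>_def using \<gamma>_pos [of k] by simp
  have X11: "X k $ 1 $ 1 = \<sigma> * (1 + \<epsilon> k * S 1 1 k)" and X12: "X k $ 1 $ 2 = \<sigma> * (\<epsilon> k * S 1 2 k)"
    and X21: "X k $ 2 $ 1 = \<sigma> * (\<epsilon> k * S 2 1 k)" and X22: "X k $ 2 $ 2 = \<sigma> * (1 + \<epsilon> k * S 2 2 k)" for k
  proof -
    have gen: "\<sigma> * (x + \<epsilon> k * (\<sigma> * r)) = \<sigma> * x + \<epsilon> k * r" for x r
    proof -
      have "\<sigma> * (x + \<epsilon> k * (\<sigma> * r)) = \<sigma> * x + (\<sigma> * \<sigma>) * (\<epsilon> k * r)" by (simp add: algebra_simps)
      then show ?thesis unfolding \<sigma>2 by simp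
    qed
    show "X k $ 1 $ 1 = \<sigma> * (1 + \<epsilon> k * S 1 1 k)" "X k $ 2 $ 2 = \<sigma> * (1 + \<epsilon> k * S 2 2 k)"
      unfolding S_def gen X_entry by (simp_all add: mat_def)
    show "X k $ 1 $ 2 = \<sigma> * (\<epsilon> k * S 1 2 k)" "X k $ 2 $ 1 = \<sigma> * (\<epsilon> k * S 2 1 k)"
      using gen [of 0] unfolding S_def X_entry by (simp_all add: mat_def)
  qed
  have step: "T k (\<sigma> ^ k * u (\<tau> k)) (\<sigma> ^ k * u (Suc (\<tau> k)))
      = (\<sigma> ^ Suc k * u (\<tau> (Suc k)), \<sigma> ^ Suc k * u (Suc (\<tau> (Suc k))))"
    if u: "sol a b u" and k: "k \<ge> K1" for u k
  proof -
    have k1: "k \<ge> 1" using K1(2) [OF k] .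
    have "X k *v vector [u (\<tau> k), u (Suc (\<tau> k))] = vector [u (\<tau> (Suc k)), u (Suc (\<tau> (Suc k)))]"
      unfolding X\<tau> [OF k1] \<tau>S [OF k1] by (rule left_prod_transfer_step [OF a_pos u])
    then have row: "X k $ 1 $ 1 * u (\<tau> k) + X k $ 1 $ 2 * u (Suc (\<tau> k)) = u (\<tau> (Suc k))"
      "X k $ 2 $ 1 * u (\<tau> k) + X k $ 2 $ 2 * u (Suc (\<tau> k)) = u (Suc (\<tau> (Suc k)))"
      unfolding vec_eq_iff forall_2 mat2_vec vector_2 by auto
    have "\<sigma> ^ Suc k * u (\<tau> (Suc k)) = (\<sigma> * \<sigma>) * \<sigma> ^ k * ((1 + \<epsilon> k * S 1 1 k) * u (\<tau> k) + \<epsilon> k * S 1 2 k * u (Suc (\<tau> k)))"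
      "\<sigma> ^ Suc k * u (Suc (\<tau> (Suc k))) = (\<sigma> * \<sigma>) * \<sigma> ^ k * (\<epsilon> k * S 2 1 k * u (\<tau> k) + (1 + \<epsilon> k * S 2 2 k) * u (Suc (\<tau> k)))"
      unfolding row [symmetric] X11 X12 X21 X22 by (simp_all add: algebra_simps)
    then show ?thesis unfolding T_def near_identity_step_def \<sigma>2 by (simp add: algebra_simps)
  qed
  obtain K \<phi> \<psi> C where K: "K \<ge> K1" and C: "C > 0" and \<phi>: "sol a b \<phi>" and \<psi>: "sol a b \<psi>"
    and wr: "a 0 * (\<phi> 0 * \<psi> 1 - \<phi> 1 * \<psi> 0) = 1"
    and \<phi>_low: "\<And>k. k \<ge> K \<Longrightarrow> (\<Prod>j\<in>{K..<k}. p j) \<le> C * (\<bar>\<phi> (\<tau> k)\<bar> + \<bar>\<phi> (Suc (\<tau> k))\<bar>)"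
    and \<phi>_up: "\<And>k. k \<ge> K \<Longrightarrow> \<bar>\<phi> (\<tau> k)\<bar> + \<bar>\<phi> (Suc (\<tau> k))\<bar> \<le> C * (\<Prod>j\<in>{K..<k}. p j)"
    and \<psi>_up: "\<And>k. k \<ge> K \<Longrightarrow> \<bar>\<psi> (\<tau> k)\<bar> + \<bar>\<psi> (Suc (\<tau> k))\<bar> \<le> C * (\<Prod>j\<in>{K..<k}. q j)"
    by (rule solution_dichotomy [where a = a and b = b and \<tau> = \<tau> and \<sigma> = \<sigma> and K = K1 and T = T
          and p = p and q = q and ?l1.0 = l1 and ?l2.0 = l2 and ?m1.0 = m1 and ?m2.0 = m2 and e = e and c = c,
          OF a_pos \<sigma>abs diag det0 [OF K1(1)] step]) (assumption | rule that)+
  have K_ge: "k \<ge> K0" "k \<ge> 1" if "k \<ge> K" for k using that K K1 [of k] by auto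
  have q0: "0 < q k" and qp: "q k \<le> p k" if "k \<ge> K" for k
    using diag0 K_ge [OF that] unfolding asymptotically_diagonal_def by auto
  define P where "P k = (\<Prod>j\<in>{K..<k}. p j)" for k
  define Q where "Q k = (\<Prod>j\<in>{K..<k}. q j)" for k
  have p0: "0 < p k" if "k \<ge> K" for k using q0 [OF that] qp [OF that] by simp
  have P0: "P k > 0" for k unfolding P_def by (rule prod_pos) (simp add: p0)
  have Q0: "Q k > 0" for k unfolding Q_def by (rule prod_pos) (simp add: q0)
  have QP: "Q k \<le> P k" for k
    unfolding P_def Q_def by (rule prod_mono) (simp add: qp less_imp_le [OF q0])
  have pq: "p k * q k = a (\<tau> k) / a (\<tau> (Suc k))" if "k \<ge> K" for k
  proof -
    have "det (X k) = a (\<tau> k) / a (\<tau> (Suc k))"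
      unfolding X\<tau> [OF K_ge(2) [OF that]] \<tau>S [OF K_ge(2) [OF that]] by (rule det_left_prod_transfer [OF a_pos])
    moreover have "det (X k) = (\<sigma> * \<sigma>) * ((1 + \<epsilon> k * S 1 1 k) * (1 + \<epsilon> k * S 2 2 k) - \<epsilon> k * S 1 2 k * (\<epsilon> k * S 2 1 k))"
      unfolding det_2 X11 X12 X21 X22 by (simp add: algebra_simps)
    moreover have "p k * q k = (1 + \<epsilon> k * S 1 1 k) * (1 + \<epsilon> k * S 2 2 k) - \<epsilon> k * S 1 2 k * (\<epsilon> k * S 2 1 k)"
      unfolding p_def q_def using disc0 [OF K_ge(1) [OF that]] discS [of k] by (intro eig_product) simp
    ultimately show ?thesis unfolding \<sigma>2 by simp
  qed
  have PQ: "P k * Q k = a (\<tau> K) / a (\<tau> k)" if "k \<ge> K" for k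
    using that
  proof (induction rule: dec_induct)
    case base show ?case using a_pos [of "\<tau> K"] by (simp add: P_def Q_def)
  next
    case (step k)
    have "P (Suc k) * Q (Suc k) = (P k * Q k) * (p k * q k)"
      using step.hyps by (simp add: P_def Q_def)
    then show ?case using step.IH pq [OF step.hyps(1)] a_pos [of "\<tau> k"] by simp
  qed
  obtain G where G: "G \<ge> 1" "\<And>n. a (Suc n) \<le> G * a n" "\<And>n. a n \<le> G * a (Suc n)"
    "\<And>n. \<bar>b (Suc n)\<bar> \<le> G * a (Suc n)"
    by (rule modulation_bounds [OF N_pos a_pos modulated]) blast
  have \<tau>K: "\<tau> (K + d) = \<tau> K + d * N" for d
    by (induction d) (use \<tau>S [OF K_ge(2)] in auto)
  have ratio: "P k * Q l \<le> P l * Q k" if "K \<le> k" "k \<le> l" for k l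
    unfolding P_def Q_def by (rule prod_ratio_mono [OF q0 qp that])
  obtain h where dichotomy: "jacobi_dichotomy a b \<phi> \<psi> h"
    and \<phi>_iff: "summable (\<lambda>n. (\<phi> n)\<^sup>2) \<longleftrightarrow> summable (\<lambda>k. (P k)\<^sup>2)"
    by (rule sampled_bounds_dichotomy [OF N_pos a_pos a_summable G \<phi> \<psi> wr \<tau>K
          \<phi>_low [folded P_def] \<phi>_up [folded P_def] \<psi>_up [folded Q_def] P0 Q0 QP ratio PQ])
  define t where "t j = (cmod (1 + (of_real (\<sigma> * trace (R j)) + csqrt (of_real (discr (R j))))
      / of_real (2 * \<gamma> j)))\<^sup>2" for j
  have t_eq: "t j = (p j)\<^sup>2" if "j \<ge> K" for j
  proof -
    have root: "csqrt (of_real (discr (R j))) = of_real (sqrt (discr (R j)))"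
      by (rule of_real_sqrt [symmetric]) (use disc0 [OF K_ge(1) [OF that]] in simp)
    have "1 + (of_real (\<sigma> * trace (R j)) + csqrt (of_real (discr (R j)))) / of_real (2 * \<gamma> j)
        = complex_of_real (1 + (\<sigma> * trace (R j) + sqrt (discr (R j))) / (2 * \<gamma> j))"
      unfolding root by (simp only: of_real_add of_real_divide of_real_1)
    moreover have "1 + (\<sigma> * trace (R j) + sqrt (discr (R j))) / (2 * \<gamma> j) = p j"
    proof -
      have tr: "S 1 1 j + S 2 2 j = \<sigma> * trace (R j)"
        unfolding S_def trace_def sum_2 by (rule distrib_left [symmetric])
      show ?thesis unfolding p_def eig_plus_def discS \<epsilon>_def tr by (simp add: mult.commute)
    qed
    ultimately show ?thesis unfolding t_def by (simp only: norm_of_real power2_abs)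
  qed
  have t_prod: "(\<Prod>j=K..K + k. t j) = (P (Suc k + K))\<^sup>2" for k
  proof -
    have range: "{K..K + k} = {K..<Suc k + K}" by auto
    have "(\<Prod>j=K..<Suc k + K. t j) = (\<Prod>j=K..<Suc k + K. (p j)\<^sup>2)"
      by (rule prod.cong) (auto simp: t_eq)
    then show ?thesis unfolding range P_def prod_power_distrib .
  qed
  have base_iff: "summable (\<lambda>k. \<Prod>j=K..K + k. t j) \<longleftrightarrow> summable (\<lambda>n. (\<phi> n)\<^sup>2)"
  proof -
    have "summable (\<lambda>k. (P (Suc k + K))\<^sup>2) \<longleftrightarrow> summable (\<lambda>k. (P (k + K))\<^sup>2)"
      using summable_Suc_iff [of "\<lambda>k. (P (k + K))\<^sup>2"] by simp
    also have "\<dots> \<longleftrightarrow> summable (\<lambda>k. (P k)\<^sup>2)" by (rule summable_iff_shift)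
    finally show ?thesis unfolding t_prod \<phi>_iff .
  qed
  have t_nz: "t j \<noteq> 0" if "j \<ge> K" for j using t_eq [OF that] p0 [OF that] by simp
  have "(\<exists>n0\<ge>1. \<not> summable (\<lambda>k. \<Prod>j=n0..n0 + k. t j)) \<longleftrightarrow> \<not> summable (\<lambda>n. (\<phi> n)\<^sup>2)"
  proof
    assume "\<exists>n0\<ge>1. \<not> summable (\<lambda>k. \<Prod>j=n0..n0 + k. t j)"
    then show "\<not> summable (\<lambda>n. (\<phi> n)\<^sup>2)"
      using summable_tail_products [where m = K and t = t, OF _ t_nz] base_iff by blast
  next
    assume "\<not> summable (\<lambda>n. (\<phi> n)\<^sup>2)"
    then show "\<exists>n0\<ge>1. \<not> summable (\<lambda>k. \<Prod>j=n0..n0 + k. t j)"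
      using base_iff K_ge(2) [of K] by blast
  qed
  then show ?thesis
    using jacobi_dichotomy.self_adjoint_iff [OF dichotomy]
      jacobi_dichotomy.essential_spectrum_empty [OF dichotomy] unfolding t_def by blast
qed

end
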